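(* Let $A$ be a semisimple complex Banach algebra with identity. The following two assertions are equivalent. (I) For each linear functional $f$ on $\mathrm{Soc}\,A$, the following two conditions on $f$ are equivalent: (a) $f=\alpha\,\mathrm{Tr}$ for some $\alpha\in\mathbb{C}$; (b) $f(ab)=f(ba)$ for all $a,b\in \mathrm{Soc}\,A$. (II) For each finite-rank projection $p$ of $A$ there is an integer $n_p\ge 0$ such that $pAp\cong M_{n_p}(\mathbb{C})$, where $M_0(\mathbb{C})=\{0\}$.
   Context: $A$ is a semisimple complex Banach algebra with identity $\mathbf 1$. For $x\in A$, $\sigma(x)$ is the spectrum and $\sigma'(x)=\sigma(x)\setminus\{0\}$; $\#K$ denotes the number of elements of a set $K$. The rank of $a\in A$ is $\mathrm{rank}(a)=\sup_{x\in A}\#\sigma'(xa)\in\{0,1,2,\dots\}\cup\{\infty\}$. A projection is an idempotent $p=p^2\in A$. The socle $\mathrm{Soc}\,A$ is the two-sided ideal of all finite-rank elements of $A$ (it coincides with the usual socle, the sum of all minimal left ideals, and is $\{0\}$ if there are none). For $a\in \mathrm{Soc}\,A$ let $E(a)=\{x\in A:\#\sigma'(xa)=\mathrm{rank}(a)\}$, which is a dense open subset of $A$. For $a\in\mathrm{Soc}\,A$ and $\lambda\in\sigma(a)$, let $B(\lambda,r)$ be an open disk whose closure contains no point of $\sigma(a)$ other than $\lambda$; there is an open ball $U\subseteq A$ centered at $\mathbf 1$ such that $\#[\sigma(xa)\cap B(\lambda,r)]$ is constant for $x\in E(a)\cap U$, and this constant is the multiplicity $m(\lambda,a)$. The trace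 is $\mathrm{Tr}(a)=\sum_{\lambda\in\sigma(a)}\lambda\, m(\lambda,a)$ for $a\in\mathrm{Soc}\,A$; it is a linear functional on $\mathrm{Soc}\,A$. Linear functionals are complex-linear and not assumed continuous. The symbol $\cong$ denotes isomorphism as (complex) algebras. *)

theory Defs
  imports "HOL-Analysis.Analysis" "HOL-Library.Extended_Nat" "Jordan_Normal_Form.Matrix"
begin

text \<open>Unital complex Banach algebras. The norm of the unit is not required to be 1.\<close>

class complex_banach_algebra_1 = real_algebra_1 + real_normed_algebra + banach +
  fixes scaleC :: "complex \<Rightarrow> 'a \<Rightarrow> 'a"  (infixr "*\<^sub>C" 75)
  assumes scaleC_add_right: "c *\<^sub>C (x + y) = c *\<^sub>C x + c *\<^sub>C y"
    and scaleC_add_left: "(c + d) *\<^sub>C x = c *\<^sub>C x + d *\<^sub>C x"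
    and scaleC_scaleC: "c *\<^sub>C d *\<^sub>C x = (c * d) *\<^sub>C x"
    and scaleC_one: "1 *\<^sub>C x = x"
    and scaleR_scaleC: "r *\<^sub>R x = complex_of_real r *\<^sub>C x"
    and mult_scaleC_left: "(c *\<^sub>C x) * y = c *\<^sub>C (x * y)"
    and mult_scaleC_right: "x * (c *\<^sub>C y) = c *\<^sub>C (x * y)"
    and norm_scaleC: "norm (c *\<^sub>C x) = cmod c * norm x"

definition left_ideal :: "'a::ring_1 set \<Rightarrow> bool" where
  "left_ideal I \<longleftrightarrow> 0 \<in> I \<and> (\<forall>x\<in>I. \<forall>y\<in>I. x + y \<in> I) \<and> (\<forall>a. \<forall>x\<in>I. a * x \<in> I)"

definition maximal_left_ideal :: "'a::ring_1 set \<Rightarrow> bool" where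
  "maximal_left_ideal I \<longleftrightarrow>
     left_ideal I \<and> I \<noteq> UNIV \<and> (\<forall>J. left_ideal J \<and> I \<subseteq> J \<longrightarrow> J = I \<or> J = UNIV)"

definition jacobson_radical :: "'a::ring_1 set" where
  "jacobson_radical = \<Inter> {I. maximal_left_ideal I}"

definition semisimple_algebra :: "'a::complex_banach_algebra_1 itself \<Rightarrow> bool" where
  "semisimple_algebra _ \<longleftrightarrow> (jacobson_radical :: 'a set) = {0}"

definition two_sided_invertible :: "'a::ring_1 \<Rightarrow> bool" where
  "two_sided_invertible x \<longleftrightarrow> (\<exists>y. x * y = 1 \<and> y * x = 1)"

definition algebra_spectrum :: "'a::complex_banach_algebra_1 \<Rightarrow> complex set" where
  "algebra_spectrum x = {c. \<not> two_sided_invertible (c *\<^sub>C 1 - x)}"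

definition nonzero_spectrum :: "'a::complex_banach_algebra_1 \<Rightarrow> complex set" where
  "nonzero_spectrum x = algebra_spectrum x - {0}"

definition num_elements :: "'b set \<Rightarrow> enat" where
  "num_elements K = (if finite K then enat (card K) else \<infinity>)"

definition spectral_rank :: "'a::complex_banach_algebra_1 \<Rightarrow> enat" where
  "spectral_rank a = (SUP x. num_elements (nonzero_spectrum (x * a)))"

definition socle :: "'a::complex_banach_algebra_1 set" where
  "socle = {a. spectral_rank a < \<infinity>}"

definition rank_attaining :: "'a::complex_banach_algebra_1 \<Rightarrow> 'a set" where
  "rank_attaining a = {x. num_elements (nonzero_spectrum (x * a)) = spectral_rank a}"

text \<open>
  For \<open>a\<close> in the socle and \<open>c\<close> in its spectrum, the value below does not depend on the
  admissible radius \<open>r\<close>, whence the universal quantifier. It is unspecified for other arguments.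
\<close>

definition spectral_multiplicity :: "complex \<Rightarrow> 'a::complex_banach_algebra_1 \<Rightarrow> nat" where
  "spectral_multiplicity c a =
     (THE n. \<forall>r>0. cball c r \<inter> algebra_spectrum a \<subseteq> {c} \<longrightarrow>
        (\<exists>e>0. \<forall>x \<in> rank_attaining a \<inter> ball 1 e.
           num_elements (algebra_spectrum (x * a) \<inter> ball c r) = enat n))"

definition spectral_trace :: "'a::complex_banach_algebra_1 \<Rightarrow> complex" where
  "spectral_trace a = (\<Sum>c\<in>algebra_spectrum a. c * of_nat (spectral_multiplicity c a))"

text \<open>
  A functional on a subspace \<open>S\<close> is represented by a function on the whole algebra whose values
  outside \<open>S\<close> are irrelevant.
\<close>

definition linear_functional_on ::
    "'a::complex_banach_algebra_1 set \<Rightarrow> ('a \<Rightarrow> complex) \<Rightarrow> bool" where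
  "linear_functional_on S f \<longleftrightarrow>
     (\<forall>x\<in>S. \<forall>y\<in>S. f (x + y) = f x + f y) \<and> (\<forall>c. \<forall>x\<in>S. f (c *\<^sub>C x) = c * f x)"

definition corner :: "'a::complex_banach_algebra_1 \<Rightarrow> 'a set" where
  "corner p = {p * x * p | x. True}"

text \<open>
  Isomorphism of complex algebras between a subalgebra \<open>S\<close> and the algebra of \<open>n \<times> n\<close>
  complex matrices; for \<open>n = 0\<close> the latter consists of the single empty matrix. If \<open>S\<close> has
  a unit, such a bijection maps it to the identity matrix automatically.
\<close>

definition iso_matrix_algebra :: "'a::complex_banach_algebra_1 set \<Rightarrow> nat \<Rightarrow> bool" where
  "iso_matrix_algebra S n \<longleftrightarrow>
     (\<exists>\<phi> :: 'a \<Rightarrow> complex mat. bij_betw \<phi> S (carrier_mat n n) \<and>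
        (\<forall>x\<in>S. \<forall>y\<in>S. \<phi> (x + y) = \<phi> x + \<phi> y) \<and>
        (\<forall>x\<in>S. \<forall>y\<in>S. \<phi> (x * y) = \<phi> x * \<phi> y) \<and>
        (\<forall>c. \<forall>x\<in>S. \<phi> (c *\<^sub>C x) = c \<cdot>\<^sub>m \<phi> x))"

end

(*
  Every left ideal generated by a nonzero element of finite rank contains a nonzero idempotent,
  obtained by the holomorphic functional calculus at an isolated point of a finite spectrum, and
  the corner eAe of a primitive idempotent e of finite rank is one-dimensional because it is local
  with quasinilpotent radical. Hence every a in the socle satisfies a = ae, where e = ya is a sum
  of orthogonal minimal idempotents. Call minimal idempotents g, h linked if gAh is nonzero. Both
  assertions are equivalent to: any two minimal idempotents are linked.

  If they are linked, eAe is a full matrix algebra. The nonzero spectrum of xa consists of the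
  nonzero eigenvalues of the matrix of exa, and these are simple exactly for x in E(a). By
  continuity of the roots of the characteristic polynomial, m(c, a) is the algebraic multiplicity
  of c for the matrix of ea, so Tr(a) is its matrix trace, and any functional vanishing on
  commutators is a multiple of it. If g and h are not linked, the trace of the component of h
  vanishes on commutators and separates g from h, whereas Tr(g) = Tr(h) = 1.
*)

theory Submission
  imports Defs "Jordan_Normal_Form.Schur_Decomposition"
begin

section \<open>Quasinilpotent elements\<close>

text \<open>The idempotent of the functional calculus is built without contour integrals. A
  polynomial \<open>h\<close> with value 1 at \<open>l\<close> and 0 on the rest of the finite
  spectrum makes \<open>u = h(b)\<close> idempotent up to the quasinilpotent
  \<open>w = u * u - u\<close>, and the binomial series of exponent -1/2 in \<open>4 w\<close>
  corrects \<open>2 u - 1\<close> to an involution. The one analytic fact behind this is that an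
  element without nonzero spectrum is quasinilpotent. The socle is defined through spectra, so even
  its closure under addition is not evident; it comes from the criterion that \<open>z\<close> has
  finite rank if \<open>z A z\<close> is finite-dimensional. Zero is exceptional: the matrices
  determine only the nonzero spectrum, and the multiplicity of 0 need not be computed because it has
  weight 0 in the trace. Assertion (II) gives linkedness because any two minimal idempotents lie in
  the corner of one finite-rank projection, and a full matrix algebra is prime.\<close>

interpretation complex_scale: vector_space
  "scaleC :: complex \<Rightarrow> 'a \<Rightarrow> 'a::complex_banach_algebra_1"
  by unfold_locales (simp_all add: scaleC_add_right scaleC_add_left scaleC_scaleC scaleC_one)

lemma power_scaleC: "(c *\<^sub>C (x::'a::complex_banach_algebra_1)) ^ n = (c ^ n) *\<^sub>C (x ^ n)"
  by (induction n) (simp_all add: mult_scaleC_left mult_scaleC_right)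

lemma invertible_if_left_right:
  fixes x :: "'a::ring_1"
  assumes "l * x = 1" and "x * r = 1"
  shows "two_sided_invertible x"
proof -
  have "l = r"
    using assms by (metis mult.assoc mult_1_left mult_1_right)
  then show ?thesis
    using assms unfolding two_sided_invertible_def by blast
qed

lemma invertible_mult:
  fixes x y :: "'a::ring_1"
  assumes "two_sided_invertible x" and "two_sided_invertible y"
  shows "two_sided_invertible (x * y)"
proof -
  obtain x' where x': "x * x' = 1" "x' * x = 1"
    using assms(1) unfolding two_sided_invertible_def by blast
  obtain y' where y': "y * y' = 1" "y' * y = 1"
    using assms(2) unfolding two_sided_invertible_def by blast
  have "(y' * x') * (x * y) = y' * (x' * x) * y" "(x * y) * (y' * x') = x * (y * y') * x'"
    by (simp_all only: mult.assoc)
  then show ?thesis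
    using x' y' by (intro invertible_if_left_right[of "y' * x'" _ "y' * x'"]) simp_all
qed

lemma invertible_commuting_factor:
  fixes x y :: "'a::ring_1"
  assumes "x * y = y * x" and "two_sided_invertible (x * y)"
  shows "two_sided_invertible x"
proof -
  obtain z where z: "x * y * z = 1" "z * (x * y) = 1"
    using assms(2) unfolding two_sided_invertible_def by blast
  show ?thesis
  proof (rule invertible_if_left_right)
    show "(z * y) * x = 1"
      using z(2) assms(1) by (simp only: mult.assoc)
    show "x * (y * z) = 1"
      using z(1) by (simp only: mult.assoc)
  qed
qed

lemma invertible_scaleC_iff:
  fixes x :: "'a::complex_banach_algebra_1"
  assumes "c \<noteq> 0"
  shows "two_sided_invertible (c *\<^sub>C x) \<longleftrightarrow> two_sided_invertible x"
proof -
  have *: "two_sided_invertible (c *\<^sub>C x)" if inv: "two_sided_invertible x" and c: "c \<noteq> 0" for c and x :: 'a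
  proof -
    obtain y where y: "x * y = 1" "y * x = 1"
      using inv unfolding two_sided_invertible_def by blast
    show ?thesis
      by (rule invertible_if_left_right[of "inverse c *\<^sub>C y" _ "inverse c *\<^sub>C y"])
        (use y c in \<open>simp_all add: mult_scaleC_left mult_scaleC_right scaleC_scaleC scaleC_one\<close>)
  qed
  have "x = inverse c *\<^sub>C c *\<^sub>C x"
    using assms by (simp add: scaleC_scaleC scaleC_one)
  then show ?thesis
    using *[of x c] *[of "c *\<^sub>C x" "inverse c"] assms by auto
qed

lemma spectrum_iff_one_minus:
  fixes x :: "'a::complex_banach_algebra_1"
  assumes "c \<noteq> 0"
  shows "c \<in> algebra_spectrum x \<longleftrightarrow> \<not> two_sided_invertible (1 - inverse c *\<^sub>C x)"
proof -
  have "c *\<^sub>C 1 - x = c *\<^sub>C (1 - inverse c *\<^sub>C x)"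
    using assms by (simp add: complex_scale.scale_right_diff_distrib scaleC_scaleC scaleC_one)
  then show ?thesis
    using invertible_scaleC_iff[OF assms, of "1 - inverse c *\<^sub>C x"]
    by (simp add: algebra_spectrum_def)
qed

text \<open>Jacobson's lemma. The inverse \<open>1 + y * z * x\<close> is what the formal geometric
  series suggests: \<open>1 + y (1 + x y + ...) x\<close>.\<close>

lemma invertible_one_minus_mult_commute:
  fixes x y :: "'a::ring_1"
  assumes "two_sided_invertible (1 - x * y)"
  shows "two_sided_invertible (1 - y * x)"
proof -
  obtain z where z: "(1 - x * y) * z = 1" "z * (1 - x * y) = 1"
    using assms unfolding two_sided_invertible_def by blast
  have "(1 + y * z * x) * (1 - y * x) = 1 - y * x + y * (z * (1 - x * y)) * x"
    "(1 - y * x) * (1 + y * z * x) = 1 - y * x + y * ((1 - x * y) * z) * x"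
    by (simp_all add: algebra_simps)
  then have "(1 + y * z * x) * (1 - y * x) = 1" "(1 - y * x) * (1 + y * z * x) = 1"
    by (simp_all add: z)
  then show ?thesis
    unfolding two_sided_invertible_def by blast
qed

lemma nonzero_spectrum_commute:
  fixes x y :: "'a::complex_banach_algebra_1"
  shows "nonzero_spectrum (x * y) = nonzero_spectrum (y * x)"
proof -
  have "two_sided_invertible (1 - c *\<^sub>C (x * y)) \<Longrightarrow> two_sided_invertible (1 - c *\<^sub>C (y * x))"
    for c and x y :: 'a
    using invertible_one_minus_mult_commute[of "c *\<^sub>C x" y]
    by (simp add: mult_scaleC_left mult_scaleC_right)
  then show ?thesis
    unfolding nonzero_spectrum_def by (auto simp: spectrum_iff_one_minus)
qed

lemma one_minus_power_factor:
  fixes x :: "'a::ring_1"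
  shows "(\<Sum>i<n. x ^ i) * (1 - x) = 1 - x ^ n"
proof (induction n)
  case (Suc n)
  have "(\<Sum>i<Suc n. x ^ i) * (1 - x) = (\<Sum>i<n. x ^ i) * (1 - x) + x ^ n * (1 - x)"
    by (simp add: distrib_right)
  also have "\<dots> = 1 - x ^ Suc n"
    by (simp only: Suc.IH) (simp add: right_diff_distrib power_commutes)
  finally show ?case .
qed simp

text \<open>The \<open>k\<close>-th powers again form a geometric progression, whose ratio differs
  from 1 because \<open>k / n\<close> lies strictly between 0 and 1.\<close>

lemma sum_powers_root_of_unity:
  assumes "0 < k" and "k < n"
  shows "(\<Sum>j<n. (cis (2 * pi / n) ^ j) ^ k) = 0"
proof -
  define w where "w = cis (2 * pi * k / n)"
  have "w \<noteq> 1"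
  proof
    assume "w = 1"
    then have "Re (cis (2 * pi * k / n)) = Re 1"
      by (simp only: w_def)
    then have "cos (2 * pi * k / n) = 1"
      by simp
    then obtain m :: int where "2 * pi * k / n = real_of_int m * 2 * pi"
      using cos_one_2pi_int by blast
    then have "(2 * pi) * (real k / n) = (2 * pi) * real_of_int m"
      by (simp add: mult_ac)
    then have "real k / n = m"
      by (subst (asm) mult_left_cancel) auto
    moreover have "0 < real k / n" "real k / n < 1"
      using assms by simp_all
    ultimately have "0 < m" "m < 1"
      by simp_all
    then show False
      by simp
  qed
  moreover have "w ^ n = 1"
    using assms by (simp add: w_def Complex.DeMoivre cis_multiple_2pi[of "of_nat k"])
  moreover have "(cis (2 * pi / n) ^ j) ^ k = w ^ j" for j
    by (simp add: w_def Complex.DeMoivre power_mult[symmetric] algebra_simps)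
  ultimately show ?thesis
    using one_minus_power_factor[of w n] by simp
qed

text \<open>This says that the \<open>n\<close>-th roots of \<open>norm (x ^ n)\<close> tend to 0.
  Powers of \<open>r\<close> replace the roots so that geometric comparison applies
  directly.\<close>

definition quasinilpotent :: "'a::complex_banach_algebra_1 \<Rightarrow> bool" where
  "quasinilpotent x \<longleftrightarrow> (\<forall>r\<ge>0. (\<lambda>n. r ^ n * norm (x ^ n)) \<longlonglongrightarrow> 0)"

text \<open>
  Averaging the resolvent over the circle of radius \<open>t\<close> at the \<open>n\<close>-th roots of unity gives
  \<open>(1 - t\<^sup>n x\<^sup>n)\<^sup>-\<^sup>1\<close>. These averages are Lipschitz in \<open>t\<close> uniformly in \<open>n\<close>, so that
  \<open>t\<^sup>n x\<^sup>n \<longlonglongrightarrow> 0\<close> propagates from \<open>t = 0\<close> by steps of a fixed length; no integration of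
  vector-valued functions is needed.
\<close>

lemma average_resolvent:
  fixes x :: "'a::complex_banach_algebra_1"
  assumes R: "\<And>c. (1 - c *\<^sub>C x) * R c = 1" and n: "0 < n"
  shows "(1 - (t *\<^sub>C x) ^ n) * (\<Sum>j<n. R (t * cis (2 * pi / n) ^ j)) = of_nat n *\<^sub>C 1"
proof -
  define w where "w = cis (2 * pi / n)"
  define z where "z = t *\<^sub>C x"
  have wn: "(w ^ j) ^ n = 1" for j
  proof -
    have "real n * (2 * pi / real n) = 2 * pi"
      using n by simp
    then have "w ^ n = 1"
      by (simp only: w_def Complex.DeMoivre cis_2pi)
    then show ?thesis
      by (metis mult.commute power_mult power_one)
  qed
  have "(1 - z ^ n) * R (t * w ^ j) = (\<Sum>k<n. (w ^ j) ^ k *\<^sub>C z ^ k)" for j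
  proof -
    have "1 - z ^ n = 1 - (w ^ j *\<^sub>C z) ^ n"
      by (simp add: power_scaleC wn scaleC_one)
    also have "\<dots> = (\<Sum>k<n. (w ^ j *\<^sub>C z) ^ k) * (1 - w ^ j *\<^sub>C z)"
      by (simp add: one_minus_power_factor)
    finally have "(1 - z ^ n) * R (t * w ^ j) = (\<Sum>k<n. (w ^ j *\<^sub>C z) ^ k) * ((1 - w ^ j *\<^sub>C z) * R (t * w ^ j))"
      by (simp add: mult.assoc)
    also have "(1 - w ^ j *\<^sub>C z) * R (t * w ^ j) = 1"
      using R[of "t * w ^ j"] by (simp add: z_def scaleC_scaleC mult.commute)
    finally show ?thesis
      by (simp add: power_scaleC)
  qed
  then have "(1 - z ^ n) * (\<Sum>j<n. R (t * w ^ j)) = (\<Sum>j<n. \<Sum>k<n. (w ^ j) ^ k *\<^sub>C z ^ k)"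
    by (simp add: sum_distrib_left)
  also have "\<dots> = (\<Sum>k<n. (\<Sum>j<n. (w ^ j) ^ k) *\<^sub>C z ^ k)"
    by (subst sum.swap) (simp add: complex_scale.scale_sum_left)
  also have "\<dots> = (\<Sum>k<n. if k = 0 then of_nat n *\<^sub>C 1 else 0)"
  proof (rule sum.cong[OF refl])
    fix k assume "k \<in> {..<n}"
    then show "(\<Sum>j<n. (w ^ j) ^ k) *\<^sub>C z ^ k = (if k = 0 then of_nat n *\<^sub>C 1 else 0)"
      using sum_powers_root_of_unity[of k n] by (auto simp: w_def)
  qed
  also have "\<dots> = of_nat n *\<^sub>C 1"
    using n by (simp add: sum.delta)
  finally show ?thesis
    by (simp add: z_def w_def)
qed

text \<open>The resolvent identity bounds \<open>R c - R d\<close> by \<open>cmod (c - d)\<close>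
  times the norms of \<open>R c\<close> and \<open>R d\<close>. It first yields continuity, then
  compactness of the disk yields a uniform bound, and the identity used once more gives the
  Lipschitz constant.\<close>

lemma resolvent_bound_lipschitz:
  fixes x :: "'a::complex_banach_algebra_1"
  assumes R: "\<And>c. (1 - c *\<^sub>C x) * R c = 1" "\<And>c. R c * (1 - c *\<^sub>C x) = 1"
  obtains M L where "0 < L" "\<And>c. cmod c \<le> \<rho> \<Longrightarrow> norm (R c) \<le> M"
    "\<And>c d. cmod c \<le> \<rho> \<Longrightarrow> cmod d \<le> \<rho> \<Longrightarrow> norm (R c - R d) \<le> L * cmod (c - d)"
proof -
  have id: "R c - R d = (c - d) *\<^sub>C (R c * x * R d)" for c d
  proof -
    have "R c - R d = R c * ((1 - d *\<^sub>C x) * R d) - (R c * (1 - c *\<^sub>C x)) * R d"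
      by (simp add: R)
    also have "\<dots> = R c * ((1 - d *\<^sub>C x) - (1 - c *\<^sub>C x)) * R d"
      by (simp add: algebra_simps)
    also have "(1 - d *\<^sub>C x) - (1 - c *\<^sub>C x) = (c - d) *\<^sub>C x"
      by (simp add: complex_scale.scale_left_diff_distrib)
    finally show ?thesis
      by (simp add: mult_scaleC_left mult_scaleC_right)
  qed
  have le: "norm (R c - R d) \<le> cmod (c - d) * (norm (R c) * norm x * norm (R d))" for c d
    unfolding id norm_scaleC
    by (intro mult_left_mono order.trans[OF norm_mult_ineq] mult_right_mono norm_mult_ineq) auto
  have "isCont R d" for d
  proof -
    define K where "K = norm x * norm (R d) + 1"
    have K: "0 < K"
      by (simp add: K_def add_nonneg_pos)
    \<comment> \<open>Within distance \<open>1 / (2 * K)\<close> the identity gives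
      \<open>norm (R c) - norm (R d) \<le> norm (R c) / 2\<close>, so the unknown
      \<open>norm (R c)\<close> can be absorbed.\<close>
    have near: "norm (R c - R d) \<le> cmod (c - d) * (2 * norm (R d) * K)"
      if "cmod (c - d) < 1 / (2 * K)" for c
    proof -
      have "norm (R c) - norm (R d) \<le> norm (R c - R d)"
        by (rule norm_triangle_ineq2)
      also have "\<dots> \<le> (cmod (c - d) * (norm x * norm (R d))) * norm (R c)"
        using le[of c d] by (simp add: algebra_simps)
      also have "\<dots> \<le> (cmod (c - d) * K) * norm (R c)"
        by (intro mult_right_mono mult_left_mono) (simp_all add: K_def)
      also have "\<dots> \<le> (1 / 2) * norm (R c)"
      proof (rule mult_right_mono)
        show "cmod (c - d) * K \<le> 1 / 2"
          using that K by (simp add: field_simps)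
      qed simp
      finally have "norm (R c) \<le> 2 * norm (R d)"
        by simp
      then have "norm (R c) * (norm x * norm (R d)) \<le> 2 * norm (R d) * K"
        by (intro mult_mono) (simp_all add: K_def)
      then show ?thesis
        using le[of c d] by (smt (verit) mult.assoc mult_left_mono norm_ge_zero)
    qed
    have "((\<lambda>c. R c - R d) \<longlongrightarrow> 0) (at d)"
    proof (rule Lim_null_comparison)
      show "\<forall>\<^sub>F c in at d. norm (R c - R d) \<le> cmod (c - d) * (2 * norm (R d) * K)"
        unfolding eventually_at using near K
        by (intro exI[of _ "1 / (2 * K)"]) (auto simp: dist_norm)
      show "((\<lambda>c. cmod (c - d) * (2 * norm (R d) * K)) \<longlongrightarrow> 0) (at d)"
        by (rule tendsto_eq_intros refl | simp)+
    qed
    then show ?thesis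
      unfolding isCont_def using LIM_zero_cancel by blast
  qed
  then have "continuous_on (cball 0 \<rho>) R"
    by (simp add: continuous_at_imp_continuous_on)
  then have "bounded (R ` cball 0 \<rho>)"
    using compact_continuous_image compact_imp_bounded compact_cball by blast
  then obtain M where "\<forall>y\<in>R ` cball 0 \<rho>. norm y \<le> M"
    unfolding bounded_iff by blast
  then have M: "norm (R c) \<le> M" if "cmod c \<le> \<rho>" for c
    using that by auto
  show thesis
  proof
    show "0 < \<bar>M\<bar> * norm x * \<bar>M\<bar> + 1"
      by (simp add: add_nonneg_pos)
    show "norm (R c) \<le> M" if "cmod c \<le> \<rho>" for c
      by (rule M[OF that])
    show "norm (R c - R d) \<le> (\<bar>M\<bar> * norm x * \<bar>M\<bar> + 1) * cmod (c - d)"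
      if "cmod c \<le> \<rho>" "cmod d \<le> \<rho>" for c d
    proof -
      have "norm (R c) * norm x * norm (R d) \<le> \<bar>M\<bar> * norm x * \<bar>M\<bar>"
        using M[OF that(1)] M[OF that(2)] by (intro mult_mono) auto
      then have "cmod (c - d) * (norm (R c) * norm x * norm (R d)) \<le> cmod (c - d) * (\<bar>M\<bar> * norm x * \<bar>M\<bar> + 1)"
        by (intro mult_left_mono) auto
      then show ?thesis
        using le[of c d] by (simp add: mult.commute)
    qed
  qed
qed

lemma quasinilpotent_if_resolvent_everywhere:
  fixes x :: "'a::complex_banach_algebra_1"
  assumes inv: "\<And>c. two_sided_invertible (1 - c *\<^sub>C x)"
  shows "quasinilpotent x"
proof -
  have "\<forall>c. \<exists>y. (1 - c *\<^sub>C x) * y = 1 \<and> y * (1 - c *\<^sub>C x) = 1"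
    using inv unfolding two_sided_invertible_def by blast
  then obtain R where R: "\<And>c. (1 - c *\<^sub>C x) * R c = 1" "\<And>c. R c * (1 - c *\<^sub>C x) = 1"
    by metis
  have "(\<lambda>n. r ^ n * norm (x ^ n)) \<longlonglongrightarrow> 0" if "0 \<le> r" for r
  proof -
    obtain M L where L: "0 < L" and M: "\<And>c. cmod c \<le> r + 1 \<Longrightarrow> norm (R c) \<le> M"
      and lip: "\<And>c d. cmod c \<le> r + 1 \<Longrightarrow> cmod d \<le> r + 1 \<Longrightarrow> norm (R c - R d) \<le> L * cmod (c - d)"
      using resolvent_bound_lipschitz[of x R "r + 1"] R by metis
    \<comment> \<open>With \<open>4 * L\<close> the average moves by at most 1/4 when the radius
      grows by \<open>\<delta>\<close>; \<open>\<delta> \<le> 1\<close> keeps the radius within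
      \<open>r + 1\<close>, where the bounds hold.\<close>
    define \<delta> where "\<delta> = min 1 (1 / (4 * L))"
    have \<delta>: "0 < \<delta>" "\<delta> \<le> 1" "L * \<delta> \<le> 1 / 4"
      using L by (auto simp: \<delta>_def min_def field_simps)
    define F where "F n t = inverse (of_nat n) *\<^sub>C (\<Sum>j<n. R (of_real t * cis (2 * pi / n) ^ j))" for n t
    define T where "T t \<longleftrightarrow> (\<lambda>n. t ^ n * norm (x ^ n)) \<longlonglongrightarrow> 0" for t
    have F1: "(1 - (of_real t *\<^sub>C x) ^ n) * F n t = 1" if "0 < n" for n t
      using average_resolvent[of x R n "of_real t", OF R(1) that] that
      unfolding F_def by (simp add: mult_scaleC_right scaleC_scaleC scaleC_one)
    have cm: "cmod (of_real t * cis (2 * pi / n) ^ j) = \<bar>t\<bar>" for t n j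
      by (simp add: norm_mult norm_power)
    have avg: "norm (inverse (of_nat n) *\<^sub>C (\<Sum>j<n. g j)) \<le> B"
      if "0 < n" "\<And>j. norm (g j) \<le> B" for n B and g :: "nat \<Rightarrow> 'a"
    proof -
      have "norm (\<Sum>j<n. g j) \<le> of_nat (card {..<n}) * B"
        by (rule sum_norm_bound) (use that in auto)
      moreover have "norm (inverse (of_nat n) *\<^sub>C (\<Sum>j<n. g j)) = norm (\<Sum>j<n. g j) / n"
        by (simp add: norm_scaleC norm_inverse divide_inverse mult.commute)
      moreover have "norm (\<Sum>j<n. g j) / n \<le> B" if "norm (\<Sum>j<n. g j) \<le> of_nat (card {..<n}) * B"
        using that \<open>0 < n\<close> by (simp add: divide_le_eq mult.commute)
      ultimately show ?thesis
        by simp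
    qed
    have FM: "norm (F n t) \<le> M" if "0 < n" "0 \<le> t" "t \<le> r + 1" for n t
      unfolding F_def by (rule avg) (use that M cm in auto)
    have FL: "norm (F n t - F n s) \<le> L * \<bar>t - s\<bar>"
      if "0 < n" "0 \<le> t" "t \<le> r + 1" "0 \<le> s" "s \<le> r + 1" for n s t
    proof -
      have "F n t - F n s = inverse (of_nat n) *\<^sub>C (\<Sum>j<n. R (of_real t * cis (2 * pi / n) ^ j)
          - R (of_real s * cis (2 * pi / n) ^ j))"
        unfolding F_def by (simp add: complex_scale.scale_right_diff_distrib sum_subtractf)
      also have "norm \<dots> \<le> L * \<bar>t - s\<bar>"
      proof (rule avg[OF that(1)])
        fix j
        have "cmod (of_real t * cis (2 * pi / n) ^ j - of_real s * cis (2 * pi / n) ^ j) = \<bar>t - s\<bar>"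
          using cm[of "t - s" n j] by (simp add: left_diff_distrib)
        then show "norm (R (of_real t * cis (2 * pi / n) ^ j) - R (of_real s * cis (2 * pi / n) ^ j)) \<le> L * \<bar>t - s\<bar>"
          using lip[of "of_real t * cis (2 * pi / n) ^ j" "of_real s * cis (2 * pi / n) ^ j"]
            cm[of t n j] cm[of s n j] that by simp
      qed
      finally show ?thesis .
    qed
    have nx: "norm ((of_real t *\<^sub>C x) ^ n) = t ^ n * norm (x ^ n)" if "0 \<le> t" for t n
      using that by (simp add: power_scaleC norm_scaleC norm_power)
    \<comment> \<open>For large \<open>n\<close> the average at radius \<open>t\<close> is within
      1/4 of 1, hence within 1/2 of 1 at \<open>t + \<delta>\<close>. This bounds the powers of
      \<open>x\<close> there, and the bound becomes convergence at the strictly smaller radius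
      \<open>s\<close>.\<close>
    have step: "T s" if T: "T t" and t: "0 \<le> t" "t \<le> r" and s: "0 \<le> s" "s \<le> t + \<delta> / 2" for s t
    proof -
      have "(\<lambda>n. t ^ n * norm (x ^ n) * M) \<longlonglongrightarrow> 0"
        using tendsto_mult_left_zero T unfolding T_def by blast
      then have "\<forall>\<^sub>F n in sequentially. dist (t ^ n * norm (x ^ n) * M) 0 < 1 / 4"
        by (rule tendstoD) simp
      then have "\<forall>\<^sub>F n in sequentially. \<bar>t ^ n * norm (x ^ n) * M\<bar> < 1 / 4"
        by (simp only: dist_norm diff_zero real_norm_def)
      then have bd: "\<forall>\<^sub>F n in sequentially. (t + \<delta>) ^ n * norm (x ^ n) \<le> norm (1::'a)"
        using eventually_gt_at_top[of 0]
      proof eventually_elim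
        case (elim n)
        define u where "u = F n (t + \<delta>)"
        define y where "y = (of_real (t + \<delta>) *\<^sub>C x) ^ n"
        have tr: "t + \<delta> \<le> r + 1" "t \<le> r + 1" "0 \<le> t + \<delta>"
          using t \<delta> by auto
        have "F n t - 1 = (of_real t *\<^sub>C x) ^ n * F n t"
          using F1[OF elim(2), of t] by (simp add: algebra_simps)
        then have "norm (F n t - 1) \<le> (t ^ n * norm (x ^ n)) * M"
          using norm_mult_ineq[of "(of_real t *\<^sub>C x) ^ n" "F n t"] FM[OF elim(2) t(1) tr(2)] t(1)
          by (smt (verit) mult_left_mono norm_ge_zero nx)
        then have "norm (F n t - 1) \<le> 1 / 4"
          using elim(1) by linarith
        moreover have "norm (u - F n t) \<le> 1 / 4"
          using FL[OF elim(2) tr(3) tr(1) t(1) tr(2)] \<delta> unfolding u_def by simp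
        ultimately have u: "norm (u - 1) \<le> 1 / 2"
          using norm_triangle_ineq[of "u - F n t" "F n t - 1"] by simp
        have "(1 - y) * u = 1"
          using F1[OF elim(2), of "t + \<delta>"] by (simp add: u_def y_def)
        \<comment> \<open>This leads to \<open>norm y \<le> (norm 1 + norm y) / 2\<close>, which is
          solved for \<open>norm y\<close>; \<open>norm 1\<close> may differ from 1.\<close>
        then have "y = (1 - y) * (u - 1)"
          by (simp add: right_diff_distrib)
        then have "norm y \<le> norm (1 - y) * norm (u - 1)"
          using norm_mult_ineq by metis
        also have "\<dots> \<le> norm (1 - y) * (1 / 2)"
          by (intro mult_left_mono u) simp
        also have "norm (1 - y) \<le> norm (1::'a) + norm y"
          by (rule norm_triangle_ineq4)
        finally have "norm y \<le> norm (1::'a)"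
          by simp
        then show ?case
          unfolding y_def using nx[OF tr(3)] by simp
      qed
      have td: "0 < t + \<delta>"
        using t \<delta> by simp
      define q where "q = s / (t + \<delta>)"
      have q: "0 \<le> q" "q < 1"
        using s t \<delta> by (simp_all add: q_def field_simps)
      have "(\<lambda>n. q ^ n * norm (1::'a)) \<longlonglongrightarrow> 0"
        using LIMSEQ_realpow_zero[OF q] by (rule tendsto_mult_left_zero)
      moreover have "\<forall>\<^sub>F n in sequentially. norm (s ^ n * norm (x ^ n)) \<le> q ^ n * norm (1::'a)"
        using bd
      proof eventually_elim
        case (elim n)
        have "s ^ n = q ^ n * (t + \<delta>) ^ n"
          using td by (simp add: q_def flip: power_mult_distrib)
        then have "s ^ n * norm (x ^ n) = q ^ n * ((t + \<delta>) ^ n * norm (x ^ n))"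
          by simp
        also have "\<dots> \<le> q ^ n * norm (1::'a)"
          by (intro mult_left_mono elim) (use q in simp)
        finally show ?case
          using s(1) by simp
      qed
      ultimately show ?thesis
        unfolding T_def by (rule Lim_null_comparison[rotated])
    qed
    \<comment> \<open>Steps have length \<open>\<delta> / 2\<close> and not \<open>\<delta>\<close>:
      the other half is the margin that makes \<open>q < 1\<close>.\<close>
    have all: "T s" if "0 \<le> s" "s \<le> r" "s \<le> real k * (\<delta> / 2)" for s k
      using that
    proof (induction k arbitrary: s)
      case 0
      then have "s = 0"
        by simp
      then have "\<forall>\<^sub>F n in sequentially. s ^ n * norm (x ^ n) = 0"
        by (intro eventually_mono[OF eventually_gt_at_top[of 0]]) simp
      then show ?case
        unfolding T_def by (rule tendsto_eventually)
    next
      case (Suc k)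
      have "T (max 0 (s - \<delta> / 2))"
      proof (rule Suc.IH)
        have "0 \<le> real k * (\<delta> / 2)"
          using \<delta>(1) by simp
        moreover have "s - \<delta> / 2 \<le> real k * (\<delta> / 2)"
          using Suc.prems(3) by (simp add: algebra_simps)
        ultimately show "max 0 (s - \<delta> / 2) \<le> real k * (\<delta> / 2)"
          by (rule max.boundedI)
      qed (use Suc.prems \<delta>(1) in auto)
      then show ?case
        by (rule step) (use Suc.prems \<delta>(1) in auto)
    qed
    obtain k where "r < real k * (\<delta> / 2)"
      using reals_Archimedean3[of "\<delta> / 2"] \<delta>(1) by auto
    then have "T r"
      using all[of r k] that by simp
    then show ?thesis
      by (simp only: T_def)
  qed
  then show ?thesis
    by (simp add: quasinilpotent_def)
qed

lemma quasinilpotent_if_spectrum: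
  fixes x :: "'a::complex_banach_algebra_1"
  assumes "nonzero_spectrum x = {}"
  shows "quasinilpotent x"
proof (rule quasinilpotent_if_resolvent_everywhere)
  fix c :: complex
  show "two_sided_invertible (1 - c *\<^sub>C x)"
  proof (cases "c = 0")
    case True
    then show ?thesis
      by (simp add: invertible_if_left_right[of 1])
  next
    case False
    then show ?thesis
      using assms spectrum_iff_one_minus[of "inverse c" x] by (auto simp: nonzero_spectrum_def)
  qed
qed

section \<open>Neumann series and their use for quasinilpotent elements\<close>

lemma neumann_series:
  fixes x :: "'a::{real_normed_algebra,ring_1,banach}"
  assumes "summable (\<lambda>n. norm (x ^ n))"
  shows "(1 - x) * (\<Sum>n. x ^ n) = 1" and "(\<Sum>n. x ^ n) * (1 - x) = 1"
proof -
  define S where "S = (\<Sum>n. x ^ n)"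
  have sm: "summable (\<lambda>n. x ^ n)"
    by (rule summable_norm_cancel[OF assms])
  have "S = 1 + (\<Sum>n. x ^ Suc n)"
    using suminf_split_head[OF sm] unfolding S_def by simp
  moreover have "(\<Sum>n. x ^ Suc n) = x * S"
    unfolding S_def using suminf_mult[OF sm, of x] by simp
  moreover have "(\<Sum>n. x ^ Suc n) = S * x"
    unfolding S_def using suminf_mult2[OF sm, of x] by (simp add: power_commutes)
  ultimately show "(1 - x) * (\<Sum>n. x ^ n) = 1" "(\<Sum>n. x ^ n) * (1 - x) = 1"
    unfolding S_def[symmetric] by (simp_all add: algebra_simps)
qed

lemma invertible_one_minus_if_summable:
  fixes x :: "'a::complex_banach_algebra_1"
  assumes "summable (\<lambda>n. norm (x ^ n))"
  shows "two_sided_invertible (1 - x)"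
  using neumann_series[OF assms] unfolding two_sided_invertible_def by blast

text \<open>The factor \<open>norm 1\<close> accounts for \<open>n = 0\<close>, since the norm of
  the unit is not normalised.\<close>

lemma norm_power_le:
  fixes x :: "'a::{real_normed_algebra,monoid_mult}"
  shows "norm (x ^ n) \<le> norm (1::'a) * norm x ^ n"
proof (induction n)
  case (Suc n)
  have "norm (x ^ Suc n) \<le> norm x * norm (x ^ n)"
    by (simp add: norm_mult_ineq)
  also have "\<dots> \<le> norm x * (norm (1::'a) * norm x ^ n)"
    by (intro mult_left_mono Suc.IH) simp
  finally show ?case
    by (simp add: ac_simps)
qed simp

lemma invertible_one_minus_if_norm_less:
  fixes x :: "'a::complex_banach_algebra_1"
  assumes "norm x < 1"
  shows "two_sided_invertible (1 - x)"
proof (rule invertible_one_minus_if_summable)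
  show "summable (\<lambda>n. norm (x ^ n))"
    by (rule summable_comparison_test'[of "\<lambda>n. norm (1::'a) * norm x ^ n"])
      (use assms norm_power_le[of x] in \<open>auto intro!: summable_mult summable_geometric\<close>)
qed

lemma spectrum_bound:
  fixes x :: "'a::complex_banach_algebra_1"
  assumes "c \<in> algebra_spectrum x"
  shows "cmod c \<le> norm x"
proof (rule ccontr)
  assume "\<not> cmod c \<le> norm x"
  then have c: "norm x < cmod c" "c \<noteq> 0"
    by (auto dest: le_less_trans[OF norm_ge_zero])
  have "norm (inverse c *\<^sub>C x) = norm x / cmod c"
    by (simp add: norm_scaleC norm_inverse divide_inverse mult.commute)
  with c have "norm (inverse c *\<^sub>C x) < 1"
    by simp
  then show False
    using assms c(2) invertible_one_minus_if_norm_less spectrum_iff_one_minus by blast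
qed

lemma quasinilpotent_summable:
  fixes x :: "'a::complex_banach_algebra_1"
  assumes "quasinilpotent x" and r: "0 \<le> r"
  shows "summable (\<lambda>n. r ^ n * norm (x ^ n))"
proof -
  \<comment> \<open>Convergence at the radius \<open>2 * r\<close> leaves the summable factor
    \<open>(1 / 2) ^ n\<close> at \<open>r\<close>.\<close>
  have "(\<lambda>n. (2 * r) ^ n * norm (x ^ n)) \<longlonglongrightarrow> 0"
    by (rule assms(1)[unfolded quasinilpotent_def, rule_format]) (use r in simp)
  then have "\<forall>\<^sub>F n in sequentially. dist ((2 * r) ^ n * norm (x ^ n)) 0 < 1"
    by (rule tendstoD) simp
  then have "\<forall>\<^sub>F n in sequentially. norm ((2 * r) ^ n * norm (x ^ n)) < 1"
    by (simp only: dist_norm diff_zero)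
  then have "\<forall>\<^sub>F n in sequentially. norm (r ^ n * norm (x ^ n)) \<le> (1 / 2) ^ n"
  proof eventually_elim
    case (elim n)
    have "(1 / 2) ^ n * ((2 * r) ^ n * norm (x ^ n)) \<le> (1 / 2) ^ n * 1"
      by (intro mult_left_mono) (use elim r in auto)
    then show ?case
      using r by (simp add: power_mult_distrib field_simps)
  qed
  then show ?thesis
    by (rule summable_comparison_test_ev) (simp add: summable_geometric)
qed

lemma quasinilpotent_invertible:
  fixes x :: "'a::complex_banach_algebra_1"
  assumes "quasinilpotent x"
  shows "two_sided_invertible (1 - c *\<^sub>C x)"
  using quasinilpotent_summable[OF assms, of "cmod c"]
  by (intro invertible_one_minus_if_summable) (simp add: power_scaleC norm_scaleC norm_power)

lemma power_mult_commuting: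
  fixes x y :: "'a::monoid_mult"
  assumes "x * y = y * x"
  shows "(x * y) ^ n = x ^ n * y ^ n"
proof (induction n)
  case (Suc n)
  have "x ^ n * y = y * x ^ n" for n
    by (induction n) (simp_all add: assms mult.assoc, metis assms mult.assoc)
  then show ?case
    using Suc by (metis mult.assoc power_Suc)
qed simp

text \<open>Commutation separates the powers, and the powers of \<open>y\<close> are absorbed by
  enlarging the radius from \<open>r\<close> to \<open>r * norm y\<close>.\<close>

lemma quasinilpotent_mult_commuting:
  fixes x y :: "'a::complex_banach_algebra_1"
  assumes "quasinilpotent x" and "x * y = y * x"
  shows "quasinilpotent (x * y)"
  unfolding quasinilpotent_def
proof (intro allI impI)
  fix r :: real assume r: "0 \<le> r"
  have lim: "(\<lambda>n. (r * norm y) ^ n * norm (x ^ n) * norm (1::'a)) \<longlonglongrightarrow> 0"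
    using assms(1) r unfolding quasinilpotent_def by (intro tendsto_mult_left_zero) simp
  have "norm (r ^ n * norm ((x * y) ^ n)) \<le> (r * norm y) ^ n * norm (x ^ n) * norm (1::'a)" for n
  proof -
    have "norm ((x * y) ^ n) \<le> norm (x ^ n) * norm (y ^ n)"
      by (simp add: power_mult_commuting[OF assms(2)] norm_mult_ineq)
    also have "\<dots> \<le> norm (x ^ n) * (norm (1::'a) * norm y ^ n)"
      by (intro mult_left_mono norm_power_le) simp
    finally have "r ^ n * norm ((x * y) ^ n) \<le> r ^ n * (norm (x ^ n) * (norm (1::'a) * norm y ^ n))"
      by (rule mult_left_mono[OF _ zero_le_power[OF r]])
    then show ?thesis
      using r by (simp add: power_mult_distrib algebra_simps)
  qed
  then show "(\<lambda>n. r ^ n * norm ((x * y) ^ n)) \<longlonglongrightarrow> 0"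
    by (intro Lim_null_comparison[OF always_eventually lim]) simp
qed

section \<open>Idempotents from isolated points of a finite spectrum\<close>

text \<open>Horner's scheme with the coefficients acting through \<open>scaleC\<close>. The values
  at one \<open>x\<close> commute, so spectral questions about them reduce to factoring
  polynomials.\<close>

definition poly_at :: "complex poly \<Rightarrow> 'a \<Rightarrow> 'a::complex_banach_algebra_1" where
  "poly_at p x = fold_coeffs (\<lambda>c y. c *\<^sub>C 1 + x * y) p 0"

lemma poly_at_0 [simp]: "poly_at 0 x = 0"
  by (simp add: poly_at_def)

lemma poly_at_pCons [simp]: "poly_at (pCons c p) x = c *\<^sub>C 1 + x * poly_at p x"
  by (cases "p = 0 \<and> c = 0") (auto simp: poly_at_def)

lemma poly_at_1 [simp]: "poly_at 1 x = 1"
  by (simp add: one_pCons scaleC_one)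

lemma poly_at_add [simp]: "poly_at (p + q) x = poly_at p x + poly_at q x"
  by (induction p q rule: poly_induct2) (simp_all add: scaleC_add_left algebra_simps)

lemma poly_at_smult [simp]: "poly_at (Polynomial.smult c p) x = c *\<^sub>C poly_at p x"
  by (induction p) (simp_all add: scaleC_add_right scaleC_scaleC mult_scaleC_right)

lemma poly_at_diff [simp]: "poly_at (p - q) x = poly_at p x - poly_at q x"
  using poly_at_add[of "p - q" q x] by simp

lemma poly_at_mult [simp]: "poly_at (p * q) x = poly_at p x * poly_at q x"
  by (induction p) (simp_all add: algebra_simps mult_scaleC_left)

lemma poly_at_commute: "poly_at p x * poly_at q x = poly_at q x * poly_at p x"
  by (metis mult.commute poly_at_mult)

lemma poly_at_commute_self: "x * poly_at p x = poly_at p x * x"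
  using poly_at_commute[of "[:0, 1:]" x p] by (simp add: scaleC_one)

lemma poly_at_linear_factor: "poly_at [:- c, 1:] x = (- 1) *\<^sub>C (c *\<^sub>C 1 - x)"
  by (simp add: scaleC_one)

text \<open>One half of spectral mapping: \<open>p\<close> splits over the complex numbers, and a
  linear factor is invertible at \<open>x\<close> when its root avoids the spectrum.\<close>

lemma poly_at_invertible:
  fixes x :: "'a::complex_banach_algebra_1"
  assumes "p \<noteq> 0" and "\<And>z. poly p z = 0 \<Longrightarrow> z \<notin> algebra_spectrum x"
  shows "two_sided_invertible (poly_at p x)"
  using assms
proof (induction "degree p" arbitrary: p rule: less_induct)
  case less
  show ?case
  proof (cases "degree p = 0")
    case True
    then obtain c where "p = [:c:]"
      by (rule degree_eq_zeroE)
    moreover have "two_sided_invertible (1::'a)"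
      by (rule invertible_if_left_right[of 1 _ 1]) simp_all
    ultimately show ?thesis
      using less.prems(1) by (simp add: invertible_scaleC_iff)
  next
    case False
    then obtain r where r: "poly p r = 0"
      using fundamental_theorem_of_algebra[of p] by (auto simp: constant_degree)
    then obtain q where q: "p = [:- r, 1:] * q"
      by (auto simp: poly_eq_0_iff_dvd)
    have "q \<noteq> 0"
      using less.prems(1) q by auto
    moreover from this have "degree q < degree p"
      unfolding q by (subst degree_mult_eq) auto
    ultimately have "two_sided_invertible (poly_at q x)"
      using less.prems(2) by (intro less.hyps) (auto simp: q)
    moreover have "two_sided_invertible (poly_at [:- r, 1:] x)"
      using less.prems(2)[OF r] unfolding poly_at_linear_factor
      by (subst invertible_scaleC_iff) (simp_all add: algebra_spectrum_def)
    ultimately show ?thesis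
      unfolding q poly_at_mult by (intro invertible_mult)
  qed
qed

text \<open>By spectral mapping 0 is the only possible spectral value. The root \<open>z0\<close>
  excludes a nonzero constant \<open>p\<close>, which an empty spectrum would otherwise
  admit.\<close>

lemma quasinilpotent_poly_at:
  fixes x :: "'a::complex_banach_algebra_1"
  assumes "\<And>z. z \<in> algebra_spectrum x \<Longrightarrow> poly p z = 0" and "poly p z0 = 0"
  shows "quasinilpotent (poly_at p x)"
proof (rule quasinilpotent_if_spectrum)
  have "c \<notin> algebra_spectrum (poly_at p x)" if c: "c \<noteq> 0" for c
  proof -
    have "two_sided_invertible (poly_at ([:c:] - p) x)"
    proof (rule poly_at_invertible)
      show "[:c:] - p \<noteq> 0"
        using assms(2) c by (metis diff_zero poly_0 poly_diff poly_const_conv)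
    qed (use assms(1) c in auto)
    then show ?thesis
      by (simp add: algebra_spectrum_def)
  qed
  then show "nonzero_spectrum (poly_at p x) = {}"
    by (auto simp: nonzero_spectrum_def)
qed

text \<open>Consecutive coefficients have the quotient \<open>(- 1 / 2 - k) / (k + 1)\<close>, of
  modulus below 1. The bound lets the inverse square root series in \<open>4 w\<close> be dominated
  by \<open>4 ^ k * norm (w ^ k)\<close>.\<close>

lemma gbinomial_minus_half_le: "\<bar>(- 1 / 2 :: real) gchoose k\<bar> \<le> 1"
proof (induction k)
  case (Suc k)
  let ?g = "\<lambda>k. (- 1 / 2 :: real) gchoose k"
  have "(real k + 1) * ?g (Suc k) = (- 1 / 2 - real k) * ?g k"
    using gbinomial_mult_1[of "- 1 / 2 :: real" k] by (simp add: algebra_simps)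
  then have "\<bar>real k + 1\<bar> * \<bar>?g (Suc k)\<bar> = \<bar>- 1 / 2 - real k\<bar> * \<bar>?g k\<bar>"
    by (metis abs_mult)
  moreover have "\<bar>real k + 1\<bar> = real k + 1" "\<bar>- 1 / 2 - real k\<bar> = real k + 1 / 2"
    by simp_all
  ultimately have "(real k + 1) * \<bar>?g (Suc k)\<bar> = (real k + 1 / 2) * \<bar>?g k\<bar>"
    by simp
  also have "\<dots> \<le> (real k + 1) * 1"
    by (intro mult_mono Suc.IH) simp_all
  finally show ?case
    by (simp add: mult_le_cancel_left)
qed simp

lemma gbinomial_minus_one: "(- 1 :: real) gchoose k = (- 1) ^ k"
proof (induction k)
  case (Suc k)
  have "(real k + 1) * ((- 1) gchoose Suc k) = - 1 * ((- 1 :: real) gchoose k) - real k * ((- 1) gchoose k)"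
    using gbinomial_mult_1[of "- 1 :: real" k] by (simp only: of_nat_Suc add.commute)
  also have "\<dots> = (real k + 1) * (- ((- 1 :: real) gchoose k))"
    by (simp add: algebra_simps)
  finally have "(real k + 1) * ((- 1) gchoose Suc k) = (real k + 1) * (- ((- 1 :: real) gchoose k))" .
  moreover have "real k + 1 \<noteq> 0"
    by linarith
  ultimately have "(- 1) gchoose Suc k = - ((- 1 :: real) gchoose k)"
    using mult_left_cancel by blast
  then show ?case
    by (simp add: Suc.IH)
qed simp

text \<open>\<open>1 + w s\<close> is the binomial series of \<open>(1 + 4 w)\<^sup>-\<^sup>1\<^sup>/\<^sup>2\<close>.\<close>

lemma quasinilpotent_inverse_sqrt:
  fixes w :: "'a::complex_banach_algebra_1"
  assumes "quasinilpotent w"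
  obtains s where "(1 + 4 *\<^sub>R w) * ((1 + w * s) * (1 + w * s)) = 1"
    and "\<And>y. y * w = w * y \<Longrightarrow> y * s = s * y"
proof -
  define c where "c k = 4 ^ k * ((- 1 / 2 :: real) gchoose k)" for k
  have c: "\<bar>c k\<bar> \<le> 4 ^ k" for k
    using gbinomial_minus_half_le[of k] by (simp add: c_def abs_mult)
  have sm4: "summable (\<lambda>k. 4 ^ k * norm (w ^ k))"
    by (rule quasinilpotent_summable[OF assms]) simp
  have nS: "summable (\<lambda>k. norm (c k *\<^sub>R w ^ k))"
    by (rule summable_comparison_test'[OF sm4, of 0]) (simp add: c mult_right_mono)
  have ns: "summable (\<lambda>k. norm (c (Suc k) *\<^sub>R w ^ k))"
  proof (rule summable_comparison_test'[OF summable_mult[OF sm4, of 4], of 0])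
    show "norm (norm (c (Suc k) *\<^sub>R w ^ k)) \<le> 4 * (4 ^ k * norm (w ^ k))" for k
      using mult_right_mono[OF c[of "Suc k"], of "norm (w ^ k)"] by (simp add: mult.assoc)
  qed
  define S where "S = (\<Sum>k. c k *\<^sub>R w ^ k)"
  define s where "s = (\<Sum>k. c (Suc k) *\<^sub>R w ^ k)"
  have smS: "summable (\<lambda>k. c k *\<^sub>R w ^ k)" and sms: "summable (\<lambda>k. c (Suc k) *\<^sub>R w ^ k)"
    by (rule summable_norm_cancel[OF nS], rule summable_norm_cancel[OF ns])
  \<comment> \<open>The index shift extracts a factor \<open>w\<close> from the non-constant terms;
    it is what later makes the idempotent a multiple of \<open>u\<close>.\<close>
  have S: "S = 1 + w * s"
  proof -
    have "S = 1 + (\<Sum>k. c (Suc k) *\<^sub>R w ^ Suc k)"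
      using suminf_split_head[OF smS] by (simp add: S_def c_def)
    also have "(\<Sum>k. c (Suc k) *\<^sub>R w ^ Suc k) = w * s"
      using suminf_mult[OF sms, of w] by (simp add: s_def)
    finally show ?thesis .
  qed
  \<comment> \<open>Vandermonde's identity for the exponents -1/2 and -1/2 gives the coefficients of
    exponent -1, so \<open>S * S\<close> is the geometric series of \<open>- 4 w\<close>.\<close>
  have conv: "(\<Sum>i\<le>k. c i * c (k - i)) = (- 4) ^ k" for k
  proof -
    have "(\<Sum>i\<le>k. c i * c (k - i)) = (\<Sum>i\<le>k. 4 ^ k * (((- 1 / 2 :: real) gchoose i) * ((- 1 / 2) gchoose (k - i))))"
    proof (rule sum.cong[OF refl])
      fix i assume "i \<in> {..k}"
      then have "(4::real) ^ k = 4 ^ i * 4 ^ (k - i)"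
        by (simp flip: power_add)
      then show "c i * c (k - i) = 4 ^ k * (((- 1 / 2 :: real) gchoose i) * ((- 1 / 2) gchoose (k - i)))"
        by (simp add: c_def)
    qed
    also have "\<dots> = 4 ^ k * ((- 1) gchoose k)"
      using gbinomial_Vandermonde[of "- 1 / 2 :: real" "- 1 / 2" k]
      by (simp add: atMost_atLeast0 flip: sum_distrib_left)
    also have "\<dots> = (- 4) ^ k"
      by (simp add: gbinomial_minus_one flip: power_mult_distrib)
    finally show ?thesis .
  qed
  have "(\<lambda>k. \<Sum>i\<le>k. (c i *\<^sub>R w ^ i) * (c (k - i) *\<^sub>R w ^ (k - i))) sums (S * S)"
    unfolding S_def by (rule Cauchy_product_sums[OF nS nS])
  moreover have "(\<Sum>i\<le>k. (c i *\<^sub>R w ^ i) * (c (k - i) *\<^sub>R w ^ (k - i))) = ((- 4) *\<^sub>R w) ^ k" for k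
  proof -
    have "(\<Sum>i\<le>k. (c i *\<^sub>R w ^ i) * (c (k - i) *\<^sub>R w ^ (k - i))) = (\<Sum>i\<le>k. (c i * c (k - i)) *\<^sub>R w ^ k)"
      by (intro sum.cong) (simp_all flip: power_add)
    also have "\<dots> = (- 4) ^ k *\<^sub>R w ^ k"
      by (simp add: conv flip: scaleR_left.sum)
    also have "\<dots> = ((- 4) *\<^sub>R w) ^ k"
      by (simp only: scaleR_scaleC power_scaleC of_real_power)
    finally show ?thesis .
  qed
  ultimately have SS: "(\<lambda>k. ((- 4) *\<^sub>R w) ^ k) sums (S * S)"
    by simp
  have "norm (((- 4) *\<^sub>R w) ^ k) = 4 ^ k * norm (w ^ k)" for k
    by (simp only: scaleR_scaleC power_scaleC norm_scaleC norm_power norm_of_real) simp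
  then have "summable (\<lambda>k. norm (((- 4) *\<^sub>R w) ^ k))"
    using sm4 by (simp only:)
  then have "(1 - (- 4) *\<^sub>R w) * (S * S) = 1"
    using neumann_series(1)[of "(- 4) *\<^sub>R w"] SS sums_unique by metis
  then have "(1 + 4 *\<^sub>R w) * (S * S) = 1"
    by simp
  moreover have "y * s = s * y" if "y * w = w * y" for y
  proof -
    have "y * w ^ k = w ^ k * y" for k
      by (induction k) (simp, metis mult.assoc power_Suc that)
    then have "(\<Sum>k. y * (c (Suc k) *\<^sub>R w ^ k)) = (\<Sum>k. (c (Suc k) *\<^sub>R w ^ k) * y)"
      by simp
    then show ?thesis
      using suminf_mult[OF sms, of y] suminf_mult2[OF sms, of y] by (simp add: s_def)
  qed
  ultimately show thesis
    using that[of s] S by metis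
qed

text \<open>This is the Riesz idempotent of \<open>l\<close>. The factorisations through
  \<open>b\<close> on both sides keep \<open>e\<close> inside one-sided ideals and corners
  containing \<open>b\<close>; the last property says that \<open>b\<close> acts on \<open>e\<close>
  as \<open>l\<close> up to a quasinilpotent.\<close>

lemma spectral_idempotent:
  fixes b :: "'a::complex_banach_algebra_1"
  assumes fin: "finite (algebra_spectrum b)" and lam: "l \<in> nonzero_spectrum b"
  obtains e d where "e * e = e" "e \<noteq> 0" "e = b * d" "e = d * b"
    "quasinilpotent ((b - l *\<^sub>C 1) * e)"
proof -
  \<comment> \<open>Including 0 makes \<open>h\<close> divisible by the variable, so
    \<open>u\<close>, and with it \<open>e\<close>, is a multiple of \<open>b\<close>.\<close>
  define K where "K = insert 0 (algebra_spectrum b) - {l}"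
  have l: "l \<in> algebra_spectrum b" "l \<noteq> 0"
    using lam by (simp_all add: nonzero_spectrum_def)
  have K: "finite K" "0 \<in> K" "l \<notin> K"
    using fin l(2) by (simp_all add: K_def)
  define q where "q = (\<Prod>z\<in>K. [:- z, 1:])"
  have q: "poly q z = 0 \<longleftrightarrow> z \<in> K" for z
    using K(1) by (auto simp: q_def poly_prod)
  define h where "h = Polynomial.smult (inverse (poly q l)) q"
  have h: "poly h l = 1" "\<And>z. z \<in> K \<Longrightarrow> poly h z = 0"
    using q K(3) by (simp_all add: h_def)
  have hz: "poly h z = 0" if "z \<in> algebra_spectrum b" "z \<noteq> l" for z
    using h(2)[of z] that by (simp add: K_def)
  have "[:0, 1:] dvd h"
    using h(2)[OF K(2)] poly_eq_0_iff_dvd[of h 0] by simp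
  then obtain g where g: "h = [:0, 1:] * g"
    by (auto elim: dvdE)
  have "[:- l, 1:] dvd 1 - h"
    using h(1) poly_eq_0_iff_dvd[of "1 - h" l] by simp
  then obtain k where k: "1 - h = [:- l, 1:] * k"
    by (auto elim: dvdE)
  define u where "u = poly_at h b"
  have u: "u = b * poly_at g b"
    by (simp add: u_def g scaleC_one)
  define w where "w = poly_at (h * h - h) b"
  have w: "w = u * (u - 1)"
    by (simp add: w_def u_def algebra_simps)
  have "quasinilpotent w"
    unfolding w_def using h(1) hz
    by (intro quasinilpotent_poly_at[of _ _ l]) (auto simp: algebra_simps)
  then obtain s where s: "(1 + 4 *\<^sub>R w) * ((1 + w * s) * (1 + w * s)) = 1"
    and cs: "\<And>y. y * w = w * y \<Longrightarrow> y * s = s * y"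
    by (rule quasinilpotent_inverse_sqrt) blast
  have ps: "poly_at p b * s = s * poly_at p b" for p
    by (rule cs) (simp only: w_def poly_at_commute)
  define V where "V = poly_at (h + h - 1) b"
  have V: "V = u + u - 1"
    by (simp only: V_def u_def poly_at_diff poly_at_add poly_at_1)
  define S where "S = 1 + w * s"
  have VS: "V * S = S * V"
  proof -
    have "V * w = w * V"
      unfolding V_def w_def by (rule poly_at_commute)
    moreover have "V * s = s * V"
      unfolding V_def by (rule ps)
    ultimately have "V * (w * s) = (w * s) * V"
      by (metis mult.assoc)
    then show ?thesis
      by (simp add: S_def distrib_left distrib_right)
  qed
  define T where "T = V * S"
  have VV: "V * V = 1 + 4 *\<^sub>R w"
  proof -
    have "4 *\<^sub>R w = w + w + (w + w)"
      using scaleR_left_distrib[of 2 2 w] by (simp add: scaleR_2)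
    then show ?thesis
      unfolding V w by (simp add: algebra_simps)
  qed
  have TT: "T * T = 1"
  proof -
    have "T * T = V * (S * V) * S"
      by (simp add: T_def mult.assoc)
    also have "\<dots> = (V * V) * (S * S)"
      by (simp add: mult.assoc flip: VS)
    finally show ?thesis
      using s by (simp add: VV S_def)
  qed
  define e where "e = (1 / 2) *\<^sub>R (1 + T)"
  define t where "t = 1 + (1 / 2) *\<^sub>R (V * (u - 1) * s)"
  have uV: "u * V = V * u"
    by (simp only: u_def V_def poly_at_commute)
  have e: "e = u * t"
  proof -
    \<comment> \<open>Since \<open>1 + V = 2 u\<close> and \<open>w\<close> contains
      \<open>u\<close>, the factor \<open>u\<close> comes out of \<open>1 + T\<close>.\<close>
    have "1 + T = (1 + V) + V * u * (u - 1) * s"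
      unfolding T_def S_def w by (simp add: distrib_left mult.assoc)
    also have "1 + V = 2 *\<^sub>R u"
      by (simp add: V scaleR_2)
    also have "V * u * (u - 1) * s = u * (V * (u - 1) * s)"
      by (simp add: mult.assoc flip: uV)
    finally have "1 + T = 2 *\<^sub>R (u * t)"
      by (simp add: t_def distrib_left scaleR_add_right)
    then show ?thesis
      by (simp add: e_def)
  qed
  have pt: "poly_at p b * t = t * poly_at p b" for p
  proof -
    have "poly_at p b * V = V * poly_at p b" "poly_at p b * (u - 1) = (u - 1) * poly_at p b"
      using poly_at_commute[of p b "h + h - 1"] poly_at_commute[of p b "h - 1"]
      by (simp_all only: V_def u_def poly_at_diff poly_at_1)
    then have "poly_at p b * (V * (u - 1) * s) = (V * (u - 1) * s) * poly_at p b"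
      using ps by (metis mult.assoc)
    then show ?thesis
      by (simp add: t_def distrib_left distrib_right)
  qed
  have bt: "b * t = t * b"
    using pt[of "[:0, 1:]"] by (simp add: scaleC_one)
  show thesis
  proof
    show "e * e = e"
    proof -
      have "(1 + T) * (1 + T) = 2 *\<^sub>R (1 + T)"
        by (simp add: TT distrib_left distrib_right scaleR_2)
      then show ?thesis
        by (simp add: e_def)
    qed
    show "e = b * (poly_at g b * t)"
      by (simp add: e u mult.assoc)
    show "e = (poly_at g b * t) * b"
      by (metis e u mult.assoc poly_at_commute_self bt)
    have "quasinilpotent (poly_at ([:- l, 1:] * h) b)"
      by (rule quasinilpotent_poly_at[of _ _ l]) (use hz in auto)
    then have "quasinilpotent (poly_at ([:- l, 1:] * h) b * t)"
      by (rule quasinilpotent_mult_commuting) (rule pt)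
    moreover have "poly_at ([:- l, 1:] * h) b * t = (b - l *\<^sub>C 1) * e"
      by (simp only: poly_at_mult e u_def mult.assoc) (simp add: scaleC_one)
    ultimately show "quasinilpotent ((b - l *\<^sub>C 1) * e)"
      by simp
    show "e \<noteq> 0"
    proof
      \<comment> \<open>Then \<open>u\<close> is a multiple of the quasinilpotent \<open>w\<close>,
        so \<open>1 - u\<close> is invertible. But \<open>1 - h\<close> has the root
        \<open>l\<close>, so \<open>b - l\<close> would be invertible as well.\<close>
      assume "e = 0"
      then have "u = - (u * ((1 / 2) *\<^sub>R (V * (u - 1) * s)))"
        by (simp add: e t_def distrib_left add_eq_0_iff2)
      also have "\<dots> = w * ((- 1 / 2) *\<^sub>R (V * s))"
      proof -
        have uw: "V * (u - 1) = (u - 1) * V"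
          unfolding V by (simp add: algebra_simps)
        have "u * (V * (u - 1) * s) = w * (V * s)"
          unfolding w by (metis mult.assoc uV uw)
        then show ?thesis
          by simp
      qed
      also have "quasinilpotent \<dots>"
      proof (rule quasinilpotent_mult_commuting[OF \<open>quasinilpotent w\<close>])
        have "w * V = V * w" "w * s = s * w"
          using ps by (simp_all only: w_def V_def poly_at_commute)
        then show "w * ((- 1 / 2) *\<^sub>R (V * s)) = (- 1 / 2) *\<^sub>R (V * s) * w"
          by simp (metis mult.assoc)
      qed
      finally have "quasinilpotent u" .
      then have "two_sided_invertible (1 - u)"
        using quasinilpotent_invertible[of u 1] by (simp add: scaleC_one)
      then have "two_sided_invertible (poly_at [:- l, 1:] b * poly_at k b)"
        by (metis k poly_at_1 poly_at_diff poly_at_mult u_def)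
      then have "two_sided_invertible (poly_at [:- l, 1:] b)"
        by (rule invertible_commuting_factor[OF poly_at_commute])
      then show False
        using l unfolding poly_at_linear_factor
        by (subst (asm) invertible_scaleC_iff) (simp_all add: algebra_spectrum_def)
    qed
  qed
qed

section \<open>Minimal idempotents and the socle\<close>

lemma socle_iff:
  fixes a :: "'a::complex_banach_algebra_1"
  shows "a \<in> socle \<longleftrightarrow>
    (\<exists>n. \<forall>x. finite (nonzero_spectrum (x * a)) \<and> card (nonzero_spectrum (x * a)) \<le> n)"
proof
  assume "a \<in> socle"
  then have "spectral_rank a \<noteq> \<infinity>"
    by (simp add: socle_def)
  then obtain n where n: "spectral_rank a = enat n"
    by auto
  have "finite (nonzero_spectrum (x * a)) \<and> card (nonzero_spectrum (x * a)) \<le> n" for x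
  proof -
    have "num_elements (nonzero_spectrum (x * a)) \<le> enat n"
      unfolding n[symmetric] spectral_rank_def by (rule SUP_upper) simp
    then show ?thesis
      by (auto simp: num_elements_def split: if_splits)
  qed
  then show "\<exists>n. \<forall>x. finite (nonzero_spectrum (x * a)) \<and> card (nonzero_spectrum (x * a)) \<le> n"
    by blast
next
  assume "\<exists>n. \<forall>x. finite (nonzero_spectrum (x * a)) \<and> card (nonzero_spectrum (x * a)) \<le> n"
  then obtain n where "\<forall>x. finite (nonzero_spectrum (x * a)) \<and> card (nonzero_spectrum (x * a)) \<le> n"
    by blast
  then have "\<And>x. num_elements (nonzero_spectrum (x * a)) \<le> enat n"
    by (simp add: num_elements_def)
  then have "spectral_rank a \<le> enat n"
    unfolding spectral_rank_def by (intro SUP_least)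
  also have "\<dots> < \<infinity>"
    by simp
  finally show "a \<in> socle"
    by (simp add: socle_def)
qed

lemma socle_mult_left: "a \<in> socle \<Longrightarrow> x * a \<in> socle"
  unfolding socle_iff by (simp flip: mult.assoc) blast

lemma socle_mult_right: "a \<in> socle \<Longrightarrow> a * x \<in> socle"
proof -
  have "nonzero_spectrum (y * (a * x)) = nonzero_spectrum (x * y * a)" for y
    using nonzero_spectrum_commute[of "y * a" x] by (simp add: mult.assoc)
  then show "a \<in> socle \<Longrightarrow> a * x \<in> socle"
    unfolding socle_iff by metis
qed

lemma socle_scaleC: "a \<in> socle \<Longrightarrow> c *\<^sub>C a \<in> socle"
  using socle_mult_left[of a "c *\<^sub>C 1"] by (simp add: mult_scaleC_left)

lemma finite_spectrum_socle:
  assumes "a \<in> socle"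
  shows "finite (algebra_spectrum a)"
proof -
  have "finite (nonzero_spectrum (1 * a))"
    using assms unfolding socle_iff by blast
  then show ?thesis
    by (simp add: nonzero_spectrum_def)
qed

lemma not_invertible_if_annihilates:
  fixes x :: "'a::ring_1"
  assumes "x * y = 0" and "y \<noteq> 0"
  shows "\<not> two_sided_invertible x"
  using assms unfolding two_sided_invertible_def by (metis mult.assoc mult_1_left mult_zero_right)

lemma in_spectrum_if_eigenvector:
  assumes "x * y = c *\<^sub>C y" and "y \<noteq> 0"
  shows "c \<in> algebra_spectrum x"
  using assms not_invertible_if_annihilates[of "c *\<^sub>C 1 - x" y]
  by (simp add: algebra_spectrum_def left_diff_distrib mult_scaleC_left)

text \<open>The other half of spectral mapping: \<open>p\<close> minus the constant
  \<open>poly p z\<close> has the root \<open>z\<close>, and a product of commuting elements is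
  invertible only if its factors are.\<close>

lemma spectrum_poly_at:
  assumes "z \<in> algebra_spectrum x"
  shows "poly p z \<in> algebra_spectrum (poly_at p x)"
proof -
  have "[:- z, 1:] dvd p - [:poly p z:]"
    by (simp add: poly_eq_0_iff_dvd[symmetric])
  then obtain k where k: "p - [:poly p z:] = [:- z, 1:] * k"
    by (auto elim: dvdE)
  have "\<not> two_sided_invertible (poly_at [:- z, 1:] x)"
    using assms unfolding poly_at_linear_factor
    by (subst invertible_scaleC_iff) (simp_all add: algebra_spectrum_def)
  then have "\<not> two_sided_invertible (poly_at (p - [:poly p z:]) x)"
    using invertible_commuting_factor[OF poly_at_commute] unfolding k poly_at_mult by blast
  moreover have "poly_at (p - [:poly p z:]) x = (- 1) *\<^sub>C (poly p z *\<^sub>C 1 - poly_at p x)"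
    by (simp add: complex_scale.scale_right_diff_distrib scaleC_one)
  ultimately have "\<not> two_sided_invertible ((- 1) *\<^sub>C (poly p z *\<^sub>C 1 - poly_at p x))"
    by (simp only: not_False_eq_True)
  then have "\<not> two_sided_invertible (poly p z *\<^sub>C 1 - poly_at p x)"
    by (subst (asm) invertible_scaleC_iff) simp_all
  then show ?thesis
    by (simp add: algebra_spectrum_def)
qed

lemma poly_at_monom: "poly_at (Polynomial.monom c n) x = c *\<^sub>C x ^ n"
  by (induction n) (simp_all add: monom_0 monom_Suc mult_scaleC_right)

lemma poly_at_sum: "poly_at (\<Sum>i\<in>I. p i) x = (\<Sum>i\<in>I. poly_at (p i) x)"
  by (induction I rule: infinite_finite_induct) simp_all

text \<open>Dependence is a property of sets and does not notice repetitions, so equal vectors get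
  their own relation with coefficients 1 and -1.\<close>

lemma linear_relation_in_span:
  fixes v :: "nat \<Rightarrow> 'a::complex_banach_algebra_1"
  assumes "finite B" and "card B \<le> n" and v: "\<And>k. v k \<in> complex_scale.span B"
  obtains c k where "k \<le> n" "c k \<noteq> 0" "(\<Sum>k\<le>n. c k *\<^sub>C v k) = 0"
proof (cases "inj_on v {..n}")
  case True
  have "complex_scale.dependent (v ` {..n})"
  proof (rule ccontr)
    assume "\<not> complex_scale.dependent (v ` {..n})"
    then have "card (v ` {..n}) \<le> card B"
      using complex_scale.independent_span_bound[OF assms(1)] v by blast
    then show False
      using assms(2) card_image[OF True] by simp
  qed
  then obtain u w where u: "(\<Sum>w\<in>v ` {..n}. u w *\<^sub>C w) = 0" "w \<in> v ` {..n}" "u w \<noteq> 0"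
    using complex_scale.dependent_finite[of "v ` {..n}"] by auto
  moreover have "(\<Sum>w\<in>v ` {..n}. u w *\<^sub>C w) = (\<Sum>k\<le>n. u (v k) *\<^sub>C v k)"
    by (rule sum.reindex_cong[OF True]) simp_all
  ultimately show thesis
    using that[of _ "\<lambda>k. u (v k)"] by auto
next
  case False
  then obtain i j where ij: "i \<le> n" "j \<le> n" "i \<noteq> j" "v i = v j"
    by (auto simp: inj_on_def)
  have "(\<Sum>k\<le>n. (if k = i then 1 else if k = j then - 1 else 0) *\<^sub>C v k)
      = (\<Sum>k\<in>{i, j}. (if k = i then 1 else if k = j then - 1 else 0) *\<^sub>C v k)"
    by (rule sum.mono_neutral_right) (use ij in auto)
  also have "\<dots> = 0"
    using ij by (simp add: scaleC_one)
  finally show thesis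
    using that[OF ij(1), of "\<lambda>k. if k = i then 1 else if k = j then - 1 else 0"] by simp
qed

text \<open>For \<open>t = x * z\<close>, the powers from \<open>t ^ 2\<close> on lie in
  \<open>x z A z\<close>. So \<open>t\<close> is annihilated by a nonzero polynomial of degree at
  most \<open>n + 2\<close>, whose roots include the spectrum, with \<open>n\<close> independent of
  \<open>x\<close>.\<close>

lemma socle_if_finite_dimensional:
  fixes z :: "'a::complex_banach_algebra_1"
  assumes B: "finite B" and z: "\<And>x. z * x * z \<in> complex_scale.span B"
  shows "z \<in> socle"
proof -
  define n where "n = card B"
  have "finite (nonzero_spectrum (x * z)) \<and> card (nonzero_spectrum (x * z)) \<le> n + 2" for x
  proof -
    define t where "t = x * z"
    have tk: "t ^ (k + 2) = x * (z * (t ^ k * x) * z)" for k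
      by (simp add: t_def mult.assoc power_commutes)
    have "t ^ (k + 2) \<in> complex_scale.span ((*) x ` B)" for k
    proof -
      have "x * y \<in> complex_scale.span ((*) x ` B)" if "y \<in> complex_scale.span B" for y
        using that
      proof (induction rule: complex_scale.span_induct_alt)
        case base
        show ?case
          by (simp add: complex_scale.span_zero)
      next
        case (step c b y)
        then show ?case
          by (simp add: distrib_left mult_scaleC_right complex_scale.span_add
              complex_scale.span_scale complex_scale.span_base)
      qed
      then show ?thesis
        unfolding tk using z by blast
    qed
    moreover have "finite ((*) x ` B)" "card ((*) x ` B) \<le> n"
      using B card_image_le by (auto simp: n_def)
    ultimately obtain c k where c: "k \<le> n" "c k \<noteq> 0" "(\<Sum>k\<le>n. c k *\<^sub>C t ^ (k + 2)) = 0"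
      using linear_relation_in_span[of "(*) x ` B" n "\<lambda>k. t ^ (k + 2)"] by metis
    define p where "p = (\<Sum>k\<le>n. Polynomial.monom (c k) (k + 2))"
    have "poly_at p t = 0"
      using c(3) by (simp only: p_def poly_at_sum poly_at_monom)
    have "Polynomial.coeff p (k + 2) = (\<Sum>i\<le>n. if i = k then c i else 0)"
      unfolding p_def coeff_sum by (intro sum.cong) auto
    then have "Polynomial.coeff p (k + 2) = c k"
      using c(1) by simp
    then have p: "p \<noteq> 0"
      using c(2) by auto
    have "degree p \<le> n + 2"
      unfolding p_def by (intro degree_sum_le) (auto intro: order.trans[OF degree_monom_le])
    have "poly p w = 0" if "w \<in> algebra_spectrum t" for w
    proof (rule ccontr)
      assume *: "poly p w \<noteq> 0"
      have "poly p w \<in> algebra_spectrum (0::'a)"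
        using spectrum_poly_at[OF that, of p] \<open>poly_at p t = 0\<close> by simp
      then show False
        using spectrum_bound[of "poly p w" "0::'a"] * by simp
    qed
    then have sub: "nonzero_spectrum t \<subseteq> {w. poly p w = 0}"
      by (auto simp: nonzero_spectrum_def)
    have "finite {w. poly p w = 0}"
      by (rule poly_roots_finite[OF p])
    moreover have "card {w. poly p w = 0} \<le> n + 2"
      using card_poly_roots_bound[OF p] \<open>degree p \<le> n + 2\<close> by simp
    ultimately show ?thesis
      unfolding t_def[symmetric] using sub by (meson card_mono finite_subset order.trans)
  qed
  then show ?thesis
    unfolding socle_iff by blast
qed

definition minimal_idempotent :: "'a::complex_banach_algebra_1 \<Rightarrow> bool" where
  "minimal_idempotent e \<longleftrightarrow> e * e = e \<and> e \<noteq> 0 \<and> (\<forall>x. \<exists>c. e * x * e = c *\<^sub>C e)"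

definition orthogonal_idempotents :: "'a::ring_1 set \<Rightarrow> bool" where
  "orthogonal_idempotents E \<longleftrightarrow> finite E \<and> (\<forall>e\<in>E. e * e = e \<and> e \<noteq> 0) \<and>
     (\<forall>e\<in>E. \<forall>f\<in>E. e \<noteq> f \<longrightarrow> e * f = 0)"

definition minimal_family :: "'a::complex_banach_algebra_1 set \<Rightarrow> bool" where
  "minimal_family E \<longleftrightarrow> orthogonal_idempotents E \<and> (\<forall>e\<in>E. minimal_idempotent e)"

lemma orthogonal_sum:
  assumes E: "orthogonal_idempotents E" and "e \<in> E"
  shows "e * \<Sum>E = e" and "\<Sum>E * e = e"
proof -
  have "e * \<Sum>E = (\<Sum>f\<in>E. if f = e then e else 0)"
    unfolding sum_distrib_left by (intro sum.cong) (use assms in \<open>auto simp: orthogonal_idempotents_def\<close>)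
  then show "e * \<Sum>E = e"
    using assms by (simp add: orthogonal_idempotents_def)
  have "\<Sum>E * e = (\<Sum>f\<in>E. if f = e then e else 0)"
    unfolding sum_distrib_right by (intro sum.cong) (use assms in \<open>auto simp: orthogonal_idempotents_def\<close>)
  then show "\<Sum>E * e = e"
    using assms by (simp add: orthogonal_idempotents_def)
qed

lemma orthogonal_sum_idempotent:
  assumes "orthogonal_idempotents E"
  shows "\<Sum>E * \<Sum>E = \<Sum>E"
proof -
  have "\<Sum>E * \<Sum>E = (\<Sum>e\<in>E. e * \<Sum>E)"
    by (simp add: sum_distrib_right)
  also have "\<dots> = \<Sum>E"
    by (intro sum.cong) (simp_all add: orthogonal_sum[OF assms])
  finally show ?thesis .
qed

text \<open>A combination of the idempotents with distinct nonzero coefficients lies in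
  \<open>A a\<close>, and each coefficient is an eigenvalue of it with eigenvector
  \<open>e\<close>.\<close>

lemma card_orthogonal_idempotents_le:
  fixes a :: "'a::complex_banach_algebra_1"
  assumes E: "orthogonal_idempotents E" and sub: "E \<subseteq> range (\<lambda>x. x * a)"
    and n: "\<And>x. finite (nonzero_spectrum (x * a)) \<and> card (nonzero_spectrum (x * a)) \<le> n"
  shows "card E \<le> n"
proof -
  have fin: "finite E"
    using E by (simp add: orthogonal_idempotents_def)
  obtain h where h: "bij_betw h E {0..<card E}"
    using ex_bij_betw_finite_nat[OF fin] by blast
  have "\<forall>e\<in>E. \<exists>x. e = x * a"
    using sub by blast
  then obtain y where y: "\<And>e. e \<in> E \<Longrightarrow> e = y e * a"
    by metis
  define c where "c e = (of_nat (Suc (h e)) :: complex)" for e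
  define z where "z = (\<Sum>e\<in>E. c e *\<^sub>C y e)"
  have za: "z * a = (\<Sum>e\<in>E. c e *\<^sub>C e)"
    unfolding z_def sum_distrib_right by (intro sum.cong) (simp_all add: mult_scaleC_left flip: y)
  have "c e \<in> nonzero_spectrum (z * a)" if e: "e \<in> E" for e
  proof -
    have "z * a * e = (\<Sum>f\<in>E. if f = e then c e *\<^sub>C e else 0)"
      unfolding za sum_distrib_right
      by (intro sum.cong) (use E e in \<open>auto simp: orthogonal_idempotents_def mult_scaleC_left\<close>)
    then have "z * a * e = c e *\<^sub>C e"
      using fin e by simp
    moreover have "e \<noteq> 0"
      using E e by (simp add: orthogonal_idempotents_def)
    ultimately have "c e \<in> algebra_spectrum (z * a)"
      by (rule in_spectrum_if_eigenvector)
    moreover have "c e \<noteq> 0"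
      unfolding c_def by (simp only: of_nat_eq_0_iff)
    ultimately show ?thesis
      by (simp add: nonzero_spectrum_def)
  qed
  then have "c ` E \<subseteq> nonzero_spectrum (z * a)"
    by blast
  moreover have "inj_on c E"
    using h by (auto simp: c_def inj_on_def bij_betw_def simp del: of_nat_Suc)
  ultimately have "card E \<le> card (nonzero_spectrum (z * a))"
    using n by (metis card_image card_mono)
  then show ?thesis
    using n[of z] by linarith
qed

section \<open>Consequences of a vanishing Jacobson radical\<close>

context
  fixes ty :: "'a::complex_banach_algebra_1 itself"
  assumes semisimple: "semisimple_algebra ty"
begin

text \<open>If \<open>x\<close> were outside a maximal left ideal \<open>I\<close>, then
  \<open>1 = m + y * x\<close> with \<open>m\<close> in \<open>I\<close>, and
  \<open>m = 1 - y * x\<close> would be an invertible element of \<open>I\<close>.\<close>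

lemma radical_zero:
  fixes x :: 'a
  assumes inv: "\<And>y. two_sided_invertible (1 - y * x)"
  shows "x = 0"
proof -
  have "x \<in> I" if I: "maximal_left_ideal I" for I :: "'a set"
  proof (rule ccontr)
    assume x: "x \<notin> I"
    have "left_ideal I" and ne: "I \<noteq> UNIV"
      and max: "\<And>J. left_ideal J \<Longrightarrow> I \<subseteq> J \<Longrightarrow> J = I \<or> J = UNIV"
      using I by (simp_all add: maximal_left_ideal_def)
    then have I': "0 \<in> I" "\<And>u v. u \<in> I \<Longrightarrow> v \<in> I \<Longrightarrow> u + v \<in> I" "\<And>a u. u \<in> I \<Longrightarrow> a * u \<in> I"
      by (simp_all add: left_ideal_def)
    define J where "J = {m + y * x | m y. m \<in> I}"
    have J: "m + y * x \<in> J" if "m \<in> I" for m y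
      using that by (auto simp: J_def)
    have "left_ideal J"
      unfolding left_ideal_def
    proof (intro conjI ballI allI)
      show "0 \<in> J"
        using J[OF I'(1), of 0] by simp
      fix u assume "u \<in> J"
      then obtain m y where u: "u = m + y * x" "m \<in> I"
        by (auto simp: J_def)
      show "a * u \<in> J" for a
        using J[OF I'(3)[OF u(2), of a], of "a * y"] by (simp add: u(1) distrib_left mult.assoc)
      fix v assume "v \<in> J"
      then obtain k w where v: "v = k + w * x" "k \<in> I"
        by (auto simp: J_def)
      show "u + v \<in> J"
        using J[OF I'(2)[OF u(2) v(2)], of "y + w"] by (simp add: u(1) v(1) algebra_simps)
    qed
    moreover have "I \<subseteq> J"
      using J[of _ 0] by auto
    moreover have "x \<in> J"
      using J[OF I'(1), of 1] by simp
    ultimately have "J = UNIV"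
      using max x by blast
    then have "1 \<in> J"
      by simp
    then obtain m y where m: "1 = m + y * x" "m \<in> I"
      unfolding J_def by blast
    then have "m = 1 - y * x"
      by (simp add: algebra_simps)
    then obtain z where "z * m = 1"
      using inv[of y] unfolding two_sided_invertible_def by blast
    then have "1 \<in> I"
      using I'(3)[OF m(2), of z] by simp
    then have "a \<in> I" for a
      using I'(3)[of 1 a] by simp
    then show False
      using ne by blast
  qed
  then have "x \<in> jacobson_radical"
    by (simp add: jacobson_radical_def)
  then show ?thesis
    using semisimple unfolding semisimple_algebra_def by blast
qed

text \<open>Each \<open>y * u\<close> has square zero, so \<open>1 + y * u\<close> inverts
  \<open>1 - y * u\<close> and \<open>u\<close> lies in the radical.\<close>

lemma semiprime:
  fixes u :: 'a
  assumes "\<And>y. u * y * u = 0"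
  shows "u = 0"
proof (rule radical_zero)
  fix y
  have "y * u * (y * u) = 0"
    using assms[of y] by (simp add: mult.assoc)
  then have "(1 + y * u) * (1 - y * u) = 1" "(1 - y * u) * (1 + y * u) = 1"
    by (simp_all add: algebra_simps)
  then show "two_sided_invertible (1 - y * u)"
    by (rule invertible_if_left_right)
qed

text \<open>Outside the radical some left multiple \<open>y * a\<close> has 1 in its spectrum, and
  finite rank makes this point isolated.\<close>

lemma left_ideal_contains_idempotent:
  fixes a :: 'a
  assumes "a \<in> socle" and "a \<noteq> 0"
  obtains e y where "e * e = e" "e \<noteq> 0" "e = y * a"
proof -
  obtain y where "\<not> two_sided_invertible (1 - y * a)"
    using radical_zero assms(2) by blast
  then have "1 \<in> nonzero_spectrum (y * a)"
    using spectrum_iff_one_minus[of 1 "y * a"] by (simp add: nonzero_spectrum_def scaleC_one)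
  moreover have "finite (algebra_spectrum (y * a))"
    by (intro finite_spectrum_socle socle_mult_left assms)
  ultimately obtain e d where "e * e = e" "e \<noteq> 0" "e = d * (y * a)"
    using spectral_idempotent by metis
  then show thesis
    using that[of e "d * y"] by (simp add: mult.assoc)
qed

text \<open>
  Every element of \<open>eAe\<close> is a scalar plus a quasinilpotent element, since a nontrivial spectral
  idempotent would contradict primitivity; so \<open>eAe\<close> is local and its quasinilpotent elements lie
  in the radical of the algebra.
\<close>

lemma primitive_imp_minimal:
  fixes e :: 'a
  assumes e: "e * e = e" "e \<noteq> 0" "e \<in> socle"
    and prim: "\<And>f. f * f = f \<Longrightarrow> e * f = f \<Longrightarrow> f * e = f \<Longrightarrow> f = 0 \<or> f = e"
  shows "minimal_idempotent e"
proof -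
  have scalar_plus: "\<exists>l. quasinilpotent (c - l *\<^sub>C e)" if c: "e * c = c" "c * e = c" for c
  proof (cases "nonzero_spectrum c = {}")
    case True
    then show ?thesis
      using quasinilpotent_if_spectrum[of c] by (intro exI[of _ 0]) simp
  next
    case False
    then obtain l where l: "l \<in> nonzero_spectrum c"
      by blast
    have "c \<in> socle"
      using socle_mult_left[OF e(3), of c] c by simp
    then obtain f d where f: "f * f = f" "f \<noteq> 0" "f = c * d" "f = d * c"
      "quasinilpotent ((c - l *\<^sub>C 1) * f)"
      using spectral_idempotent[OF finite_spectrum_socle l] by metis
    have "e * f = f" "f * e = f"
      using c f(3,4) by (metis mult.assoc)+
    then have "f = e"
      using prim f(1,2) by blast
    then have "(c - l *\<^sub>C 1) * f = c - l *\<^sub>C e"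
      by (simp add: left_diff_distrib c mult_scaleC_left)
    then show ?thesis
      using f(5) by auto
  qed
  \<comment> \<open>By primitivity the idempotent \<open>q * z\<close> is 0 or \<open>e\<close>. The
    first forces \<open>q = 0\<close>; the second makes \<open>q\<close> and \<open>z\<close>
    commute, and then \<open>e\<close> would be quasinilpotent.\<close>
  have no_inverse: "z * q \<noteq> e" if q: "e * q = q" "q * e = q" "quasinilpotent q"
    and z: "e * z = z" "z * e = z" for q z
  proof
    assume zq: "z * q = e"
    have "q * z * (q * z) = q * (z * q) * z"
      by (simp only: mult.assoc)
    also have "\<dots> = q * z"
      by (simp only: zq q(2))
    finally have idem: "q * z * (q * z) = q * z" .
    have "e * (q * z) = q * z" "(q * z) * e = q * z"
      by (metis mult.assoc q(1), metis mult.assoc z(2))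
    then consider "q * z = 0" | "q * z = e"
      using prim[OF idem] by blast
    then show False
    proof cases
      case 1
      have "q = q * (z * q)"
        by (simp only: zq q(2))
      also have "\<dots> = q * z * q"
        by (simp only: mult.assoc)
      finally have "q = 0"
        using 1 by simp
      then show False
        using zq e(2) by simp
    next
      case 2
      then have "quasinilpotent e"
        using quasinilpotent_mult_commuting[OF q(3), of z] zq by simp
      then have "two_sided_invertible (1 - e)"
        using quasinilpotent_invertible[of e 1] by (simp add: scaleC_one)
      moreover have "(1 - e) * e = 0"
        by (simp add: left_diff_distrib e(1))
      ultimately show False
        using not_invertible_if_annihilates e(2) by blast
    qed
  qed
  have "\<exists>l. e * x * e = l *\<^sub>C e" for x
  proof -
    define c where "c = e * x * e"
    have c: "e * c = c" "c * e = c"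
      unfolding c_def by (metis e(1) mult.assoc)+
    obtain l where l: "quasinilpotent (c - l *\<^sub>C e)"
      using scalar_plus[OF c] by blast
    define q where "q = c - l *\<^sub>C e"
    have q: "e * q = q" "q * e = q"
      by (simp_all add: q_def c e(1) left_diff_distrib right_diff_distrib mult_scaleC_left mult_scaleC_right)
    have "q = 0"
    proof (rule radical_zero)
      fix y
      define d where "d = e * y * q"
      have d: "e * d = d" "d * e = d"
        unfolding d_def by (metis e(1) mult.assoc) (metis q(2) mult.assoc)
      obtain m where m: "quasinilpotent (d - m *\<^sub>C e)"
        using scalar_plus[OF d] by blast
      \<comment> \<open>For nonzero \<open>m\<close>, the element \<open>d = e * y * q\<close> would
        be left invertible relative to \<open>e\<close>, and so would \<open>q\<close>.\<close>
      have "m = 0"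
      proof (rule ccontr)
        assume m0: "m \<noteq> 0"
        obtain w where w: "w * (1 - (- inverse m) *\<^sub>C (d - m *\<^sub>C e)) = 1"
          using quasinilpotent_invertible[OF m] unfolding two_sided_invertible_def by blast
        have "(1 - (- inverse m) *\<^sub>C (d - m *\<^sub>C e)) * e = inverse m *\<^sub>C d"
          using m0 by (simp add: left_diff_distrib distrib_right mult_scaleC_left d e(1)
              complex_scale.scale_right_diff_distrib scaleC_scaleC scaleC_one)
        then have "w * (inverse m *\<^sub>C d) = e"
          using w by (metis mult.assoc mult_1_left)
        then have wd: "inverse m *\<^sub>C (w * d) = e"
          by (simp add: mult_scaleC_right)
        define z where "z = inverse m *\<^sub>C (e * w * e * y * e)"
        have "e * (e * w * e * y * e) = (e * e) * w * e * y * e"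
          "(e * w * e * y * e) * e = e * w * e * y * (e * e)"
          by (simp_all only: mult.assoc)
        then have "e * z = z" "z * e = z"
          by (simp_all add: z_def mult_scaleC_left mult_scaleC_right e(1))
        moreover have "z * q = e"
        proof -
          have "(e * w * e * y * e) * q = e * (w * (e * y * (e * q)))"
            by (simp only: mult.assoc)
          then have "z * q = e * (inverse m *\<^sub>C (w * d))"
            by (simp add: z_def d_def q(1) mult_scaleC_left mult_scaleC_right)
          then show ?thesis
            by (simp add: wd e(1))
        qed
        ultimately show False
          using no_inverse q l unfolding q_def[symmetric] by blast
      qed
      then have "quasinilpotent d"
        using m by simp
      then have "two_sided_invertible (1 - e * (y * q))"
        using quasinilpotent_invertible[of d 1] by (simp add: scaleC_one d_def mult.assoc)
      then have "two_sided_invertible (1 - (y * q) * e)"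
        by (rule invertible_one_minus_mult_commute)
      then show "two_sided_invertible (1 - y * q)"
        by (simp add: mult.assoc q(2))
    qed
    then show ?thesis
      unfolding q_def c_def by auto
  qed
  then show ?thesis
    using e by (simp add: minimal_idempotent_def)
qed

text \<open>
  The family \<open>E\<close> below is an orthogonal family of idempotents of \<open>Aa\<close> of maximal cardinality: it
  exhausts \<open>a\<close>, and none of its members can be split.
\<close>

lemma socle_right_unit:
  fixes a :: 'a
  assumes a: "a \<in> socle"
  obtains E y where "minimal_family E" "\<Sum>E = y * a" "a * \<Sum>E = a"
proof -
  obtain n where n: "\<And>x. finite (nonzero_spectrum (x * a)) \<and> card (nonzero_spectrum (x * a)) \<le> n"
    using a unfolding socle_iff by blast
  define fam where "fam E \<longleftrightarrow> orthogonal_idempotents E \<and> E \<subseteq> range (\<lambda>x. x * a)" for E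
  have "fam {}"
    by (simp add: fam_def orthogonal_idempotents_def)
  moreover have "\<forall>E. fam E \<longrightarrow> card E < Suc n"
    unfolding fam_def by (auto intro!: le_imp_less_Suc card_orthogonal_idempotents_le simp: n)
  ultimately have "\<exists>E. fam E \<and> (\<forall>F. fam F \<longrightarrow> card F \<le> card E)"
    by (rule ex_has_greatest_nat)
  then obtain E where E: "fam E" and max: "\<And>F. fam F \<Longrightarrow> card F \<le> card E"
    by blast
  have oE: "orthogonal_idempotents E" and fin: "finite E" and subE: "E \<subseteq> range (\<lambda>x. x * a)"
    using E by (auto simp: fam_def orthogonal_idempotents_def)
  define g where "g = \<Sum>E"
  have gg: "g * g = g"
    unfolding g_def by (rule orthogonal_sum_idempotent[OF oE])
  have ge: "g * e = e" "e * g = e" if "e \<in> E" for e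
    unfolding g_def using orthogonal_sum[OF oE that] by auto
  have "\<forall>e\<in>E. \<exists>x. e = x * a"
    using subE by blast
  then obtain y where y: "\<And>e. e \<in> E \<Longrightarrow> e = y e * a"
    by metis
  have ga: "g = (\<Sum>e\<in>E. y e) * a"
    unfolding g_def sum_distrib_right by (intro sum.cong) (simp_all flip: y)
  have "a * g = a"
  proof (rule ccontr)
    assume "a * g \<noteq> a"
    define b where "b = a * (1 - g)"
    have "b \<noteq> 0"
      using \<open>a * g \<noteq> a\<close> by (auto simp: b_def right_diff_distrib)
    then obtain f x where f: "f * f = f" "f \<noteq> 0" "f = x * b"
      using left_ideal_contains_idempotent[of b] socle_mult_right[OF a] unfolding b_def by metis
    have "b * g = 0"
      by (simp add: b_def mult.assoc left_diff_distrib gg)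
    then have fg: "f * g = 0"
      by (simp add: f(3) mult.assoc)
    \<comment> \<open>\<open>f * g = 0\<close>, but \<open>g * f\<close> may be nonzero; the factor
      \<open>1 - g\<close> makes the new idempotent orthogonal to \<open>g\<close> on both
      sides.\<close>
    define h where "h = (1 - g) * f"
    have fh: "f * h = f"
      by (simp add: h_def left_diff_distrib right_diff_distrib f(1) fg flip: mult.assoc)
    have hg: "h * g = 0"
      by (simp add: h_def mult.assoc fg)
    have gh: "g * h = 0"
      by (simp add: h_def left_diff_distrib right_diff_distrib gg flip: mult.assoc)
    have hh: "h * h = h"
    proof -
      have "h * h = (1 - g) * (f * h)"
        by (simp add: h_def mult.assoc)
      then show ?thesis
        by (simp only: fh flip: h_def)
    qed
    have h0: "h \<noteq> 0"
      using fh f(2) by auto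
    have "b = (1 - a * (\<Sum>e\<in>E. y e)) * a"
      unfolding b_def using ga by (simp add: left_diff_distrib right_diff_distrib mult.assoc)
    then have "h = ((1 - g) * x * (1 - a * (\<Sum>e\<in>E. y e))) * a"
      by (simp add: h_def f(3) mult.assoc)
    then have hr: "h \<in> range (\<lambda>x. x * a)"
      by blast
    have eh: "e * h = 0" "h * e = 0" if "e \<in> E" for e
      using ge[OF that] gh hg by (metis mult.assoc mult_zero_left mult_zero_right)+
    have "fam (insert h E)"
      using oE subE hr eh hh h0 unfolding fam_def orthogonal_idempotents_def by auto
    moreover have "h \<notin> E"
      using eh hh h0 by metis
    ultimately show False
      using max[of "insert h E"] fin by simp
  qed
  moreover have "minimal_idempotent e" if e: "e \<in> E" for e
  proof (rule primitive_imp_minimal)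
    show ee: "e * e = e" "e \<noteq> 0"
      using oE e by (auto simp: orthogonal_idempotents_def)
    show "e \<in> socle"
      using socle_mult_left[OF a] y[OF e] by metis
    fix f assume f: "f * f = f" "e * f = f" "f * e = f"
    show "f = 0 \<or> f = e"
    proof (rule ccontr)
      assume ne: "\<not> (f = 0 \<or> f = e)"
      define F where "F = insert f (insert (e - f) (E - {e}))"
      have orth: "k * f = 0" "f * k = 0" "k * (e - f) = 0" "(e - f) * k = 0" if k: "k \<in> E - {e}" for k
      proof -
        have ke: "k * e = 0" "e * k = 0"
          using oE e k by (auto simp: orthogonal_idempotents_def)
        show "k * f = 0" "f * k = 0"
          using ke f by (metis mult.assoc mult_zero_left, metis mult.assoc mult_zero_right)
        then show "k * (e - f) = 0" "(e - f) * k = 0"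
          using ke by (simp_all add: left_diff_distrib right_diff_distrib)
      qed
      have idem: "(e - f) * (e - f) = e - f" "f * (e - f) = 0" "(e - f) * f = 0" "e - f \<noteq> 0"
        using ne by (auto simp: left_diff_distrib right_diff_distrib ee f)
      have "f = (f * y e) * a" "e - f = ((e - f) * y e) * a"
        using y[OF e] f ee by (simp_all add: mult.assoc left_diff_distrib)
      then have "f \<in> range (\<lambda>x. x * a)" "e - f \<in> range (\<lambda>x. x * a)"
        by blast+
      then have "fam F"
        using oE subE orth idem ne f(1) unfolding fam_def orthogonal_idempotents_def F_def by auto
      have "f \<notin> E - {e}"
        using orth(1)[of f] f(1) ne by auto
      moreover have "e - f \<notin> E - {e}"
        using orth(3)[of "e - f"] idem(1,4) by auto
      moreover have "f \<noteq> e - f"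
        using idem(2) f(1) ne by auto
      ultimately have "card F = Suc (Suc (card (E - {e})))"
        using fin by (simp add: F_def)
      also have "\<dots> = Suc (card E)"
        using card.remove[OF fin e] by simp
      finally show False
        using max[OF \<open>fam F\<close>] by simp
    qed
  qed
  ultimately show thesis
    using that[of E] oE ga unfolding g_def minimal_family_def by metis
qed

end

section \<open>Traces of linked components\<close>

lemma minimal_idempotent_socle:
  assumes "minimal_idempotent e"
  shows "e \<in> socle"
proof (rule socle_if_finite_dimensional)
  show "e * x * e \<in> complex_scale.span {e}" for x
  proof -
    obtain c where "e * x * e = c *\<^sub>C e"
      using assms unfolding minimal_idempotent_def by blast
    then show ?thesis
      by (simp add: complex_scale.span_scale complex_scale.span_base)
  qed
qed simp

definition corner_coeff :: "'a::complex_banach_algebra_1 \<Rightarrow> 'a \<Rightarrow> complex" where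
  "corner_coeff g x = (THE c. g * x * g = c *\<^sub>C g)"

lemma corner_coeff_unique:
  assumes "minimal_idempotent g" and "g * x * g = c *\<^sub>C g"
  shows "corner_coeff g x = c"
  unfolding corner_coeff_def
  by (rule the_equality) (use assms in \<open>auto simp: minimal_idempotent_def\<close>)

lemma corner_coeff:
  assumes "minimal_idempotent g"
  shows "g * x * g = corner_coeff g x *\<^sub>C g"
  using assms corner_coeff_unique[OF assms] unfolding minimal_idempotent_def by metis

lemma corner_coeff_add:
  assumes "minimal_idempotent g"
  shows "corner_coeff g (x + y) = corner_coeff g x + corner_coeff g y"
  by (rule corner_coeff_unique[OF assms])
    (simp add: distrib_left distrib_right scaleC_add_left flip: corner_coeff[OF assms])

lemma corner_coeff_scaleC:
  assumes "minimal_idempotent g"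
  shows "corner_coeff g (c *\<^sub>C x) = c * corner_coeff g x"
  by (rule corner_coeff_unique[OF assms])
    (simp add: mult_scaleC_left mult_scaleC_right corner_coeff[OF assms] scaleC_scaleC)

lemma corner_coeff_0:
  assumes "minimal_idempotent g" and "g * x * g = 0"
  shows "corner_coeff g x = 0"
  by (rule corner_coeff_unique[OF assms(1)]) (simp add: assms(2))

lemma corner_coeff_sum:
  assumes "minimal_idempotent g"
  shows "corner_coeff g (\<Sum>i\<in>I. x i) = (\<Sum>i\<in>I. corner_coeff g (x i))"
  by (induction I rule: infinite_finite_induct)
    (simp_all add: corner_coeff_0[OF assms] corner_coeff_add[OF assms])

text \<open>\<open>X * Y\<close> and \<open>Y * X\<close> are multiples of \<open>g\<close> and
  \<open>h\<close>, so associativity of \<open>X * Y * X\<close> compares the two coefficients on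
  \<open>X\<close>. For \<open>X = 0\<close> both vanish.\<close>

lemma corner_coeff_swap:
  assumes g: "minimal_idempotent g" and h: "minimal_idempotent h"
  shows "corner_coeff g (a * h * b) = corner_coeff h (b * g * a)"
proof -
  define X where "X = g * a * h"
  define Y where "Y = h * b * g"
  have gg: "g * g = g" and hh: "h * h = h"
    using g h by (simp_all add: minimal_idempotent_def)
  have "X * Y = g * a * (h * h) * b * g" "Y * X = h * b * (g * g) * a * h"
    by (simp_all only: X_def Y_def mult.assoc)
  then have XY: "X * Y = g * (a * h * b) * g" "Y * X = h * (b * g * a) * h"
    by (simp_all only: gg hh mult.assoc)
  have "g * X = (g * g) * a * h" "X * h = g * a * (h * h)"
    by (simp_all only: X_def mult.assoc)
  then have gX: "g * X = X" "X * h = X"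
    by (simp_all only: gg hh X_def)
  show ?thesis
  proof (cases "X = 0")
    case True
    then show ?thesis
      using corner_coeff_0[OF g, of "a * h * b"] corner_coeff_0[OF h, of "b * g * a"] XY by simp
  next
    case False
    have "(X * Y) * X = corner_coeff g (a * h * b) *\<^sub>C X"
      unfolding XY corner_coeff[OF g] by (simp add: mult_scaleC_left gX)
    moreover have "X * (Y * X) = corner_coeff h (b * g * a) *\<^sub>C X"
      unfolding XY corner_coeff[OF h] by (simp add: mult_scaleC_right gX)
    ultimately show ?thesis
      using False by (simp add: mult.assoc)
  qed
qed

text \<open>Such a \<open>P\<close> selects whole linked components, which is what makes the trace
  restricted to \<open>P\<close> well defined and invariant under swapping factors.\<close>

definition link_invariant :: "('a::complex_banach_algebra_1 \<Rightarrow> bool) \<Rightarrow> bool" where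
  "link_invariant P \<longleftrightarrow> (\<forall>g h x. minimal_idempotent g \<longrightarrow> minimal_idempotent h \<longrightarrow>
     g * x * h \<noteq> 0 \<longrightarrow> P g = P h)"

text \<open>Both sides are double sums over pairs \<open>(g, h)\<close>. Where \<open>P g\<close>
  and \<open>P h\<close> differ, \<open>g * a * h = 0\<close> and both coefficients vanish. The case
  \<open>b = 1\<close> gives independence of the family, the case \<open>R = S\<close> the trace
  property.\<close>

lemma family_trace_swap:
  assumes P: "link_invariant P" and R: "minimal_family R" and S: "minimal_family S"
  shows "(\<Sum>g\<in>R. if P g then corner_coeff g (a * \<Sum>S * b) else 0)
       = (\<Sum>h\<in>S. if P h then corner_coeff h (b * \<Sum>R * a) else 0)"
proof -
  have min: "minimal_idempotent g" if "g \<in> R \<union> S" for g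
    using that R S by (auto simp: minimal_family_def)
  have swap: "(if P g then corner_coeff g (a * h * b) else 0) = (if P h then corner_coeff h (b * g * a) else 0)"
    if "g \<in> R" "h \<in> S" for g h
  proof (cases "g * a * h = 0")
    case True
    then have "corner_coeff g (a * h * b) = 0"
      using min[of g] that by (intro corner_coeff_0) (simp_all flip: mult.assoc)
    then show ?thesis
      using corner_coeff_swap[of g h a b] min that by simp
  next
    case False
    then have "P g = P h"
      using P min that unfolding link_invariant_def by blast
    then show ?thesis
      using corner_coeff_swap[of g h a b] min that by simp
  qed
  have "(\<Sum>g\<in>R. if P g then corner_coeff g (a * \<Sum>S * b) else 0)
      = (\<Sum>g\<in>R. \<Sum>h\<in>S. if P g then corner_coeff g (a * h * b) else 0)"
    using min by (intro sum.cong)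
      (auto simp: sum_distrib_left sum_distrib_right corner_coeff_sum)
  also have "\<dots> = (\<Sum>g\<in>R. \<Sum>h\<in>S. if P h then corner_coeff h (b * g * a) else 0)"
    by (intro sum.cong refl swap)
  also have "\<dots> = (\<Sum>h\<in>S. \<Sum>g\<in>R. if P h then corner_coeff h (b * g * a) else 0)"
    by (rule sum.swap)
  also have "\<dots> = (\<Sum>h\<in>S. if P h then corner_coeff h (b * \<Sum>R * a) else 0)"
    using min by (intro sum.cong)
      (auto simp: sum_distrib_left sum_distrib_right corner_coeff_sum)
  finally show ?thesis .
qed

text \<open>
  The trace of the part of \<open>a\<close> lying in those simple components of the socle whose minimal
  idempotents satisfy \<open>P\<close>.
\<close>

definition trace_on :: "('a::complex_banach_algebra_1 \<Rightarrow> bool) \<Rightarrow> 'a \<Rightarrow> complex" where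
  "trace_on P a = (let R = (SOME R. minimal_family R \<and> \<Sum>R * a = a \<and> a * \<Sum>R = a)
     in (\<Sum>g\<in>R. if P g then corner_coeff g a else 0))"

section \<open>Links between minimal idempotents, the socle as an ideal, and local units\<close>

context
  fixes ty :: "'a::complex_banach_algebra_1 itself"
  assumes semisimple: "semisimple_algebra ty"
begin

text \<open>Semiprimeness gives \<open>y\<close> with \<open>(g x h) y (g x h)\<close> nonzero. Its
  part \<open>h y g x h\<close> is then a nonzero multiple of \<open>h\<close> and can be
  normalised.\<close>

lemma link_inverse:
  fixes g h x :: 'a
  assumes h: "minimal_idempotent h" and "g * x * h \<noteq> 0"
  obtains w where "h * w * g * x * h = h" "h * w * g \<noteq> 0"
proof -
  obtain y where y: "g * x * h * y * (g * x * h) \<noteq> 0"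
    using semiprime[OF semisimple, of "g * x * h"] assms(2) by blast
  obtain c where c: "h * (y * g * x) * h = c *\<^sub>C h"
    using h unfolding minimal_idempotent_def by blast
  have hh: "h * h = h" "h \<noteq> 0"
    using h by (auto simp: minimal_idempotent_def)
  have "g * x * h * y * (g * x * h) = g * x * (h * (y * g * x) * h)"
    by (simp only: mult.assoc)
  then have c0: "c \<noteq> 0"
    using y unfolding c by auto
  have 1: "h * (inverse c *\<^sub>C y) * g * x * h = h"
  proof -
    have "h * (inverse c *\<^sub>C y) * g * x * h = inverse c *\<^sub>C (h * (y * g * x) * h)"
      by (simp add: mult_scaleC_left mult_scaleC_right mult.assoc)
    then show ?thesis
      using c0 by (simp add: c scaleC_scaleC scaleC_one)
  qed
  moreover have "h * (inverse c *\<^sub>C y) * g \<noteq> 0"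
    using 1 hh(2) by auto
  ultimately show thesis
    by (rule that)
qed

text \<open>Links compose, because \<open>link_inverse\<close> recovers a nonzero
  \<open>h y e\<close> from \<open>g (x h y) e\<close>. They can also be reversed, so the property
  passes in both directions.\<close>

lemma link_invariant_linked:
  fixes e :: 'a
  assumes e: "minimal_idempotent e"
  shows "link_invariant (\<lambda>g. \<exists>x. g * x * e \<noteq> 0)"
proof -
  have step: "\<exists>x. g * x * e \<noteq> 0" if h: "minimal_idempotent h" "g * x * h \<noteq> 0" "h * y * e \<noteq> 0"
    for g h x y :: 'a
  proof -
    obtain w where w: "h * w * g * x * h = h"
      using link_inverse[OF h(1,2)] by metis
    have "h * w * (g * (x * h * y) * e) = h * w * g * x * h * y * e"
      by (simp only: mult.assoc)
    also have "\<dots> = h * y * e"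
      by (simp only: w)
    finally have "g * (x * h * y) * e \<noteq> 0"
      using h(3) by auto
    then show ?thesis
      by blast
  qed
  show ?thesis
    unfolding link_invariant_def
  proof (intro allI impI)
    fix g h x :: 'a assume gh: "minimal_idempotent g" "minimal_idempotent h" "g * x * h \<noteq> 0"
    obtain w where "h * w * g \<noteq> 0"
      using link_inverse[OF gh(2,3)] by metis
    then show "(\<exists>x. g * x * e \<noteq> 0) = (\<exists>x. h * x * e \<noteq> 0)"
      using step[of h g x] step[of g h w] gh by blast
  qed
qed

text \<open>Inserting \<open>f = f w e x f\<close> from \<open>link_inverse\<close> writes
  \<open>e y f\<close> as an element of \<open>e A e\<close>, a scalar multiple of \<open>e\<close>,
  times \<open>e x f\<close>.\<close>

lemma minimal_corner_one_dimensional: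
  fixes e f :: 'a
  assumes e: "minimal_idempotent e" and f: "minimal_idempotent f"
  obtains u where "\<And>x. \<exists>c. e * x * f = c *\<^sub>C u"
proof (cases "\<exists>x. e * x * f \<noteq> 0")
  case False
  then show thesis
    by (intro that[of 0]) simp
next
  case True
  then obtain x where x: "e * x * f \<noteq> 0"
    by blast
  obtain w where w: "f * w * e * x * f = f"
    using link_inverse[OF f x] by metis
  have "\<exists>c. e * y * f = c *\<^sub>C (e * x * f)" for y
  proof -
    obtain c where c: "e * (y * f * w) * e = c *\<^sub>C e"
      using e unfolding minimal_idempotent_def by blast
    have "e * y * f = e * y * (f * w * e * x * f)"
      by (simp only: w)
    also have "\<dots> = e * (y * f * w) * e * x * f"
      by (simp only: mult.assoc)
    also have "\<dots> = c *\<^sub>C (e * x * f)"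
      by (simp only: c mult_scaleC_left)
    finally show ?thesis
      by blast
  qed
  then show thesis
    by (rule that)
qed

text \<open>Right units of \<open>a\<close> and \<open>b\<close> split \<open>a x b\<close> into
  finitely many terms \<open>a e (x b) f\<close>, where \<open>e A f\<close> is at most
  one-dimensional.\<close>

lemma socle_product_finite_dimensional:
  fixes a b :: 'a
  assumes "a \<in> socle" and "b \<in> socle"
  obtains B where "finite B" "\<And>x. a * x * b \<in> complex_scale.span B"
proof -
  obtain E where E: "minimal_family E" "a * \<Sum>E = a"
    using socle_right_unit[OF semisimple assms(1)] by metis
  obtain F where F: "minimal_family F" "b * \<Sum>F = b"
    using socle_right_unit[OF semisimple assms(2)] by metis
  have "\<exists>u. \<forall>x. \<exists>c. e * x * f = c *\<^sub>C u" if "e \<in> E" "f \<in> F" for e f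
    using minimal_corner_one_dimensional[of e f] that E(1) F(1) unfolding minimal_family_def by metis
  then obtain u where u: "\<And>e f x. e \<in> E \<Longrightarrow> f \<in> F \<Longrightarrow> \<exists>c. e * x * f = c *\<^sub>C u e f"
    by metis
  define B where "B = (\<lambda>(e, f). a * u e f) ` (E \<times> F)"
  show thesis
  proof
    show "finite B"
      using E(1) F(1) by (simp add: B_def minimal_family_def orthogonal_idempotents_def)
    fix x
    have "a * x * b = a * \<Sum>E * x * (b * \<Sum>F)"
      by (simp only: E(2) F(2))
    also have "\<dots> = (\<Sum>e\<in>E. \<Sum>f\<in>F. a * (e * (x * b) * f))"
      by (simp add: sum_distrib_left sum_distrib_right mult.assoc) (rule sum.swap)
    also have "\<dots> \<in> complex_scale.span B"
    proof (intro complex_scale.span_sum)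
      fix e f assume ef: "e \<in> E" "f \<in> F"
      then obtain c where "e * (x * b) * f = c *\<^sub>C u e f"
        using u by blast
      moreover have "a * u e f \<in> B"
        using ef by (auto simp: B_def)
      ultimately show "a * (e * (x * b) * f) \<in> complex_scale.span B"
        by (simp add: mult_scaleC_right complex_scale.span_scale complex_scale.span_base)
    qed
    finally show "a * x * b \<in> complex_scale.span B" .
  qed
qed

text \<open>Spectra of sums are not controlled by spectra of summands. Instead
  \<open>(a + b) x (a + b)\<close> lies in a sum of four finite-dimensional spaces.\<close>

lemma socle_add:
  fixes a b :: 'a
  assumes "a \<in> socle" and "b \<in> socle"
  shows "a + b \<in> socle"
proof -
  obtain B1 where B1: "finite B1" "\<And>x. a * x * a \<in> complex_scale.span B1"
    using socle_product_finite_dimensional[OF assms(1,1)] by metis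
  obtain B2 where B2: "finite B2" "\<And>x. a * x * b \<in> complex_scale.span B2"
    using socle_product_finite_dimensional[OF assms(1,2)] by metis
  obtain B3 where B3: "finite B3" "\<And>x. b * x * a \<in> complex_scale.span B3"
    using socle_product_finite_dimensional[OF assms(2,1)] by metis
  obtain B4 where B4: "finite B4" "\<And>x. b * x * b \<in> complex_scale.span B4"
    using socle_product_finite_dimensional[OF assms(2,2)] by metis
  define B where "B = B1 \<union> B2 \<union> B3 \<union> B4"
  have sub: "complex_scale.span Bi \<subseteq> complex_scale.span B" if "Bi \<in> {B1, B2, B3, B4}" for Bi
    using that by (intro complex_scale.span_mono) (auto simp: B_def)
  show ?thesis
  proof (rule socle_if_finite_dimensional[of B])
    show "finite B"
      using B1 B2 B3 B4 by (simp add: B_def)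
    fix x
    have "(a + b) * x * (a + b) = a * x * a + a * x * b + (b * x * a + b * x * b)"
      by (simp add: distrib_left distrib_right)
    also have "\<dots> \<in> complex_scale.span B"
      using sub[of B1] sub[of B2] sub[of B3] sub[of B4] B1(2)[of x] B2(2)[of x] B3(2)[of x] B4(2)[of x]
      by (intro complex_scale.span_add) auto
    finally show "(a + b) * x * (a + b) \<in> complex_scale.span B" .
  qed
qed

lemma socle_diff:
  fixes a b :: 'a
  assumes "a \<in> socle" and "b \<in> socle"
  shows "a - b \<in> socle"
  using socle_add[OF assms(1) socle_scaleC[OF assms(2), of "- 1"]] by (simp add: scaleC_one)

text \<open>The family from \<open>socle_right_unit\<close> sums to \<open>y * p\<close> instead of
  \<open>p\<close>. Its members satisfy \<open>e * p = e\<close>, so left multiplication by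
  \<open>p\<close> preserves the product relations and corrects the sum.\<close>

lemma idempotent_minimal_family:
  fixes p :: 'a
  assumes "p \<in> socle" and pp: "p * p = p"
  obtains F where "minimal_family F" "\<Sum>F = p"
proof -
  obtain E y where E: "minimal_family E" "\<Sum>E = y * p" "p * \<Sum>E = p"
    using socle_right_unit[OF semisimple assms(1)] by metis
  have orth: "orthogonal_idempotents E"
    using E(1) by (simp add: minimal_family_def)
  have ep: "e * p = e" if "e \<in> E" for e
  proof -
    have "e * p = e * (y * p) * p"
      using orthogonal_sum(1)[OF orth that] E(2) by simp
    also have "\<dots> = e * (y * p)"
      by (simp add: mult.assoc pp)
    also have "\<dots> = e"
      using orthogonal_sum(1)[OF orth that] E(2) by simp
    finally show ?thesis .
  qed
  have epf: "e * (p * f) = e * f" if "e \<in> E" for e f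
    using ep[OF that] by (simp flip: mult.assoc)
  have inj: "inj_on ((*) p) E"
  proof (rule inj_onI, rule ccontr)
    fix e f assume ef: "e \<in> E" "f \<in> E" "p * e = p * f" "e \<noteq> f"
    then have "e * e = e * f"
      using epf by metis
    then show False
      using orth ef by (auto simp: orthogonal_idempotents_def)
  qed
  have min: "minimal_idempotent (p * e)" if e: "e \<in> E" for e
  proof -
    have m: "minimal_idempotent e" "e * e = e" "e \<noteq> 0"
      using E(1) e by (auto simp: minimal_family_def minimal_idempotent_def)
    have "\<exists>c. (p * e) * x * (p * e) = c *\<^sub>C (p * e)" for x
    proof -
      have "(p * e) * x * (p * e) = p * (e * (x * p) * e)"
        by (simp only: mult.assoc)
      also have "\<dots> = corner_coeff e (x * p) *\<^sub>C (p * e)"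
        by (simp only: corner_coeff[OF m(1)] mult_scaleC_right)
      finally show ?thesis
        by blast
    qed
    moreover have "(p * e) * (p * e) = p * e"
      by (simp add: mult.assoc epf[OF e] m(2))
    moreover have "p * e \<noteq> 0"
      using epf[OF e, of e] m by auto
    ultimately show ?thesis
      by (simp add: minimal_idempotent_def)
  qed
  have "(p * e) * (p * f) = 0" if "e \<in> E" "f \<in> E" "e \<noteq> f" for e f
    using epf[OF that(1)] orth that by (simp add: mult.assoc orthogonal_idempotents_def)
  then have "minimal_family ((*) p ` E)"
    using min orth inj by (auto simp: minimal_family_def orthogonal_idempotents_def minimal_idempotent_def inj_on_def)
  moreover have "\<Sum>((*) p ` E) = p"
    using E(3) by (simp add: sum.reindex[OF inj] sum_distrib_left)
  ultimately show thesis
    by (rule that)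
qed

text \<open>The idempotent \<open>f\<close> fixes \<open>(1 - e) b\<close> from the left and
  satisfies \<open>e * f = 0\<close>, but \<open>f * e\<close> may be nonzero; hence
  \<open>e + f (1 - e)\<close> in place of \<open>e + f\<close>.\<close>

lemma extend_left_unit:
  fixes e b :: 'a
  assumes e: "e \<in> socle" "e * e = e" and b: "b \<in> socle"
  obtains g where "g \<in> socle" "g * g = g" "g * e = e" "e * g = e" "g * b = b"
proof -
  define c where "c = b - e * b"
  have "c \<in> socle"
    unfolding c_def by (intro socle_diff b socle_mult_left)
  then obtain E y where E: "\<Sum>E = y * c" "c * \<Sum>E = c"
    using socle_right_unit[OF semisimple] by metis
  \<comment> \<open>Interchanging the factors turns the right unit \<open>y * c\<close> of
    \<open>c\<close> into a left unit.\<close>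
  define f where "f = c * y"
  have fc: "f * c = c"
    using E by (simp add: f_def mult.assoc)
  have ff: "f * f = f"
    using fc by (simp add: f_def flip: mult.assoc)
  have "e * c = 0"
    using e(2) by (simp add: c_def right_diff_distrib flip: mult.assoc)
  then have ef: "e * f = 0"
    by (simp add: f_def flip: mult.assoc)
  then have ef': "e * (f * z) = 0" for z
    by (simp flip: mult.assoc)
  define g where "g = e + f - f * e"
  have eg: "e * g = e" and ge: "g * e = e" and gf: "g * f = f"
    by (simp_all add: g_def distrib_left distrib_right left_diff_distrib right_diff_distrib
        e(2) ef ef' ff mult.assoc)
  have fg: "f * g = f"
    by (simp add: g_def distrib_left right_diff_distrib e(2) ff flip: mult.assoc)
  show thesis
  proof
    have "f \<in> socle"
      unfolding f_def by (rule socle_mult_right) fact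
    then show "g \<in> socle"
      unfolding g_def by (intro socle_diff socle_add e(1) socle_mult_right)
    have "g * g = e * g + f * g - f * (e * g)"
      by (simp only: g_def left_diff_distrib distrib_right mult.assoc)
    then show "g * g = g"
      by (simp only: eg fg flip: g_def)
    have "g * c = c"
      using gf fc by (metis mult.assoc)
    moreover have "b = e * b + c"
      by (simp add: c_def)
    ultimately show "g * b = b"
      using ge by (metis distrib_left mult.assoc)
  qed (fact ge eg)+
qed

text \<open>Mirror image of \<open>extend_left_unit\<close>: now \<open>f * e = 0\<close>, and
  \<open>e + (1 - e) f\<close> repairs the other product.\<close>

lemma extend_right_unit:
  fixes e b :: 'a
  assumes e: "e \<in> socle" "e * e = e" and b: "b \<in> socle"
  obtains g where "g \<in> socle" "g * g = g" "g * e = e" "e * g = e" "b * g = b"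
proof -
  define c where "c = b - b * e"
  have "c \<in> socle"
    unfolding c_def by (intro socle_diff b socle_mult_right)
  then obtain E y where E: "\<Sum>E = y * c" "c * \<Sum>E = c"
    using socle_right_unit[OF semisimple] by metis
  define f where "f = y * c"
  have cf: "c * f = c"
    using E by (simp add: f_def)
  have ff: "f * f = f"
    using cf by (simp add: f_def mult.assoc)
  have "c * e = 0"
    by (simp add: c_def left_diff_distrib mult.assoc e(2))
  then have fe: "f * e = 0"
    by (simp add: f_def mult.assoc)
  then have fe': "f * (e * z) = 0" for z
    by (simp flip: mult.assoc)
  have ee': "e * (e * z) = e * z" for z
    by (simp add: e(2) flip: mult.assoc)
  define g where "g = e + f - e * f"
  have eg: "e * g = e" and ge: "g * e = e" and fg: "f * g = f"
    by (simp_all add: g_def distrib_left distrib_right left_diff_distrib right_diff_distrib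
        e(2) fe fe' ff ee' mult.assoc)
  show thesis
  proof
    have "f \<in> socle"
      unfolding f_def by (rule socle_mult_left) fact
    then show "g \<in> socle"
      unfolding g_def by (intro socle_diff socle_add e(1) socle_mult_left)
    have "g * g = e * g + f * g - e * (f * g)"
      by (simp only: g_def left_diff_distrib distrib_right mult.assoc)
    then show "g * g = g"
      by (simp only: eg fg flip: g_def)
    have "c * g = c"
      using fg cf by (metis mult.assoc)
    moreover have "b = b * e + c"
      by (simp add: c_def)
    ultimately show "b * g = b"
      using eg by (metis distrib_right mult.assoc)
  qed (fact ge eg)+
qed

text \<open>Elements are adjoined one at a time, on the left and then on the right. Each enlarged
  idempotent \<open>g\<close> satisfies \<open>g * r = r = r * g\<close>, so it remains a unit for
  the earlier elements.\<close>

lemma common_unit: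
  fixes S :: "'a set"
  assumes "finite S" and "S \<subseteq> socle"
  obtains R where "minimal_family R" "\<And>s. s \<in> S \<Longrightarrow> \<Sum>R * s = s \<and> s * \<Sum>R = s"
proof -
  have "\<exists>r\<in>socle. r * r = r \<and> (\<forall>s\<in>S. r * s = s \<and> s * r = s)"
    using assms
  proof (induction S rule: finite_induct)
    case empty
    have "(0::'a) \<in> socle"
      by (rule socle_if_finite_dimensional[of "{}"]) simp_all
    then show ?case
      by (intro bexI[of _ 0]) simp_all
  next
    case (insert b S)
    then obtain r where r: "r \<in> socle" "r * r = r" "\<And>s. s \<in> S \<Longrightarrow> r * s = s \<and> s * r = s"
      by auto
    have b: "b \<in> socle"
      using insert.prems by simp
    obtain g where g: "g \<in> socle" "g * g = g" "g * r = r" "r * g = r" "g * b = b"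
      using extend_left_unit[OF r(1,2) b] by metis
    obtain h where h: "h \<in> socle" "h * h = h" "h * g = g" "g * h = g" "b * h = b"
      using extend_right_unit[OF g(1,2) b] by metis
    have "h * s = s \<and> s * h = s" if s: "s \<in> insert b S" for s
    proof (cases "s = b")
      case True
      have "h * b = h * g * b"
        by (simp only: mult.assoc g(5))
      then show ?thesis
        by (simp add: True h(3,5) g(5))
    next
      case False
      then have rs: "r * s = s" "s * r = s"
        using r(3) s by auto
      have "g * s = g * r * s" "s * g = s * (r * g)"
        by (simp_all only: mult.assoc rs) (simp only: rs flip: mult.assoc)
      then have gs: "g * s = s" "s * g = s"
        by (simp_all only: g(3,4) rs)
      have "h * s = h * g * s" "s * h = s * (g * h)"
        by (simp_all only: mult.assoc gs) (simp only: gs flip: mult.assoc)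
      then show ?thesis
        by (simp only: h(3,4) gs)
    qed
    then show ?case
      using h(1,2) by blast
  qed
  then obtain r where r: "r \<in> socle" "r * r = r" "\<And>s. s \<in> S \<Longrightarrow> r * s = s \<and> s * r = s"
    by blast
  obtain R where "minimal_family R" "\<Sum>R = r"
    using idempotent_minimal_family[OF r(1,2)] by metis
  then show thesis
    using that[of R] r(3) by blast
qed

text \<open>\<open>family_trace_swap\<close> with second factor 1 compares \<open>R\<close>, a left
  unit of \<open>a\<close>, with the chosen family, a right unit. One family can then serve several
  elements at once.\<close>

lemma trace_on_eq:
  fixes a :: 'a
  assumes P: "link_invariant P" and a: "a \<in> socle"
    and R: "minimal_family R" "\<Sum>R * a = a"
  shows "trace_on P a = (\<Sum>g\<in>R. if P g then corner_coeff g a else 0)"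
proof -
  define S where "S = (SOME R. minimal_family R \<and> \<Sum>R * a = a \<and> a * \<Sum>R = a)"
  have "\<exists>R. minimal_family R \<and> \<Sum>R * a = a \<and> a * \<Sum>R = a"
    using common_unit[of "{a}"] a by (metis empty_subsetI finite.simps insertI1 insert_subset)
  then have S: "minimal_family S" "a * \<Sum>S = a"
    unfolding S_def by (rule someI2_ex; blast)+
  have "(\<Sum>g\<in>R. if P g then corner_coeff g (a * \<Sum>S * 1) else 0)
      = (\<Sum>h\<in>S. if P h then corner_coeff h (1 * \<Sum>R * a) else 0)"
    by (rule family_trace_swap[OF P R(1) S(1)])
  then show ?thesis
    unfolding mult_1_left mult_1_right S(2) R(2) trace_on_def Let_def S_def[symmetric] by (rule sym)
qed

lemma trace_on_linear:
  assumes P: "link_invariant P"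
  shows "linear_functional_on (socle :: 'a set) (trace_on P)"
  unfolding linear_functional_on_def
proof (intro conjI ballI allI)
  fix a b :: 'a assume ab: "a \<in> socle" "b \<in> socle"
  then obtain R where R: "minimal_family R" "\<And>s. s \<in> {a, b} \<Longrightarrow> \<Sum>R * s = s \<and> s * \<Sum>R = s"
    using common_unit[of "{a, b}"] by auto
  have min: "minimal_idempotent g" if "g \<in> R" for g
    using that R(1) by (simp add: minimal_family_def)
  have Rab: "\<Sum>R * a = a" "\<Sum>R * b = b" "\<Sum>R * (a + b) = a + b"
    using R(2) by (simp_all add: distrib_left)
  show "trace_on P (a + b) = trace_on P a + trace_on P b"
    unfolding trace_on_eq[OF P ab(1) R(1) Rab(1)] trace_on_eq[OF P ab(2) R(1) Rab(2)]
      trace_on_eq[OF P socle_add[OF ab] R(1) Rab(3)] sum.distrib[symmetric]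
    by (intro sum.cong) (auto simp: corner_coeff_add[OF min])
next
  fix c and a :: 'a assume a: "a \<in> socle"
  then obtain R where R: "minimal_family R" "\<And>s. s \<in> {a} \<Longrightarrow> \<Sum>R * s = s \<and> s * \<Sum>R = s"
    using common_unit[of "{a}"] by auto
  have min: "minimal_idempotent g" if "g \<in> R" for g
    using that R(1) by (simp add: minimal_family_def)
  have Ra: "\<Sum>R * a = a" "\<Sum>R * (c *\<^sub>C a) = c *\<^sub>C a"
    using R(2) by (simp_all add: mult_scaleC_right)
  show "trace_on P (c *\<^sub>C a) = c * trace_on P a"
    unfolding trace_on_eq[OF P a R(1) Ra(1)] trace_on_eq[OF P socle_scaleC[OF a] R(1) Ra(2)] sum_distrib_left
    by (intro sum.cong) (auto simp: corner_coeff_scaleC[OF min])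
qed

lemma trace_on_commute:
  fixes a b :: 'a
  assumes P: "link_invariant P" and ab: "a \<in> socle" "b \<in> socle"
  shows "trace_on P (a * b) = trace_on P (b * a)"
proof -
  obtain R where R: "minimal_family R" "\<And>s. s \<in> {a, b} \<Longrightarrow> \<Sum>R * s = s \<and> s * \<Sum>R = s"
    using common_unit[of "{a, b}"] ab by auto
  have Rab: "\<Sum>R * (a * b) = a * b" "\<Sum>R * (b * a) = b * a" "a * \<Sum>R = a" "b * \<Sum>R = b"
    using R(2) by (simp_all flip: mult.assoc)
  show ?thesis
    using family_trace_swap[OF P R(1) R(1), of a b]
    by (simp only: Rab(3,4) trace_on_eq[OF P socle_mult_left[OF ab(2)] R(1) Rab(1)]
        trace_on_eq[OF P socle_mult_left[OF ab(1)] R(1) Rab(2)])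
qed

lemma trace_on_minimal:
  fixes e :: 'a
  assumes P: "link_invariant P" and e: "minimal_idempotent e"
  shows "trace_on P e = of_bool (P e)"
proof -
  have "minimal_family {e}" "\<Sum>{e} * e = e"
    using e by (simp_all add: minimal_family_def orthogonal_idempotents_def minimal_idempotent_def)
  then have "trace_on P e = (\<Sum>g\<in>{e}. if P g then corner_coeff g e else 0)"
    using trace_on_eq[OF P minimal_idempotent_socle[OF e]] by blast
  moreover have "corner_coeff e e = 1"
    by (rule corner_coeff_unique[OF e]) (use e in \<open>simp add: minimal_idempotent_def scaleC_one\<close>)
  ultimately show ?thesis
    by simp
qed

end

section \<open>Matrices and the roots of their characteristic polynomials\<close>

lemma proots_linear_factors: "proots (\<Prod>a\<leftarrow>as. [:- a, 1:]) = mset (as :: complex list)"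
proof (induction as)
  case (Cons a as)
  have "(\<Prod>a\<leftarrow>as. [:- a, 1:]) \<noteq> 0"
    by (auto simp: prod_list_zero_iff)
  then show ?case
    using Cons by (simp add: proots_mult del: mult_pCons_left)
qed simp

lemma poly_linear_factors:
  "poly (\<Prod>a\<leftarrow>as. [:- a, 1:]) z = (\<Prod>i<length as. z - as ! i)" for z :: complex
proof -
  have "poly (\<Prod>a\<leftarrow>as. [:- a, 1:]) z = (\<Prod>a\<leftarrow>as. z - a)"
    by (induction as) (simp_all add: algebra_simps)
  then show ?thesis
    by (simp add: prod.list_conv_set_nth atLeast0LessThan)
qed

text \<open>Bolzano-Weierstrass, applied to one coordinate after another.\<close>

lemma convergent_list_subsequence:
  fixes bs :: "nat \<Rightarrow> complex list"
  assumes "\<And>n i. i < k \<Longrightarrow> cmod (bs n ! i) \<le> C"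
  obtains r where "strict_mono r" "\<And>i. i < k \<Longrightarrow> convergent (\<lambda>n. bs (r n) ! i)"
proof -
  have "\<exists>r. strict_mono r \<and> (\<forall>i<m. convergent (\<lambda>n. bs (r n) ! i))" if "m \<le> k" for m
    using that
  proof (induction m)
    case 0
    show ?case
      using strict_mono_id by auto
  next
    case (Suc m)
    then obtain r where r: "strict_mono r" "\<And>i. i < m \<Longrightarrow> convergent (\<lambda>n. bs (r n) ! i)"
      by auto
    have "bounded (range (\<lambda>n. bs (r n) ! m))"
      unfolding bounded_iff using assms Suc.prems by (intro exI[of _ C]) auto
    then obtain l s where s: "strict_mono s" "((\<lambda>n. bs (r n) ! m) \<circ> s) \<longlonglongrightarrow> l"
      using bounded_imp_convergent_subsequence by blast
    have "convergent (\<lambda>n. bs ((r \<circ> s) n) ! i)" if "i < Suc m" for i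
    proof (cases "i = m")
      case True
      then show ?thesis
        using s(2) by (auto simp: convergent_def o_def)
    next
      case False
      then have "convergent (\<lambda>n. bs (r n) ! i)"
        using r(2) that by simp
      then show ?thesis
        using convergent_subseq_convergent[OF _ s(1)] by (simp add: o_def)
    qed
    then show ?case
      using strict_mono_o[OF r(1) s(1)] by blast
  qed
  then show thesis
    using that by blast
qed

text \<open>Bounded root lists converge along a subsequence, and the limits factor the limit
  polynomial. A subsequence suffices for the later argument by contradiction.\<close>

lemma roots_converge:
  fixes as :: "complex list"
  assumes len: "\<And>n. length (bs n) = length as"
    and bd: "\<And>n b. b \<in> set (bs n) \<Longrightarrow> cmod b \<le> C"
    and conv: "\<And>z. (\<lambda>n. poly (\<Prod>b\<leftarrow>bs n. [:- b, 1:]) z) \<longlonglongrightarrow> poly (\<Prod>a\<leftarrow>as. [:- a, 1:]) z"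
  obtains r cs where "strict_mono r" "mset cs = mset as"
    "\<And>i. i < length as \<Longrightarrow> (\<lambda>n. bs (r n) ! i) \<longlonglongrightarrow> cs ! i"
proof -
  have "cmod (bs n ! i) \<le> C" if "i < length as" for n i
    using bd len that nth_mem by metis
  then obtain r where r: "strict_mono r" "\<And>i. i < length as \<Longrightarrow> convergent (\<lambda>n. bs (r n) ! i)"
    using convergent_list_subsequence[of "length as" bs C] by blast
  define cs where "cs = map (\<lambda>i. lim (\<lambda>n. bs (r n) ! i)) [0..<length as]"
  have cs: "(\<lambda>n. bs (r n) ! i) \<longlonglongrightarrow> cs ! i" if "i < length as" for i
    using r(2)[OF that] that by (simp add: cs_def convergent_LIMSEQ_iff)
  have lcs: "length cs = length as"
    by (simp add: cs_def)
  have "poly (\<Prod>a\<leftarrow>cs. [:- a, 1:]) z = poly (\<Prod>a\<leftarrow>as. [:- a, 1:]) z" for z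
  proof (rule LIMSEQ_unique)
    show "(\<lambda>n. poly (\<Prod>b\<leftarrow>bs (r n). [:- b, 1:]) z) \<longlonglongrightarrow> poly (\<Prod>a\<leftarrow>cs. [:- a, 1:]) z"
      unfolding poly_linear_factors len lcs
      by (intro tendsto_prod tendsto_diff tendsto_const cs) simp
    show "(\<lambda>n. poly (\<Prod>b\<leftarrow>bs (r n). [:- b, 1:]) z) \<longlonglongrightarrow> poly (\<Prod>a\<leftarrow>as. [:- a, 1:]) z"
      using LIMSEQ_subseq_LIMSEQ[OF conv r(1)] by (simp add: o_def)
  qed
  then have "(\<Prod>a\<leftarrow>cs. [:- a, 1:]) = (\<Prod>a\<leftarrow>as. [:- a, 1:])"
    by (simp add: poly_eq_poly_eq_iff[symmetric] fun_eq_iff)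
  then have "mset cs = mset as"
    by (metis proots_linear_factors)
  then show thesis
    using that r(1) cs by blast
qed

text \<open>By the Leibniz formula the value at \<open>z\<close> is a polynomial in the
  entries.\<close>

lemma char_poly_tendsto:
  fixes B :: "complex mat"
  assumes A: "\<And>n. A n \<in> carrier_mat k k" and B: "B \<in> carrier_mat k k"
    and conv: "\<And>i j. i < k \<Longrightarrow> j < k \<Longrightarrow> (\<lambda>n. A n $$ (i, j)) \<longlonglongrightarrow> B $$ (i, j)"
  shows "(\<lambda>n. poly (char_poly (A n)) z) \<longlonglongrightarrow> poly (char_poly B) z"
proof -
  have less: "p i < k" if "p permutes {0..<k}" "i < k" for p i
    using permutes_in_image[OF that(1), of i] that(2) by simp
  have *: "poly (char_poly X) z = (\<Sum>p | p permutes {0..<k}.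
      signof p * (\<Prod>i = 0..<k. (if i = p i then z else 0) - X $$ (i, p i)))"
    if X: "X \<in> carrier_mat k k" for X :: "complex mat"
  proof -
    have "- char_matrix X z \<in> carrier_mat k k"
      using X by (simp add: char_matrix_def)
    moreover have "(- char_matrix X z) $$ (i, j) = (if i = j then z else 0) - X $$ (i, j)"
      if "i < k" "j < k" for i j
      using X that by (simp add: char_matrix_def)
    ultimately show ?thesis
      unfolding char_poly_matrix[OF X]
      by (subst det_def'[of _ k]) (auto intro!: sum.cong prod.cong simp: less)
  qed
  show ?thesis
    unfolding *[OF A] *[OF B]
    by (intro tendsto_sum tendsto_mult tendsto_prod tendsto_diff tendsto_const conv)
      (auto simp: less)
qed

lemma index_mult_square_mat:
  fixes X Y :: "complex mat"
  assumes "X \<in> carrier_mat n n" and "Y \<in> carrier_mat n n" and "i < n" and "j < n"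
  shows "(X * Y) $$ (i, j) = (\<Sum>l<n. X $$ (i, l) * Y $$ (l, j))"
  using assms by (simp add: scalar_prod_def atLeast0LessThan)

lemma sum_diagonal_mult_commute:
  fixes X Y :: "complex mat"
  assumes "X \<in> carrier_mat k k" and "Y \<in> carrier_mat k k"
  shows "(\<Sum>i<k. (X * Y) $$ (i, i)) = (\<Sum>i<k. (Y * X) $$ (i, i))"
proof -
  have "(\<Sum>i<k. (X * Y) $$ (i, i)) = (\<Sum>i<k. \<Sum>j<k. X $$ (i, j) * Y $$ (j, i))"
    by (simp add: index_mult_square_mat[OF assms])
  also have "\<dots> = (\<Sum>j<k. \<Sum>i<k. Y $$ (j, i) * X $$ (i, j))"
    by (subst sum.swap) (simp add: mult.commute)
  also have "\<dots> = (\<Sum>i<k. (Y * X) $$ (i, i))"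
    by (simp add: index_mult_square_mat[OF assms(2,1)])
  finally show ?thesis .
qed

text \<open>Similarity preserves the sum of the diagonal, and the diagonal of the Schur form lists
  the roots.\<close>

lemma sum_diagonal_eq_sum_roots:
  fixes A :: "complex mat"
  assumes A: "A \<in> carrier_mat k k" and as: "char_poly A = (\<Prod>a\<leftarrow>as. [:- a, 1:])"
  shows "(\<Sum>i<k. A $$ (i, i)) = sum_list as"
proof -
  obtain T P Q where schur: "schur_decomposition A as = (T, P, Q)"
    by (cases "schur_decomposition A as") auto
  then have sim: "similar_mat_wit A T P Q" and T: "diag_mat T = as"
    using schur_decomposition[OF A as schur] by simp_all
  then have PQ: "T \<in> carrier_mat k k" "P \<in> carrier_mat k k" "Q \<in> carrier_mat k k" "Q * P = 1\<^sub>m k" "A = P * T * Q"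
    using similar_mat_witD2[OF A sim] by auto
  have "(\<Sum>i<k. A $$ (i, i)) = (\<Sum>i<k. (Q * (P * T)) $$ (i, i))"
    unfolding PQ(5) by (rule sum_diagonal_mult_commute) (use PQ in auto)
  also have "Q * (P * T) = T"
    by (simp add: assoc_mult_mat[OF PQ(3,2,1), symmetric] PQ(4) left_mult_one_mat[OF PQ(1)])
  also have "(\<Sum>i<k. T $$ (i, i)) = sum_list as"
    using PQ(1) by (simp add: diag_mat_def interv_sum_list_conv_sum_set_nat atLeast0LessThan flip: T)
  finally show ?thesis .
qed

text \<open>In a triangularising basis, adding \<open>s\<close> times the diagonal matrix with
  entries 1, ..., k moves the roots at different speeds. Only finitely many \<open>s\<close> make
  two of them meet or one of them vanish.\<close>

lemma char_poly_simple_perturbation: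
  fixes A :: "complex mat"
  assumes A: "A \<in> carrier_mat k k"
  obtains N where "N \<in> carrier_mat k k"
    "\<And>\<epsilon>. 0 < \<epsilon> \<Longrightarrow> \<exists>s bs. 0 < s \<and> s < \<epsilon> \<and> char_poly (A + of_real s \<cdot>\<^sub>m N) = (\<Prod>b\<leftarrow>bs. [:- b, 1:]) \<and>
       length bs = k \<and> distinct bs \<and> 0 \<notin> set bs"
proof -
  obtain as where as: "char_poly A = (\<Prod>a\<leftarrow>as. [:- a, 1:])" "length as = k"
    using char_poly_factorized[OF A] by blast
  obtain T P Q where schur: "schur_decomposition A as = (T, P, Q)"
    by (cases "schur_decomposition A as") auto
  then have sim: "similar_mat_wit A T P Q" and T: "diag_mat T = as" and ut: "upper_triangular T"
    using schur_decomposition[OF A as(1) schur] by simp_all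
  have PQ: "T \<in> carrier_mat k k" "P \<in> carrier_mat k k" "Q \<in> carrier_mat k k" "P * Q = 1\<^sub>m k" "Q * P = 1\<^sub>m k"
      "A = P * T * Q"
    using similar_mat_witD2[OF A sim] by auto
  define D :: "complex mat" where "D = Matrix.mat k k (\<lambda>(i, j). if i = j then of_nat (Suc i) else 0)"
  have D: "D \<in> carrier_mat k k"
    by (simp add: D_def)
  have Tii: "T $$ (i, i) = as ! i" if "i < k" for i
    using that PQ(1) T by (auto simp: diag_mat_def)
  define bs where "bs s = map (\<lambda>i. as ! i + of_real s * of_nat (Suc i)) [0..<k]" for s :: real
  have cp: "char_poly (A + of_real s \<cdot>\<^sub>m (P * D * Q)) = (\<Prod>b\<leftarrow>bs s. [:- b, 1:])" for s :: real
  proof -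
    let ?U = "T + of_real s \<cdot>\<^sub>m D"
    have U: "?U \<in> carrier_mat k k"
      using PQ D by simp
    have "P * ?U * Q = (P * T + P * (of_real s \<cdot>\<^sub>m D)) * Q"
      using PQ D by (subst mult_add_distrib_mat[of _ k k _ k]) auto
    also have "\<dots> = P * T * Q + P * (of_real s \<cdot>\<^sub>m D) * Q"
      using PQ D by (subst add_mult_distrib_mat[of _ k k _ _ k]) auto
    also have "P * (of_real s \<cdot>\<^sub>m D) = of_real s \<cdot>\<^sub>m (P * D)"
      using PQ D by (subst mult_smult_distrib[of _ k k _ k]) auto
    also have "of_real s \<cdot>\<^sub>m (P * D) * Q = of_real s \<cdot>\<^sub>m (P * D * Q)"
      using PQ D by (subst mult_smult_assoc_mat[of _ k k _ k]) auto
    finally have eq: "A + of_real s \<cdot>\<^sub>m (P * D * Q) = P * ?U * Q"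
      by (simp only: PQ(6))
    have "similar_mat (A + of_real s \<cdot>\<^sub>m (P * D * Q)) ?U"
    proof (rule similar_matI[of _ _ P Q k])
      show "{A + of_real s \<cdot>\<^sub>m (P * D * Q), ?U, P, Q} \<subseteq> carrier_mat k k"
        using PQ(1-3) D U A by auto
    qed (fact PQ(4) PQ(5) eq)+
    then have "char_poly (A + of_real s \<cdot>\<^sub>m (P * D * Q)) = char_poly ?U"
      by (rule char_poly_similar)
    also have "\<dots> = (\<Prod>b\<leftarrow>diag_mat ?U. [:- b, 1:])"
      by (rule char_poly_upper_triangular[OF U])
        (use ut PQ(1) D in \<open>auto simp: upper_triangular_def D_def\<close>)
    also have "diag_mat ?U = bs s"
      unfolding diag_mat_def bs_def using PQ(1) D by (intro map_cong) (auto simp: D_def Tii)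
    finally show ?thesis .
  qed
  \<comment> \<open>Solutions \<open>s\<close> of the vanishing and collision equations;
    \<open>Re\<close> takes them to the reals. For \<open>i = j\<close>, division by 0 merely
    contributes the value 0.\<close>
  define bad where "bad = (\<lambda>i. Re (- as ! i / of_nat (Suc i))) ` {..<k} \<union>
    (\<lambda>(i, j). Re ((as ! j - as ! i) / (of_nat (Suc i) - of_nat (Suc j)))) ` ({..<k} \<times> {..<k})"
  have bad: "finite bad"
    by (simp add: bad_def)
  have good: "distinct (bs s) \<and> 0 \<notin> set (bs s)" if s: "s \<notin> bad" for s
  proof
    have "as ! i + of_real s * of_nat (Suc i) \<noteq> as ! j + of_real s * of_nat (Suc j)"
      if ij: "i < k" "j < k" "i \<noteq> j" for i j
    proof
      assume eq: "as ! i + of_real s * of_nat (Suc i) = as ! j + of_real s * of_nat (Suc j)"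
      have ne: "(of_nat (Suc i) - of_nat (Suc j) :: complex) \<noteq> 0"
        using ij(3) by simp
      have "of_real s * (of_nat (Suc i) - of_nat (Suc j)) = as ! j - as ! i"
        using eq by (simp add: algebra_simps)
      then have "of_real s = (as ! j - as ! i) / (of_nat (Suc i) - of_nat (Suc j))"
        by (simp only: nonzero_eq_divide_eq[OF ne])
      then have "s = Re ((as ! j - as ! i) / (of_nat (Suc i) - of_nat (Suc j)))"
        by (metis Re_complex_of_real)
      then have "s \<in> bad"
        unfolding bad_def using ij by (intro UnI2 image_eqI[of _ _ "(i, j)"]) auto
      then show False
        using s by blast
    qed
    then have "inj_on (\<lambda>i. as ! i + of_real s * of_nat (Suc i)) {0..<k}"
      unfolding inj_on_def by (metis atLeastLessThan_iff)
    then show "distinct (bs s)"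
      by (simp add: bs_def distinct_map del: of_nat_Suc)
    have "as ! i + of_real s * of_nat (Suc i) \<noteq> 0" if i: "i < k" for i
    proof
      assume "as ! i + of_real s * of_nat (Suc i) = 0"
      then have "of_real s * of_nat (Suc i) = - as ! i"
        by (simp only: add_eq_0_iff)
      moreover have "(of_nat (Suc i) :: complex) \<noteq> 0"
        by (simp only: of_nat_eq_0_iff)
      ultimately have "of_real s = - as ! i / of_nat (Suc i)"
        by (simp only: nonzero_eq_divide_eq not_False_eq_True)
      then have "s = Re (- as ! i / of_nat (Suc i))"
        by (metis Re_complex_of_real)
      then have "s \<in> bad"
        unfolding bad_def using i by (intro UnI1 image_eqI[of _ _ i]) auto
      then show False
        using s by blast
    qed
    then show "0 \<notin> set (bs s)"
      by (auto simp: bs_def simp del: of_nat_Suc)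
  qed
  show thesis
  proof
    show "P * D * Q \<in> carrier_mat k k"
      using PQ D by simp
    fix \<epsilon> :: real assume "0 < \<epsilon>"
    then have "infinite ({0<..<\<epsilon>} - bad)"
      using bad by (simp add: infinite_Ioo)
    then obtain s where "s \<in> {0<..<\<epsilon>} - bad"
      using infinite_imp_nonempty by blast
    then show "\<exists>s bs. 0 < s \<and> s < \<epsilon> \<and> char_poly (A + of_real s \<cdot>\<^sub>m (P * D * Q)) = (\<Prod>b\<leftarrow>bs. [:- b, 1:]) \<and>
       length bs = k \<and> distinct bs \<and> 0 \<notin> set bs"
      using good[of s] cp[of s] by (intro exI[of _ s] exI[of _ "bs s"]) (auto simp: bs_def)
  qed
qed

text \<open>
  The elements \<open>u i\<close> of \<open>Ae\<^sub>0\<close> and \<open>v i\<close> of \<open>e\<^sub>0A\<close> are dual bases; the products \<open>u i * v j\<close> are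
  matrix units of the corner \<open>unit A unit\<close>.
\<close>

locale dual_basis =
  fixes k :: nat and e0 :: "'a::complex_banach_algebra_1" and u v :: "nat \<Rightarrow> 'a"
  assumes minimal: "minimal_idempotent e0"
    and u: "\<And>i. i < k \<Longrightarrow> u i * e0 = u i"
    and v: "\<And>i. i < k \<Longrightarrow> e0 * v i = v i"
    and vu: "\<And>i j. i < k \<Longrightarrow> j < k \<Longrightarrow> v i * u j = (if i = j then e0 else 0)"
begin

definition unit :: 'a where
  "unit = (\<Sum>i<k. u i * v i)"

definition entry :: "'a \<Rightarrow> nat \<Rightarrow> nat \<Rightarrow> complex" where
  "entry x i j = corner_coeff e0 (v i * x * u j)"

definition matrix_of :: "'a \<Rightarrow> complex mat" where
  "matrix_of x = Matrix.mat k k (\<lambda>(i, j). entry x i j)"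

definition of_matrix :: "complex mat \<Rightarrow> 'a" where
  "of_matrix N = (\<Sum>i<k. \<Sum>j<k. N $$ (i, j) *\<^sub>C (u i * v j))"

lemma e0: "e0 * e0 = e0" "e0 \<noteq> 0"
  using minimal by (auto simp: minimal_idempotent_def)

lemma entry:
  assumes "i < k" and "j < k"
  shows "v i * x * u j = entry x i j *\<^sub>C e0"
proof -
  have "v i * x * u j = e0 * (v i * x * u j) * e0"
    using u[OF assms(2)] v[OF assms(1)] by (metis mult.assoc)
  then show ?thesis
    by (simp add: entry_def corner_coeff[OF minimal])
qed

lemma entry_unique:
  assumes "i < k" "j < k" "v i * x * u j = c *\<^sub>C e0"
  shows "entry x i j = c"
  using entry[OF assms(1,2), of x] assms(3) e0(2) by simp

lemma v_unit [simp]: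
  assumes "i < k"
  shows "v i * unit = v i"
proof -
  have "v i * unit = (\<Sum>j<k. v i * u j * v j)"
    by (simp add: unit_def sum_distrib_left mult.assoc)
  also have "\<dots> = (\<Sum>j<k. if j = i then v i else 0)"
    by (intro sum.cong) (use assms in \<open>auto simp: vu v\<close>)
  finally show ?thesis
    using assms by simp
qed

lemma unit_u [simp]:
  assumes "i < k"
  shows "unit * u i = u i"
proof -
  have "unit * u i = (\<Sum>j<k. u j * (v j * u i))"
    by (simp add: unit_def sum_distrib_right mult.assoc)
  also have "\<dots> = (\<Sum>j<k. if j = i then u i else 0)"
    by (intro sum.cong) (use assms in \<open>auto simp: vu u\<close>)
  finally show ?thesis
    using assms by simp
qed

lemma unit_unit: "unit * unit = unit"
proof -
  have "unit * unit = (\<Sum>i<k. unit * (u i * v i))"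
    by (subst (2) unit_def) (rule sum_distrib_left)
  also have "\<dots> = unit"
    by (simp add: flip: mult.assoc) (simp add: unit_def)
  finally show ?thesis .
qed

lemma entry_add: "entry (x + y) i j = entry x i j + entry y i j"
  by (simp add: entry_def distrib_left distrib_right corner_coeff_add[OF minimal])

lemma entry_scaleC: "entry (c *\<^sub>C x) i j = c * entry x i j"
  by (simp add: entry_def mult_scaleC_left mult_scaleC_right corner_coeff_scaleC[OF minimal])

lemma entry_unit_left [simp]: "i < k \<Longrightarrow> entry (unit * x) i j = entry x i j"
  by (simp add: entry_def flip: mult.assoc)

lemma entry_unit_right [simp]: "j < k \<Longrightarrow> entry (x * unit) i j = entry x i j"
  by (simp add: entry_def mult.assoc)

lemma corner_expansion: "unit * x * unit = of_matrix (matrix_of x)"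
proof -
  have "unit * x * unit = (\<Sum>i<k. \<Sum>j<k. u i * (v i * x * u j) * v j)"
    by (simp add: unit_def sum_distrib_left sum_distrib_right mult.assoc) (rule sum.swap)
  also have "\<dots> = (\<Sum>i<k. \<Sum>j<k. entry x i j *\<^sub>C (u i * v j))"
  proof (intro sum.cong refl)
    fix i j assume "i \<in> {..<k}" "j \<in> {..<k}"
    then show "u i * (v i * x * u j) * v j = entry x i j *\<^sub>C (u i * v j)"
      by (simp add: entry mult_scaleC_left mult_scaleC_right) (simp add: mult.assoc v)
  qed
  finally show ?thesis
    by (simp add: of_matrix_def matrix_of_def)
qed

lemma matrix_of_carrier [simp]: "matrix_of x \<in> carrier_mat k k"
  by (simp add: matrix_of_def)

lemma matrix_of_index [simp]: "i < k \<Longrightarrow> j < k \<Longrightarrow> matrix_of x $$ (i, j) = entry x i j"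
  by (simp add: matrix_of_def)

lemma matrix_of_dim [simp]: "dim_row (matrix_of x) = k" "dim_col (matrix_of x) = k"
  by (simp_all add: matrix_of_def)

lemma matrix_of_add: "matrix_of (x + y) = matrix_of x + matrix_of y"
  by (rule eq_matI) (simp_all add: entry_add)

lemma matrix_of_scaleC: "matrix_of (c *\<^sub>C x) = c \<cdot>\<^sub>m matrix_of x"
  by (rule eq_matI) (simp_all add: entry_scaleC)

text \<open>The entries see only the compression \<open>unit * x * unit\<close>, which is why
  \<open>unit\<close> stands between the factors.\<close>

lemma entry_mult:
  assumes "i < k" and "j < k"
  shows "entry (x * unit * y) i j = (\<Sum>l<k. entry x i l * entry y l j)"
proof (rule entry_unique[OF assms])
  have "v i * (x * unit * y) * u j = (\<Sum>l<k. (v i * x * u l) * (v l * y * u j))"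
    by (simp add: unit_def sum_distrib_left sum_distrib_right mult.assoc)
  also have "\<dots> = (\<Sum>l<k. (entry x i l * entry y l j) *\<^sub>C e0)"
    by (intro sum.cong)
      (simp_all add: entry assms mult_scaleC_left mult_scaleC_right scaleC_scaleC e0 mult.commute)
  finally show "v i * (x * unit * y) * u j = (\<Sum>l<k. entry x i l * entry y l j) *\<^sub>C e0"
    by (simp add: complex_scale.scale_sum_left)
qed

lemma matrix_of_mult: "matrix_of (x * unit * y) = matrix_of x * matrix_of y"
  by (rule eq_matI) (simp_all add: entry_mult scalar_prod_def atLeast0LessThan)

lemma matrix_of_unit: "matrix_of unit = 1\<^sub>m k"
proof (rule eq_matI)
  fix i j assume "i < dim_row (1\<^sub>m k :: complex mat)" "j < dim_col (1\<^sub>m k :: complex mat)"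
  then show "matrix_of unit $$ (i, j) = 1\<^sub>m k $$ (i, j)"
    by (auto intro!: entry_unique simp: vu scaleC_one)
qed simp_all

lemma matrix_of_of_matrix:
  assumes "N \<in> carrier_mat k k"
  shows "matrix_of (of_matrix N) = N"
proof (rule eq_matI)
  fix i j assume "i < dim_row N" "j < dim_col N"
  then have ij: "i < k" "j < k"
    using assms by auto
  have "v i * of_matrix N * u j = (\<Sum>l<k. \<Sum>m<k. N $$ (l, m) *\<^sub>C ((v i * u l) * (v m * u j)))"
    by (simp add: of_matrix_def sum_distrib_left sum_distrib_right mult_scaleC_left mult_scaleC_right mult.assoc)
  also have "\<dots> = (\<Sum>l<k. \<Sum>m<k. if l = i then if m = j then N $$ (i, j) *\<^sub>C e0 else 0 else 0)"
    by (intro sum.cong) (use ij in \<open>auto simp: vu e0\<close>)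
  also have "\<dots> = (\<Sum>l<k. if l = i then N $$ (i, j) *\<^sub>C e0 else 0)"
    by (intro sum.cong) (use ij in auto)
  also have "\<dots> = N $$ (i, j) *\<^sub>C e0"
    using ij by simp
  finally show "matrix_of (of_matrix N) $$ (i, j) = N $$ (i, j)"
    using ij by (simp add: entry_unique)
qed (use assms in auto)

lemma of_matrix_unit: "unit * of_matrix N = of_matrix N" "of_matrix N * unit = of_matrix N"
  by (simp_all add: of_matrix_def sum_distrib_left sum_distrib_right mult_scaleC_left
      mult_scaleC_right mult.assoc) (simp_all flip: mult.assoc)

lemma of_matrix_mult:
  assumes "N \<in> carrier_mat k k" and "N' \<in> carrier_mat k k"
  shows "of_matrix (N * N') = of_matrix N * of_matrix N'"
proof -
  have "of_matrix N * of_matrix N' = unit * (of_matrix N * unit * of_matrix N') * unit"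
    by (metis mult.assoc of_matrix_unit)
  also have "\<dots> = of_matrix (N * N')"
    by (simp only: corner_expansion matrix_of_mult matrix_of_of_matrix assms)
  finally show ?thesis
    by simp
qed

text \<open>The elements \<open>u i\<close> form a basis of \<open>unit A e0\<close>, on which
  \<open>z\<close> acts by its matrix. An eigenvector \<open>w\<close> therefore lifts to the
  element with coordinates \<open>w\<close>.\<close>

lemma spectrum_if_eigenvalue:
  assumes z: "unit * z = z" and ev: "eigenvalue (matrix_of z) c"
  obtains y where "z * y = c *\<^sub>C y" "y \<noteq> 0" "unit * y = y"
proof -
  obtain w where w: "w \<in> carrier_vec k" "w \<noteq> 0\<^sub>v k" "matrix_of z *\<^sub>v w = c \<cdot>\<^sub>v w"
    using ev by (auto simp: eigenvalue_def eigenvector_def)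
  define y where "y = (\<Sum>j<k. vec_index w j *\<^sub>C u j)"
  have vy: "v i * y = vec_index w i *\<^sub>C e0" if "i < k" for i
  proof -
    have "v i * y = (\<Sum>j<k. if j = i then vec_index w i *\<^sub>C e0 else 0)"
      unfolding y_def sum_distrib_left
      by (intro sum.cong) (use that in \<open>auto simp: mult_scaleC_right vu\<close>)
    then show ?thesis
      using that by simp
  qed
  have uy: "unit * y = y"
    unfolding y_def sum_distrib_left by (intro sum.cong) (simp_all add: mult_scaleC_right)
  have row: "(\<Sum>j<k. entry z i j * vec_index w j) = c * vec_index w i" if "i < k" for i
  proof -
    have "vec_index (matrix_of z *\<^sub>v w) i = c * vec_index w i"
      using w that by simp
    then show ?thesis
      using that w(1) by (simp add: scalar_prod_def atLeast0LessThan)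
  qed
  have zu: "z * u j = (\<Sum>i<k. entry z i j *\<^sub>C u i)" if "j < k" for j
  proof -
    have "z * u j = (\<Sum>i<k. u i * (v i * z * u j))"
      by (subst z[symmetric]) (simp add: unit_def sum_distrib_right mult.assoc)
    also have "\<dots> = (\<Sum>i<k. entry z i j *\<^sub>C u i)"
      by (intro sum.cong) (use that in \<open>simp_all add: entry mult_scaleC_right u\<close>)
    finally show ?thesis .
  qed
  have "z * y = (\<Sum>j<k. \<Sum>i<k. (entry z i j * vec_index w j) *\<^sub>C u i)"
    unfolding y_def sum_distrib_left
    by (intro sum.cong)
      (simp_all add: mult_scaleC_right zu complex_scale.scale_sum_right scaleC_scaleC mult.commute)
  also have "\<dots> = (\<Sum>i<k. (c * vec_index w i) *\<^sub>C u i)"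
    by (subst sum.swap) (simp add: row flip: complex_scale.scale_sum_left)
  also have "\<dots> = c *\<^sub>C y"
    by (simp add: y_def complex_scale.scale_sum_right scaleC_scaleC)
  finally have "z * y = c *\<^sub>C y" .
  moreover have "y \<noteq> 0"
  proof
    assume "y = 0"
    then have "vec_index w i = 0" if "i < k" for i
      using vy[OF that] e0(2) by simp
    then have "w = 0\<^sub>v k"
      using w(1) by (intro eq_vecI) auto
    then show False
      using w(2) by blast
  qed
  ultimately show thesis
    using that uy by blast
qed

text \<open>Lifted eigenvectors give one inclusion. Conversely, if \<open>c\<close> is no root, the
  adjugate inverts \<open>c - z\<close> inside the corner.\<close>

lemma nonzero_spectrum_corner:
  assumes z: "unit * z = z" "z * unit = z"
  shows "nonzero_spectrum z = {c. c \<noteq> 0 \<and> poly (char_poly (matrix_of z)) c = 0}"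
proof (intro equalityI subsetI)
  fix c assume "c \<in> {c. c \<noteq> 0 \<and> poly (char_poly (matrix_of z)) c = 0}"
  then have c: "c \<noteq> 0" "eigenvalue (matrix_of z) c"
    by (simp_all add: eigenvalue_root_char_poly[OF matrix_of_carrier])
  then obtain y where "z * y = c *\<^sub>C y" "y \<noteq> 0"
    using spectrum_if_eigenvalue[OF z(1)] by metis
  then show "c \<in> nonzero_spectrum z"
    using c(1) in_spectrum_if_eigenvector by (simp add: nonzero_spectrum_def)
next
  fix c assume "c \<in> nonzero_spectrum z"
  then have c: "c \<noteq> 0" "\<not> two_sided_invertible (c *\<^sub>C 1 - z)"
    by (simp_all add: nonzero_spectrum_def algebra_spectrum_def)
  have "poly (char_poly (matrix_of z)) c = 0"
  proof (rule ccontr)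
    define d where "d = poly (char_poly (matrix_of z)) c"
    assume "poly (char_poly (matrix_of z)) c \<noteq> 0"
    then have d: "d \<noteq> 0"
      by (simp add: d_def)
    define X where "X = - char_matrix (matrix_of z) c"
    have X: "X \<in> carrier_mat k k"
      by (simp add: X_def char_matrix_def)
    have detX: "Determinant.det X = d"
      by (simp add: X_def d_def char_poly_matrix[OF matrix_of_carrier])
    define Y where "Y = inverse d \<cdot>\<^sub>m adj_mat X"
    have Y: "Y \<in> carrier_mat k k"
      using adj_mat(1)[OF X] by (simp add: Y_def)
    have "X * Y = inverse d \<cdot>\<^sub>m (d \<cdot>\<^sub>m 1\<^sub>m k)" "Y * X = inverse d \<cdot>\<^sub>m (d \<cdot>\<^sub>m 1\<^sub>m k)"
      using adj_mat[OF X] by (simp_all add: Y_def detX mult_smult_distrib[OF X] mult_smult_assoc_mat[OF _ X])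
    moreover have "inverse d \<cdot>\<^sub>m (d \<cdot>\<^sub>m 1\<^sub>m k) = 1\<^sub>m k"
      by (rule eq_matI) (use d in auto)
    ultimately have XY: "X * Y = 1\<^sub>m k" "Y * X = 1\<^sub>m k"
      by simp_all
    have oX: "of_matrix X = c *\<^sub>C unit - z"
    proof -
      have "X = matrix_of (c *\<^sub>C unit + (- 1) *\<^sub>C z)"
        unfolding X_def matrix_of_add matrix_of_scaleC matrix_of_unit
        by (rule eq_matI) (auto simp: char_matrix_def)
      then have "of_matrix X = unit * (c *\<^sub>C unit + (- 1) *\<^sub>C z) * unit"
        by (simp only: corner_expansion)
      also have "\<dots> = c *\<^sub>C unit - z"
        by (simp add: distrib_left distrib_right left_diff_distrib right_diff_distrib mult_scaleC_left
            mult_scaleC_right unit_unit z scaleC_one)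
      finally show ?thesis .
    qed
    have o1: "of_matrix (1\<^sub>m k) = unit"
      using corner_expansion[of unit] by (simp add: matrix_of_unit unit_unit)
    \<comment> \<open>The second summand inverts the scalar \<open>c\<close>, which is nonzero, on
      the complement of \<open>unit\<close>.\<close>
    define w where "w = of_matrix Y + inverse c *\<^sub>C (1 - unit)"
    have cz: "c *\<^sub>C 1 - z = of_matrix X + c *\<^sub>C (1 - unit)"
      by (simp add: oX complex_scale.scale_right_diff_distrib)
    have orth: "of_matrix N * (1 - unit) = 0" "(1 - unit) * of_matrix N = 0" for N
      by (simp_all add: left_diff_distrib right_diff_distrib of_matrix_unit)
    have uu: "(1 - unit) * (1 - unit) = 1 - unit"
      by (simp add: left_diff_distrib right_diff_distrib unit_unit)
    have "(c *\<^sub>C 1 - z) * w = of_matrix (X * Y) + (1 - unit)"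
      "w * (c *\<^sub>C 1 - z) = of_matrix (Y * X) + (1 - unit)"
      unfolding w_def cz of_matrix_mult[OF X Y] of_matrix_mult[OF Y X]
      using c(1) by (simp_all only: distrib_left distrib_right mult_scaleC_left mult_scaleC_right orth uu
          scaleC_scaleC complex_scale.scale_zero_right add_0_left add_0_right)
        (simp_all add: scaleC_one)
    then have "(c *\<^sub>C 1 - z) * w = 1" "w * (c *\<^sub>C 1 - z) = 1"
      by (simp_all add: XY o1)
    then show False
      using c(2) unfolding two_sided_invertible_def by blast
  qed
  then show "c \<in> {c. c \<noteq> 0 \<and> poly (char_poly (matrix_of z)) c = 0}"
    using c(1) by simp
qed

text \<open>Elements such as \<open>x * a\<close> lie in \<open>A unit\<close> but in general not in
  the corner. Moving \<open>unit\<close> to the left changes neither the nonzero spectrum nor the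
  matrix.\<close>

lemma nonzero_spectrum_right_supported:
  assumes "z * unit = z"
  shows "nonzero_spectrum z = {c. c \<noteq> 0 \<and> poly (char_poly (matrix_of z)) c = 0}"
proof -
  have "nonzero_spectrum z = nonzero_spectrum (unit * z)"
    using nonzero_spectrum_commute[of z unit] by (simp add: assms)
  also have "\<dots> = {c. c \<noteq> 0 \<and> poly (char_poly (matrix_of (unit * z))) c = 0}"
    by (rule nonzero_spectrum_corner)
      (simp_all add: unit_unit assms mult.assoc flip: mult.assoc[of unit unit])
  also have "matrix_of (unit * z) = matrix_of z"
    by (rule eq_matI) simp_all
  finally show ?thesis .
qed

lemma entry_tendsto:
  assumes "x \<longlonglongrightarrow> y" and ij: "i < k" "j < k"
  shows "(\<lambda>n. entry (x n) i j) \<longlonglongrightarrow> entry y i j"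
proof -
  have bd: "cmod (entry z i j) \<le> norm z * (norm (v i) * norm (u j) / norm e0)" for z
  proof -
    have "cmod (entry z i j) * norm e0 = norm (v i * z * u j)"
      by (simp add: entry[OF ij] norm_scaleC)
    also have "\<dots> \<le> norm (v i) * norm z * norm (u j)"
      by (meson mult_right_mono norm_ge_zero norm_mult_ineq order.trans)
    finally show ?thesis
      using e0(2) by (simp add: field_simps)
  qed
  have diff: "entry (x n) i j - entry y i j = entry (x n - y) i j" for n
    using entry_add[of "x n - y" y i j] by simp
  have "(\<lambda>n. norm (x n - y) * (norm (v i) * norm (u j) / norm e0)) \<longlonglongrightarrow> 0"
    using assms(1) by (intro tendsto_mult_left_zero tendsto_norm_zero LIM_zero)
  then have "(\<lambda>n. entry (x n) i j - entry y i j) \<longlonglongrightarrow> 0"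
  proof (rule Lim_null_comparison[rotated])
    show "\<forall>\<^sub>F n in sequentially. norm (entry (x n) i j - entry y i j)
        \<le> norm (x n - y) * (norm (v i) * norm (u j) / norm e0)"
      unfolding diff by (intro always_eventually allI bd)
  qed
  then show ?thesis
    by (rule LIM_zero_cancel)
qed

end

section \<open>The spectral trace as a matrix trace\<close>

lemma poly_linear_factors_eq_0_iff:
  "poly (\<Prod>a\<leftarrow>as. [:- a, 1:]) z = 0 \<longleftrightarrow> z \<in> set as" for z :: complex
  by (auto simp: poly_linear_factors in_set_conv_nth)

lemma sum_list_eq_sum_count:
  fixes as :: "complex list"
  assumes "finite S" and "set as \<subseteq> S"
  shows "sum_list as = (\<Sum>c\<in>S. c * of_nat (count (mset as) c))"
  using assms(2)
proof (induction as)
  case (Cons a as)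
  have "(\<Sum>c\<in>S. c * of_nat (count (mset (a # as)) c))
      = (\<Sum>c\<in>S. c * of_nat (count (mset as) c) + (if c = a then a else 0))"
    by (intro sum.cong) (auto simp: algebra_simps)
  then show ?case
    using Cons assms(1) by (simp add: sum.distrib)
qed simp

context dual_basis
begin

context
  fixes a y :: 'a
  assumes au: "a * unit = a" and ya: "y * a = unit"
begin

lemma nonzero_spectrum_mult:
  assumes "char_poly (matrix_of (x * a)) = (\<Prod>b\<leftarrow>bs. [:- b, 1:])"
  shows "nonzero_spectrum (x * a) = set bs - {0}"
  using nonzero_spectrum_right_supported[of "x * a"]
  by (auto simp: au mult.assoc assms poly_linear_factors_eq_0_iff)

text \<open>Since \<open>y * a = unit\<close>, multiplying \<open>a\<close> by
  \<open>1 + s * d\<close> with \<open>d = of_matrix N * y\<close> adds exactly \<open>s\<close>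
  times \<open>N\<close> to its matrix. So matrix perturbations are realised by factors near
  1.\<close>

lemma simple_roots_dense:
  assumes "0 < \<epsilon>"
  obtains x bs where "x \<in> ball 1 \<epsilon>" "char_poly (matrix_of (x * a)) = (\<Prod>b\<leftarrow>bs. [:- b, 1:])"
    "length bs = k" "distinct bs" "0 \<notin> set bs"
proof -
  obtain N where N: "N \<in> carrier_mat k k"
    "\<And>\<epsilon>. 0 < \<epsilon> \<Longrightarrow> \<exists>s bs. 0 < s \<and> s < \<epsilon> \<and>
       char_poly (matrix_of a + of_real s \<cdot>\<^sub>m N) = (\<Prod>b\<leftarrow>bs. [:- b, 1:]) \<and>
       length bs = k \<and> distinct bs \<and> 0 \<notin> set bs"
    using char_poly_simple_perturbation[OF matrix_of_carrier[of a]] by blast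
  define d where "d = of_matrix N * y"
  have "0 < \<epsilon> / (norm d + 1)"
    using assms by (simp add: add_nonneg_pos)
  then obtain s bs where s: "0 < s" "s < \<epsilon> / (norm d + 1)"
    "char_poly (matrix_of a + of_real s \<cdot>\<^sub>m N) = (\<Prod>b\<leftarrow>bs. [:- b, 1:])"
    "length bs = k" "distinct bs" "0 \<notin> set bs"
    using N(2) by blast
  define x where "x = 1 + of_real s *\<^sub>C d"
  have "norm (x - 1) = s * norm d"
    using s(1) by (simp add: x_def norm_scaleC)
  also have "\<dots> \<le> s * (norm d + 1)"
    using s(1) by simp
  also have "\<dots> < \<epsilon>"
    using s(2) by (simp add: pos_less_divide_eq add_nonneg_pos)
  finally have "x \<in> ball 1 \<epsilon>"
    by (simp add: dist_norm norm_minus_commute)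
  moreover have "x * a = a + of_real s *\<^sub>C of_matrix N"
    by (simp add: x_def d_def distrib_right mult_scaleC_left mult.assoc ya of_matrix_unit)
  then have "matrix_of (x * a) = matrix_of a + of_real s \<cdot>\<^sub>m N"
    by (simp add: matrix_of_add matrix_of_scaleC matrix_of_of_matrix[OF N(1)])
  ultimately show thesis
    using that s by metis
qed

lemma spectral_rank_eq: "spectral_rank a = enat k"
proof (rule antisym)
  show "spectral_rank a \<le> enat k"
    unfolding spectral_rank_def
  proof (rule SUP_least)
    fix x
    obtain bs where bs: "char_poly (matrix_of (x * a)) = (\<Prod>b\<leftarrow>bs. [:- b, 1:])" "length bs = k"
      using char_poly_factorized[OF matrix_of_carrier] by blast
    have "card (set bs - {0}) \<le> card (set bs)"
      by (rule card_mono) auto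
    also have "\<dots> \<le> k"
      using card_length[of bs] bs(2) by simp
    finally show "num_elements (nonzero_spectrum (x * a)) \<le> enat k"
      by (simp add: nonzero_spectrum_mult[OF bs(1)] num_elements_def)
  qed
  have "(0::real) < 1"
    by simp
  then obtain x bs where bs: "char_poly (matrix_of (x * a)) = (\<Prod>b\<leftarrow>bs. [:- b, 1:])"
    "length bs = k" "distinct bs" "0 \<notin> set bs"
    by (rule simple_roots_dense) blast
  have "enat k = num_elements (nonzero_spectrum (x * a))"
    using bs(2-4) by (simp add: nonzero_spectrum_mult[OF bs(1)] num_elements_def distinct_card)
  also have "\<dots> \<le> spectral_rank a"
    unfolding spectral_rank_def by (rule SUP_upper) simp
  finally show "enat k \<le> spectral_rank a" .
qed

lemma rank_attaining_if_simple_roots: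
  assumes "char_poly (matrix_of (x * a)) = (\<Prod>b\<leftarrow>bs. [:- b, 1:])"
    and "length bs = k" "distinct bs" "0 \<notin> set bs"
  shows "x \<in> rank_attaining a"
  using assms(2-) by (simp add: rank_attaining_def spectral_rank_eq nonzero_spectrum_mult[OF assms(1)]
      num_elements_def distinct_card)

lemma rank_attaining_simple_roots:
  assumes "x \<in> rank_attaining a"
  obtains bs where "char_poly (matrix_of (x * a)) = (\<Prod>b\<leftarrow>bs. [:- b, 1:])"
    "length bs = k" "distinct bs" "0 \<notin> set bs"
proof -
  obtain bs where bs: "char_poly (matrix_of (x * a)) = (\<Prod>b\<leftarrow>bs. [:- b, 1:])" "length bs = k"
    using char_poly_factorized[OF matrix_of_carrier] by blast
  have card: "card (set bs - {0}) = k"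
    using assms by (simp add: rank_attaining_def spectral_rank_eq nonzero_spectrum_mult[OF bs(1)] num_elements_def)
  have "card (set bs - {0}) \<le> card (set bs)"
    by (rule card_mono) auto
  then have cs: "card (set bs) = k"
    using card card_length[of bs] bs(2) by linarith
  then have "distinct bs"
    using bs(2) by (intro card_distinct) simp
  moreover have "0 \<notin> set bs"
  proof
    assume "0 \<in> set bs"
    then have "card (set bs - {0}) < card (set bs)"
      by (intro psubset_card_mono) auto
    then show False
      using card cs by simp
  qed
  ultimately show thesis
    using that bs by blast
qed

text \<open>Lifting the eigenvector requires \<open>unit * a = a\<close>. If \<open>a\<close> were
  invertible, \<open>a * unit = a\<close> would force \<open>unit = 1\<close>, and the eigenvector
  could be lifted after all.\<close>

lemma zero_eigenvalue_imp_not_invertible: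
  assumes "eigenvalue (matrix_of a) 0"
  shows "0 \<in> algebra_spectrum a"
proof (rule ccontr)
  assume "0 \<notin> algebra_spectrum a"
  then have "two_sided_invertible (- a)"
    by (simp add: algebra_spectrum_def)
  then obtain b where b: "b * - a = 1"
    unfolding two_sided_invertible_def by blast
  have "unit = (b * - a) * unit"
    by (simp only: b mult_1_left)
  also have "\<dots> = b * - (a * unit)"
    by (simp add: mult.assoc)
  also have "\<dots> = 1"
    by (simp only: au b)
  finally have one: "unit = 1" .
  then obtain w where "a * w = 0 *\<^sub>C w" "w \<noteq> 0"
    using spectrum_if_eigenvalue[of a 0] assms by auto
  then show False
    using in_spectrum_if_eigenvector \<open>0 \<notin> algebra_spectrum a\<close> by blast
qed

text \<open>Multiplicities count the full spectrum in the disk, the matrix only the nonzero part. If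
  0 is in the disk, \<open>a\<close> is invertible, and so is \<open>x * a\<close> for
  \<open>x\<close> near 1.\<close>

lemma spectrum_near:
  assumes x: "x \<in> ball 1 1" and r: "0 < r" "c \<noteq> 0" "cball c r \<inter> algebra_spectrum a \<subseteq> {c}"
  shows "algebra_spectrum (x * a) \<inter> ball c r = nonzero_spectrum (x * a) \<inter> ball c r"
proof -
  have "0 \<notin> algebra_spectrum (x * a)" if 0: "0 \<in> ball c r"
  proof -
    have "0 \<notin> algebra_spectrum a"
      using r(2,3) ball_subset_cball[of c r] 0 by blast
    then have "two_sided_invertible (- a)"
      by (simp add: algebra_spectrum_def)
    moreover have "norm (1 - x) < 1"
      using x by (simp add: dist_norm)
    then have "two_sided_invertible x"
      using invertible_one_minus_if_norm_less[of "1 - x"] by simp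
    ultimately have "two_sided_invertible (x * - a)"
      by (intro invertible_mult)
    then show ?thesis
      by (simp add: algebra_spectrum_def)
  qed
  then show ?thesis
    by (auto simp: nonzero_spectrum_def)
qed

text \<open>Otherwise some \<open>x n\<close> tending to 1 give wrong counts. Along a subsequence
  their roots converge to those of \<open>a\<close>: roots with limit \<open>c\<close> end up in the
  disk, the others outside, and simplicity means that no root is counted twice.\<close>

lemma multiplicity_near:
  assumes as: "char_poly (matrix_of a) = (\<Prod>b\<leftarrow>as. [:- b, 1:])"
    and r: "0 < r" "c \<noteq> 0" "cball c r \<inter> algebra_spectrum a \<subseteq> {c}"
  shows "\<exists>\<epsilon>>0. \<forall>x\<in>rank_attaining a \<inter> ball 1 \<epsilon>.
    num_elements (algebra_spectrum (x * a) \<inter> ball c r) = enat (count (mset as) c)"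
proof (rule ccontr)
  assume neg: "\<not> ?thesis"
  have "\<forall>n. \<exists>x. x \<in> rank_attaining a \<and> x \<in> ball 1 (1 / Suc n) \<and>
      num_elements (algebra_spectrum (x * a) \<inter> ball c r) \<noteq> enat (count (mset as) c)"
  proof
    fix n
    have "0 < 1 / real (Suc n)"
      by simp
    then show "\<exists>x. x \<in> rank_attaining a \<and> x \<in> ball 1 (1 / Suc n) \<and>
      num_elements (algebra_spectrum (x * a) \<inter> ball c r) \<noteq> enat (count (mset as) c)"
      using neg by blast
  qed
  then obtain x where x: "\<And>n. x n \<in> rank_attaining a" "\<And>n. x n \<in> ball 1 (1 / Suc n)"
    and bad: "\<And>n. num_elements (algebra_spectrum (x n * a) \<inter> ball c r) \<noteq> enat (count (mset as) c)"
    by metis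
  have "\<forall>n. \<exists>bs. char_poly (matrix_of (x n * a)) = (\<Prod>b\<leftarrow>bs. [:- b, 1:]) \<and> length bs = k \<and> distinct bs \<and> 0 \<notin> set bs"
    using rank_attaining_simple_roots[OF x(1)] by metis
  then obtain bs where bs: "\<And>n. char_poly (matrix_of (x n * a)) = (\<Prod>b\<leftarrow>bs n. [:- b, 1:])"
    "\<And>n. length (bs n) = k" "\<And>n. distinct (bs n)" "\<And>n. 0 \<notin> set (bs n)"
    by metis
  have len: "length as = k"
  proof -
    obtain as' where as': "char_poly (matrix_of a) = (\<Prod>b\<leftarrow>as'. [:- b, 1:])" "length as' = k"
      using char_poly_factorized[OF matrix_of_carrier] by blast
    then have "mset as = mset as'"
      using as by (metis proots_linear_factors)
    then show ?thesis
      using as'(2) mset_eq_length by metis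
  qed
  have x1: "norm (x n - 1) < 1 / Suc n" for n
    using x(2)[of n] by (simp add: dist_norm norm_minus_commute)
  have ball1: "x n \<in> ball 1 1" for n
  proof -
    have "1 / real (Suc n) \<le> 1"
      by simp
    with x1[of n] have "norm (x n - 1) < 1"
      by (rule less_le_trans)
    then show ?thesis
      by (simp add: dist_norm norm_minus_commute)
  qed
  have "(\<lambda>n. x n - 1) \<longlonglongrightarrow> 0"
    by (rule Lim_null_comparison[OF _ LIMSEQ_Suc[OF lim_1_over_n]])
      (use x1 in \<open>auto intro!: always_eventually less_imp_le\<close>)
  then have "x \<longlonglongrightarrow> 1"
    by (rule LIM_zero_cancel)
  then have xa: "(\<lambda>n. x n * a) \<longlonglongrightarrow> 1 * a"
    by (rule tendsto_mult_right)
  have conv: "(\<lambda>n. poly (\<Prod>b\<leftarrow>bs n. [:- b, 1:]) z) \<longlonglongrightarrow> poly (\<Prod>b\<leftarrow>as. [:- b, 1:]) z" for z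
    unfolding bs(1)[symmetric] as[symmetric]
    using entry_tendsto[OF xa] by (intro char_poly_tendsto[where k = k]) simp_all
  have bound: "cmod b \<le> (norm (1::'a) + 1) * norm a" if "b \<in> set (bs n)" for b n
  proof -
    have "b \<in> nonzero_spectrum (x n * a)"
      using that bs(4)[of n] by (auto simp: nonzero_spectrum_mult[OF bs(1)])
    then have "cmod b \<le> norm (x n * a)"
      using spectrum_bound by (auto simp: nonzero_spectrum_def)
    also have "\<dots> \<le> norm (x n) * norm a"
      by (rule norm_mult_ineq)
    also have "\<dots> \<le> (norm (1::'a) + 1) * norm a"
    proof (rule mult_right_mono)
      have "norm (x n) - norm (1::'a) \<le> norm (x n - 1)"
        by (rule norm_triangle_ineq2)
      then show "norm (x n) \<le> norm (1::'a) + 1"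
        using ball1[of n] by (simp add: dist_norm norm_minus_commute)
    qed simp
    finally show ?thesis .
  qed
  have lbs: "length (bs n) = length as" for n
    by (simp add: bs(2) len)
  obtain q cs where q: "strict_mono q" and cs: "mset cs = mset as"
    and lim: "\<And>i. i < length as \<Longrightarrow> (\<lambda>n. bs (q n) ! i) \<longlonglongrightarrow> cs ! i"
    by (rule roots_converge[OF lbs bound conv]) blast+
  have lcs: "length cs = k"
    using cs len mset_eq_length by metis
  \<comment> \<open>The limits are eigenvalues and hence in the spectrum, where the value 0 needs
    \<open>zero_eigenvalue_imp_not_invertible\<close>. Excluding the closed disk leaves an open set
    for the approximating roots.\<close>
  have isolated: "cs ! i \<notin> cball c r" if i: "i < k" "cs ! i \<noteq> c" for i
  proof
    assume ci: "cs ! i \<in> cball c r"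
    have "cs ! i \<in> set as"
      using i(1) lcs cs mset_eq_setD nth_mem by metis
    then have "eigenvalue (matrix_of a) (cs ! i)"
      by (simp add: eigenvalue_root_char_poly[OF matrix_of_carrier] as poly_linear_factors_eq_0_iff)
    then have "cs ! i \<in> algebra_spectrum a"
      using zero_eigenvalue_imp_not_invertible nonzero_spectrum_mult[of 1 as] as \<open>cs ! i \<in> set as\<close>
      by (cases "cs ! i = 0") (auto simp: nonzero_spectrum_def)
    then show False
      using r(3) ci i(2) by blast
  qed
  have "\<forall>\<^sub>F n in sequentially. bs (q n) ! i \<in> ball c r \<longleftrightarrow> cs ! i = c" if i: "i < k" for i
  proof (cases "cs ! i = c")
    case True
    have "\<forall>\<^sub>F n in sequentially. bs (q n) ! i \<in> ball c r"
      by (rule topological_tendstoD[OF lim]) (use i len True r(1) in auto)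
    then show ?thesis
      using True by simp
  next
    case False
    have "\<forall>\<^sub>F n in sequentially. bs (q n) ! i \<in> - cball c r"
      by (rule topological_tendstoD[OF lim]) (use i len isolated[OF i False] in auto)
    then show ?thesis
      by (rule eventually_mono) (use False in auto)
  qed
  then have "\<forall>\<^sub>F n in sequentially. \<forall>i\<in>{..<k}. bs (q n) ! i \<in> ball c r \<longleftrightarrow> cs ! i = c"
    by (intro eventually_ball_finite) auto
  then obtain n where n: "\<And>i. i < k \<Longrightarrow> bs (q n) ! i \<in> ball c r \<longleftrightarrow> cs ! i = c"
    by (auto simp: eventually_sequentially)
  have "algebra_spectrum (x (q n) * a) \<inter> ball c r = set (bs (q n)) \<inter> ball c r"
    using spectrum_near[OF ball1 r] bs(4)[of "q n"] by (auto simp: nonzero_spectrum_mult[OF bs(1)])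
  moreover have "card (set (bs (q n)) \<inter> ball c r) = count (mset as) c"
  proof -
    have "set (bs (q n)) \<inter> ball c r = (\<lambda>i. bs (q n) ! i) ` {i. i < k \<and> cs ! i = c}"
      using n bs(2)[of "q n"] by (auto simp: set_conv_nth)
    moreover have "inj_on (\<lambda>i. bs (q n) ! i) {i. i < k \<and> cs ! i = c}"
      using bs(2,3)[of "q n"] by (auto simp: inj_on_def nth_eq_iff_index_eq)
    ultimately have "card (set (bs (q n)) \<inter> ball c r) = card {i. i < k \<and> cs ! i = c}"
      by (simp add: card_image)
    also have "\<dots> = length (filter (\<lambda>b. b = c) cs)"
      by (simp add: length_filter_conv_card lcs)
    also have "\<dots> = count (mset cs) c"
      by (induction cs) auto
    finally show ?thesis
      by (simp add: cs)
  qed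
  ultimately show False
    using bad[of "q n"] by (simp add: num_elements_def)
qed

lemma finite_spectrum: "finite (algebra_spectrum a)"
proof -
  obtain as where "char_poly (matrix_of (1 * a)) = (\<Prod>b\<leftarrow>as. [:- b, 1:])"
    using char_poly_factorized[OF matrix_of_carrier] by blast
  then have "finite (nonzero_spectrum (1 * a))"
    by (simp only: nonzero_spectrum_mult) simp
  then show ?thesis
    by (simp add: nonzero_spectrum_def)
qed

text \<open>For uniqueness, two candidate values are compared at one rank-attaining \<open>x\<close>
  in the smaller of their balls; \<open>simple_roots_dense\<close> supplies it.\<close>

lemma spectral_multiplicity_eq:
  assumes as: "char_poly (matrix_of a) = (\<Prod>b\<leftarrow>as. [:- b, 1:])" and c: "c \<noteq> 0"
  shows "spectral_multiplicity c a = count (mset as) c"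
  unfolding spectral_multiplicity_def
proof (rule the_equality)
  show "\<forall>r>0. cball c r \<inter> algebra_spectrum a \<subseteq> {c} \<longrightarrow>
      (\<exists>e>0. \<forall>x\<in>rank_attaining a \<inter> ball 1 e.
        num_elements (algebra_spectrum (x * a) \<inter> ball c r) = enat (count (mset as) c))"
  proof (intro allI impI)
    fix r :: real assume r: "0 < r" "cball c r \<inter> algebra_spectrum a \<subseteq> {c}"
    show "\<exists>e>0. \<forall>x\<in>rank_attaining a \<inter> ball 1 e.
        num_elements (algebra_spectrum (x * a) \<inter> ball c r) = enat (count (mset as) c)"
      by (rule multiplicity_near[OF as r(1) c r(2)])
  qed
next
  fix m
  assume m: "\<forall>r>0. cball c r \<inter> algebra_spectrum a \<subseteq> {c} \<longrightarrow>
      (\<exists>e>0. \<forall>x\<in>rank_attaining a \<inter> ball 1 e.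
        num_elements (algebra_spectrum (x * a) \<inter> ball c r) = enat m)"
  obtain r where r: "0 < r" "\<And>z. z \<in> algebra_spectrum a \<Longrightarrow> z \<noteq> c \<Longrightarrow> r \<le> dist c z"
    using finite_set_avoid[OF finite_spectrum, of c] by blast
  \<comment> \<open>Half the radius, because the closed disk must avoid the other spectral
    points.\<close>
  then have sub: "cball c (r / 2) \<inter> algebra_spectrum a \<subseteq> {c}"
    by fastforce
  obtain e1 where e1: "0 < e1" "\<And>x. x \<in> rank_attaining a \<inter> ball 1 e1 \<Longrightarrow>
      num_elements (algebra_spectrum (x * a) \<inter> ball c (r / 2)) = enat m"
    using m sub r(1) by (meson half_gt_zero)
  obtain e2 where e2: "0 < e2" "\<And>x. x \<in> rank_attaining a \<inter> ball 1 e2 \<Longrightarrow>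
      num_elements (algebra_spectrum (x * a) \<inter> ball c (r / 2)) = enat (count (mset as) c)"
    using multiplicity_near[OF as _ c sub] r(1) by (metis half_gt_zero)
  obtain x bs where x: "x \<in> ball 1 (min e1 e2)"
    and bs: "char_poly (matrix_of (x * a)) = (\<Prod>b\<leftarrow>bs. [:- b, 1:])" "length bs = k" "distinct bs" "0 \<notin> set bs"
    using simple_roots_dense[of "min e1 e2"] e1(1) e2(1) by auto
  have "x \<in> rank_attaining a"
    by (rule rank_attaining_if_simple_roots[OF bs])
  then show "m = count (mset as) c"
    using e1(2)[of x] e2(2)[of x] x by simp
qed

lemma spectral_trace_eq: "spectral_trace a = (\<Sum>i<k. entry a i i)"
proof -
  obtain as where as: "char_poly (matrix_of a) = (\<Prod>b\<leftarrow>as. [:- b, 1:])"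
    using char_poly_factorized[OF matrix_of_carrier] by blast
  \<comment> \<open>Adding 0 makes \<open>S\<close> contain both the spectrum and all roots. At 0
    the summands vanish whatever the multiplicity is.\<close>
  define S where "S = insert 0 (algebra_spectrum a)"
  have ns: "nonzero_spectrum a = set as - {0}"
    using nonzero_spectrum_mult[of 1 as] as by simp
  then have S: "finite S" "set as \<subseteq> S" "algebra_spectrum a \<subseteq> S"
    using finite_spectrum by (auto simp: S_def nonzero_spectrum_def)
  have "spectral_trace a = (\<Sum>c\<in>S. c * of_nat (spectral_multiplicity c a))"
    unfolding spectral_trace_def
    by (rule sum.mono_neutral_left) (use S in \<open>auto simp: S_def\<close>)
  also have "\<dots> = (\<Sum>c\<in>S. c * of_nat (count (mset as) c))"
    by (intro sum.cong refl) (metis mult_zero_left spectral_multiplicity_eq[OF as])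
  also have "\<dots> = sum_list as"
    by (rule sum_list_eq_sum_count[symmetric, OF S(1,2)])
  also have "\<dots> = (\<Sum>i<k. matrix_of a $$ (i, i))"
    by (rule sum_diagonal_eq_sum_roots[symmetric, OF matrix_of_carrier as])
  finally show ?thesis
    by simp
qed

end

end

section \<open>The characterisation of the trace\<close>

definition minimal_idempotents_linked :: "'a::complex_banach_algebra_1 itself \<Rightarrow> bool" where
  "minimal_idempotents_linked _ \<longleftrightarrow> (\<forall>g h :: 'a. minimal_idempotent g \<longrightarrow> minimal_idempotent h \<longrightarrow>
     (\<exists>x. g * x * h \<noteq> 0))"

lemma zero_in_socle: "(0::'a::complex_banach_algebra_1) \<in> socle"
  by (rule socle_if_finite_dimensional[of "{}"]) simp_all

lemma linear_functional_on_0: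
  assumes "linear_functional_on (socle::'a::complex_banach_algebra_1 set) f"
  shows "f 0 = 0"
proof -
  have "f (0 *\<^sub>C 0) = 0 * f 0"
    using assms zero_in_socle unfolding linear_functional_on_def by blast
  then show ?thesis
    by simp
qed

lemma spectral_trace_0: "spectral_trace (0::'a::complex_banach_algebra_1) = 0"
proof -
  have "c = 0" if "c \<in> algebra_spectrum (0::'a)" for c
    using spectrum_bound[OF that] by simp
  then show ?thesis
    unfolding spectral_trace_def by (intro sum.neutral) auto
qed

text \<open>A minimal idempotent is its own dual basis of length 1, whatever its links; this
  normalisation serves where linkedness is still to be shown.\<close>

lemma spectral_trace_minimal_idempotent:
  assumes e: "minimal_idempotent e"
  shows "spectral_trace e = 1"
proof -
  have ee: "e * e = e"
    using e by (simp add: minimal_idempotent_def)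
  interpret dual_basis 1 e "\<lambda>_. e" "\<lambda>_. e"
    by unfold_locales (simp_all add: e ee)
  have "unit = e"
    unfolding unit_def by (simp add: ee)
  then have "spectral_trace e = (\<Sum>i<1. entry e i i)"
    by (intro spectral_trace_eq[of e 1]) (simp_all add: ee)
  also have "\<dots> = entry e 0 0"
    by simp
  also have "\<dots> = 1"
    by (rule entry_unique) (simp_all add: ee scaleC_one)
  finally show ?thesis .
qed

context
  fixes ty :: "'a::complex_banach_algebra_1 itself"
  assumes semisimple: "semisimple_algebra ty"
begin

lemma linear_functional_on_sum:
  fixes x :: "'b \<Rightarrow> 'a"
  assumes f: "linear_functional_on socle f" and x: "\<And>i. i \<in> I \<Longrightarrow> x i \<in> socle"
  shows "(\<Sum>i\<in>I. x i) \<in> socle \<and> f (\<Sum>i\<in>I. x i) = (\<Sum>i\<in>I. f (x i))"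
  using x
proof (induction I rule: infinite_finite_induct)
  case (insert i I)
  then have "x i \<in> socle" "(\<Sum>i\<in>I. x i) \<in> socle" "f (\<Sum>i\<in>I. x i) = (\<Sum>i\<in>I. f (x i))"
    by simp_all
  then show ?case
    using insert.hyps f socle_add[OF semisimple, of "x i" "\<Sum>i\<in>I. x i"]
    by (simp add: linear_functional_on_def)
qed (simp_all add: zero_in_socle linear_functional_on_0[OF f])

end

text \<open>\<open>f a = f (unit * a)\<close> moves \<open>a\<close> into the corner. There
  \<open>f (u i * v j) = f (v j * u i)\<close> is \<open>f e0\<close> on the diagonal and 0 off
  it.\<close>

lemma (in dual_basis) tracial_functional_eq:
  fixes f :: "'a \<Rightarrow> complex" and ty :: "'a itself"
  assumes ss: "semisimple_algebra ty"
    and f: "linear_functional_on socle f"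
    and tracial: "\<forall>a\<in>socle. \<forall>b\<in>socle. f (a * b) = f (b * a)"
    and a: "a \<in> socle" "a * unit = a"
  shows "f a = f e0 * (\<Sum>i<k. entry a i i)"
proof -
  have usocle: "u i \<in> socle" if "i < k" for i
    using socle_mult_left[OF minimal_idempotent_socle[OF minimal], of "u i"] u[OF that] by simp
  have vsocle: "v i \<in> socle" if "i < k" for i
    using socle_mult_right[OF minimal_idempotent_socle[OF minimal], of "v i"] v[OF that] by simp
  have uv: "u i * v j \<in> socle" if "i < k" for i j
    by (rule socle_mult_right[OF usocle[OF that]])
  have inner: "(\<Sum>j<k. entry a i j *\<^sub>C (u i * v j)) \<in> socle \<and>
      f (\<Sum>j<k. entry a i j *\<^sub>C (u i * v j)) = (\<Sum>j<k. f (entry a i j *\<^sub>C (u i * v j)))"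
    if "i < k" for i
    by (rule linear_functional_on_sum[OF ss f]) (rule socle_scaleC[OF uv[OF that]])
  have "unit \<in> socle"
    unfolding unit_def
    using linear_functional_on_sum[OF ss f, of "{..<k}" "\<lambda>i. u i * v i"] uv by simp
  then have "f a = f (unit * a)"
    using tracial a by metis
  also have "unit * a = (\<Sum>i<k. \<Sum>j<k. entry a i j *\<^sub>C (u i * v j))"
    using corner_expansion[of a] a(2) by (simp add: mult.assoc of_matrix_def)
  also have "f \<dots> = (\<Sum>i<k. f (\<Sum>j<k. entry a i j *\<^sub>C (u i * v j)))"
    using inner by (intro linear_functional_on_sum[OF ss f, THEN conjunct2]) simp
  also have "\<dots> = (\<Sum>i<k. \<Sum>j<k. f (entry a i j *\<^sub>C (u i * v j)))"
    using inner by simp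
  also have "\<dots> = (\<Sum>i<k. \<Sum>j<k. if j = i then entry a i i * f e0 else 0)"
  proof (intro sum.cong refl)
    fix i j assume ij: "i \<in> {..<k}" "j \<in> {..<k}"
    have "f (u i * v j) = f (v j * u i)"
      using tracial usocle vsocle ij by simp
    also have "\<dots> = (if j = i then f e0 else 0)"
      using vu[of j i] ij linear_functional_on_0[OF f] by simp
    finally show "f (entry a i j *\<^sub>C (u i * v j)) = (if j = i then entry a i i * f e0 else 0)"
      using f uv[of i j] ij by (simp add: linear_functional_on_def)
  qed
  also have "\<dots> = f e0 * (\<Sum>i<k. entry a i i)"
    by (simp add: sum_distrib_left mult.commute)
  finally show ?thesis .
qed

context
  fixes ty :: "'a::complex_banach_algebra_1 itself"
  assumes semisimple: "semisimple_algebra ty"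
begin

text \<open>Every \<open>g i\<close> is compared with one fixed member \<open>e0\<close>:
  \<open>u i\<close> lies in \<open>g i A e0\<close>, \<open>v i\<close> in \<open>e0 A g i\<close>,
  and \<open>link_inverse\<close> normalises \<open>v i * u i\<close> to \<open>e0\<close>.\<close>

lemma dual_basis_of_family:
  fixes R :: "'a set"
  assumes R: "minimal_family R" "R \<noteq> {}"
    and linked: "minimal_idempotents_linked ty"
  obtains k e0 u v where "dual_basis k e0 u v" "dual_basis.unit k u v = \<Sum>R"
proof -
  have orth: "\<And>g h. g \<in> R \<Longrightarrow> h \<in> R \<Longrightarrow> g \<noteq> h \<Longrightarrow> g * h = 0" and fin: "finite R"
    and min: "\<And>g. g \<in> R \<Longrightarrow> minimal_idempotent g"
    using R(1) by (auto simp: minimal_family_def orthogonal_idempotents_def)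
  have idem: "g * g = g" "g \<noteq> 0" if "g \<in> R" for g
    using min[OF that] by (simp_all add: minimal_idempotent_def)
  define k where "k = card R"
  obtain g where g: "bij_betw g {0..<k} R"
    using ex_bij_betw_nat_finite[OF fin] unfolding k_def by blast
  have gR: "g i \<in> R" if "i < k" for i
    using g that by (auto simp: bij_betw_def)
  obtain e0 where e0: "e0 \<in> R"
    using R(2) by blast
  have "\<exists>x w. e0 * w * g i * x * e0 = e0" if i: "i < k" for i
  proof -
    obtain x where "g i * x * e0 \<noteq> 0"
      using linked min[OF gR[OF i]] min[OF e0] unfolding minimal_idempotents_linked_def by blast
    then show ?thesis
      using link_inverse[OF semisimple min[OF e0]] by metis
  qed
  then obtain x w where xw: "\<And>i. i < k \<Longrightarrow> e0 * w i * g i * x i * e0 = e0"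
    by metis
  define u where "u i = g i * x i * e0" for i
  define v where "v i = e0 * w i * g i" for i
  have vu: "v i * u j = (if i = j then e0 else 0)" if "i < k" "j < k" for i j
  proof -
    have "v i * u j = e0 * w i * (g i * g j) * x j * e0"
      by (simp add: u_def v_def mult.assoc)
    moreover have "g i \<noteq> g j" if "i \<noteq> j"
      using g \<open>i < k\<close> \<open>j < k\<close> that by (auto simp: bij_betw_def inj_on_def)
    then have "g i * g j = (if i = j then g i else 0)"
      using orth idem gR that by auto
    ultimately show ?thesis
      using xw[OF that(1)] by (cases "i = j") auto
  qed
  have db: "dual_basis k e0 u v"
    by unfold_locales
      (simp_all add: min[OF e0] u_def mult.assoc idem[OF e0] v_def vu[unfolded u_def v_def mult.assoc]
        flip: mult.assoc[of e0 e0])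
  \<comment> \<open>Minimality of \<open>g i\<close> gives the equation up to a scalar
    \<open>c\<close>; squaring \<open>v i * u i = e0\<close> shows \<open>c = 1\<close>.\<close>
  have uv: "u i * v i = g i" if i: "i < k" for i
  proof -
    obtain c where c: "g i * (x i * e0 * (e0 * w i)) * g i = c *\<^sub>C g i"
      using min[OF gR[OF i]] unfolding minimal_idempotent_def by blast
    have uvc: "u i * v i = c *\<^sub>C g i"
      using c by (simp only: u_def v_def mult.assoc)
    have "v i * (u i * v i) * u i = (v i * u i) * (v i * u i)"
      by (simp only: mult.assoc)
    also have "\<dots> = e0"
      using vu[OF i i] idem[OF e0] by simp
    finally have "c *\<^sub>C (v i * g i * u i) = e0"
      by (simp add: uvc mult_scaleC_left mult_scaleC_right)
    moreover have "v i * g i = v i"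
      by (simp add: v_def mult.assoc idem[OF gR[OF i]])
    ultimately have "c *\<^sub>C e0 = 1 *\<^sub>C e0"
      using vu[OF i i] by (simp add: scaleC_one)
    then have "c = 1"
      using idem(2)[OF e0] complex_scale.scale_right_imp_eq by blast
    then show ?thesis
      by (simp add: uvc scaleC_one)
  qed
  have "dual_basis.unit k u v = (\<Sum>i<k. g i)"
    by (simp add: dual_basis.unit_def[OF db] uv)
  also have "\<dots> = \<Sum>R"
    using sum.reindex_bij_betw[OF g, of "\<lambda>x. x"] by (simp add: atLeast0LessThan)
  finally show thesis
    using that db by blast
qed

lemma tracial_functional_eq_spectral_trace:
  fixes f :: "'a \<Rightarrow> complex"
  assumes linked: "minimal_idempotents_linked ty"
    and f: "linear_functional_on socle f"
    and tracial: "\<forall>a\<in>socle. \<forall>b\<in>socle. f (a * b) = f (b * a)"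
    and a: "a \<in> socle" "a \<noteq> 0"
  obtains e where "minimal_idempotent e" "f a = f e * spectral_trace a"
proof -
  obtain R y where R: "minimal_family R" "\<Sum>R = y * a" "a * \<Sum>R = a"
    using socle_right_unit[OF semisimple a(1)] by metis
  then have "R \<noteq> {}"
    using a(2) by auto
  then obtain k e0 u v where db: "dual_basis k e0 u v" "dual_basis.unit k u v = \<Sum>R"
    using dual_basis_of_family[OF R(1) _ linked] by metis
  interpret dual_basis k e0 u v
    by (rule db(1))
  have au: "a * unit = a" and ya: "y * a = unit"
    using R(2,3) by (simp_all add: db(2))
  have "f a = f e0 * spectral_trace a"
    using tracial_functional_eq[OF semisimple f tracial a(1) au] spectral_trace_eq[OF au ya] by simp
  then show thesis
    using that minimal by blast
qed

text \<open>A link makes the idempotents equivalent, \<open>g = X * Y\<close> and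
  \<open>h = Y * X\<close>, and a tracial functional does not distinguish these products.\<close>

lemma tracial_functional_minimal_idempotents:
  fixes f :: "'a \<Rightarrow> complex"
  assumes linked: "minimal_idempotents_linked ty"
    and tracial: "\<forall>a\<in>socle. \<forall>b\<in>socle. f (a * b) = f (b * a)"
    and g: "minimal_idempotent g" and h: "minimal_idempotent h"
  shows "f g = f h"
proof -
  obtain x where x: "g * x * h \<noteq> 0"
    using linked g h unfolding minimal_idempotents_linked_def by blast
  obtain w where w: "h * w * g * x * h = h"
    using link_inverse[OF semisimple h x] by metis
  define X where "X = g * x * h"
  define Y where "Y = h * w * g"
  have idem: "g * g = g" "h * h = h"
    using g h by (simp_all add: minimal_idempotent_def)
  have "Y * X = h * w * (g * g) * x * h"
    by (simp only: X_def Y_def mult.assoc)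
  then have YX: "Y * X = h"
    by (simp only: idem w)
  obtain c where c: "g * (x * h * (h * w)) * g = c *\<^sub>C g"
    using g unfolding minimal_idempotent_def by blast
  then have XY: "X * Y = c *\<^sub>C g"
    by (simp only: X_def Y_def mult.assoc)
  have "g * X = X" "X * h = X"
    by (simp_all add: X_def mult.assoc idem) (simp flip: mult.assoc add: idem)
  then have "c *\<^sub>C X = 1 *\<^sub>C X"
    using XY YX by (metis mult.assoc mult_scaleC_left scaleC_one)
  then have "c = 1"
    using x complex_scale.scale_right_imp_eq unfolding X_def by blast
  then have "X * Y = g"
    by (simp add: XY scaleC_one)
  moreover have "X \<in> socle" "Y \<in> socle"
    unfolding X_def Y_def mult.assoc
    by (intro socle_mult_right minimal_idempotent_socle g h)+
  then have "f (X * Y) = f (Y * X)"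
    using tracial by blast
  ultimately show ?thesis
    by (simp add: YX)
qed

text \<open>The functional \<open>trace_on\<close> over all components is tracial and equals 1 at
  every minimal idempotent. Through this identity the spectral trace inherits invariance under
  swapping factors.\<close>

lemma spectral_trace_eq_trace_on:
  assumes linked: "minimal_idempotents_linked ty" and a: "a \<in> socle"
  shows "spectral_trace a = trace_on (\<lambda>_. True) (a::'a)"
proof (cases "a = 0")
  case True
  have P: "link_invariant (\<lambda>_::'a. True)"
    by (simp add: link_invariant_def)
  show ?thesis
    using linear_functional_on_0[OF trace_on_linear[OF semisimple P]] by (simp add: True spectral_trace_0)
next
  case False
  have P: "link_invariant (\<lambda>_::'a. True)"
    by (simp add: link_invariant_def)
  obtain e :: 'a where "minimal_idempotent e"
    "trace_on (\<lambda>_. True) a = trace_on (\<lambda>_. True) e * spectral_trace a"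
    by (rule tracial_functional_eq_spectral_trace[OF linked trace_on_linear[OF semisimple P] _ a False])
      (use trace_on_commute[OF semisimple P] in blast)+
  then show ?thesis
    using trace_on_minimal[OF semisimple P] by simp
qed

lemma trace_characterization_if_linked:
  fixes f :: "'a \<Rightarrow> complex"
  assumes linked: "minimal_idempotents_linked ty" and f: "linear_functional_on socle f"
  shows "(\<exists>\<alpha>. \<forall>a\<in>socle. f a = \<alpha> * spectral_trace a) \<longleftrightarrow>
    (\<forall>a\<in>socle. \<forall>b\<in>socle. f (a * b) = f (b * a))"
proof
  have P: "link_invariant (\<lambda>_::'a. True)"
    by (simp add: link_invariant_def)
  assume "\<exists>\<alpha>. \<forall>a\<in>socle. f a = \<alpha> * spectral_trace a"
  then obtain \<alpha> where \<alpha>: "\<And>a. a \<in> socle \<Longrightarrow> f a = \<alpha> * trace_on (\<lambda>_. True) a"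
    using spectral_trace_eq_trace_on[OF linked] by auto
  show "\<forall>a\<in>socle. \<forall>b\<in>socle. f (a * b) = f (b * a)"
    by (simp add: \<alpha> socle_mult_left trace_on_commute[OF semisimple P])
next
  assume tracial: "\<forall>a\<in>socle. \<forall>b\<in>socle. f (a * b) = f (b * a)"
  \<comment> \<open>If there is no minimal idempotent, the socle is zero and any value will do;
    otherwise \<open>f\<close> is the same at all of them.\<close>
  define \<alpha> where "\<alpha> = f (SOME e. minimal_idempotent e)"
  have "f a = \<alpha> * spectral_trace a" if a: "a \<in> socle" for a
  proof (cases "a = 0")
    case True
    then show ?thesis
      by (simp add: linear_functional_on_0[OF f] spectral_trace_0)
  next
    case False
    obtain e where e: "minimal_idempotent e" "f a = f e * spectral_trace a"
      by (rule tracial_functional_eq_spectral_trace[OF linked f tracial a False])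
    have "minimal_idempotent (SOME e::'a. minimal_idempotent e)"
      using e(1) by (rule someI)
    then have "f e = \<alpha>"
      unfolding \<alpha>_def by (rule tracial_functional_minimal_idempotents[OF linked tracial e(1)])
    then show ?thesis
      using e(2) by simp
  qed
  then show "\<exists>\<alpha>. \<forall>a\<in>socle. f a = \<alpha> * spectral_trace a"
    by blast
qed

text \<open>
  If \<open>g A h = 0\<close>, the trace of the component of \<open>h\<close> takes the value \<open>1\<close> at \<open>h\<close> and \<open>0\<close> at \<open>g\<close>, whereas
  \<open>Tr\<close> is \<open>1\<close> at both.
\<close>

lemma linked_if_trace_characterization:
  assumes "\<And>f :: 'a \<Rightarrow> complex. linear_functional_on socle f \<Longrightarrow>
    \<forall>a\<in>socle. \<forall>b\<in>socle. f (a * b) = f (b * a) \<Longrightarrow> \<exists>\<alpha>. \<forall>a\<in>socle. f a = \<alpha> * spectral_trace a"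
  shows "minimal_idempotents_linked ty"
  unfolding minimal_idempotents_linked_def
proof (intro allI impI)
  fix g h :: 'a
  assume gh: "minimal_idempotent g" "minimal_idempotent h"
  define P where "P x \<longleftrightarrow> (\<exists>y. x * y * h \<noteq> 0)" for x
  have P: "link_invariant P"
    unfolding P_def by (rule link_invariant_linked[OF semisimple gh(2)])
  obtain \<alpha> where \<alpha>: "\<And>a. a \<in> socle \<Longrightarrow> trace_on P a = \<alpha> * spectral_trace a"
    using assms[OF trace_on_linear[OF semisimple P]] trace_on_commute[OF semisimple P] by blast
  have "h * 1 * h \<noteq> 0"
    using gh(2) by (simp add: minimal_idempotent_def)
  then have "P h"
    unfolding P_def by blast
  then have "\<alpha> = 1"
    using \<alpha>[OF minimal_idempotent_socle[OF gh(2)]]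
    by (simp add: trace_on_minimal[OF semisimple P gh(2)] spectral_trace_minimal_idempotent[OF gh(2)])
  then have "of_bool (P g) = (1::complex)"
    using \<alpha>[OF minimal_idempotent_socle[OF gh(1)]]
    by (simp add: trace_on_minimal[OF semisimple P gh(1)] spectral_trace_minimal_idempotent[OF gh(1)])
  then show "\<exists>x. g * x * h \<noteq> 0"
    by (simp add: P_def split: if_splits)
qed

lemma corner_matrix_algebra_if_linked:
  fixes p :: 'a
  assumes linked: "minimal_idempotents_linked ty" and p: "p \<in> socle" "p * p = p"
  shows "\<exists>n. iso_matrix_algebra (corner p) n"
proof -
  obtain R where R: "minimal_family R" "\<Sum>R = p"
    using idempotent_minimal_family[OF semisimple p] by metis
  show ?thesis
  proof (cases "R = {}")
    \<comment> \<open>A dual basis needs a base idempotent \<open>e0\<close>. The empty family means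
      \<open>p = 0\<close> and is matched with the empty matrix.\<close>
    case True
    then have "corner p = {0}"
      using R(2) by (auto simp: corner_def)
    moreover have "carrier_mat 0 0 = {0\<^sub>m 0 0 :: complex mat}"
      by auto
    ultimately have "iso_matrix_algebra (corner p) 0"
      unfolding iso_matrix_algebra_def
      by (intro exI[of _ "\<lambda>_. 0\<^sub>m 0 0"]) (auto simp: bij_betw_def)
    then show ?thesis
      by blast
  next
    case False
    then obtain k e0 u v where db: "dual_basis k e0 u v" "dual_basis.unit k u v = \<Sum>R"
      using dual_basis_of_family[OF R(1) _ linked] by metis
    interpret dual_basis k e0 u v
      by (rule db(1))
    have unit: "unit = p"
      using db(2) R(2) by simp
    have "p * (p * x * p) = p * p * x * p" "(p * x * p) * p = p * x * (p * p)" for x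
      by (simp_all only: mult.assoc)
    then have corner: "p * x = x" "x * p = x" if "x \<in> corner p" for x
      using that by (auto simp: corner_def p(2))
    have "bij_betw matrix_of (corner p) (carrier_mat k k)"
    proof (rule bij_betw_byWitness[of _ of_matrix])
      show "\<forall>x\<in>corner p. of_matrix (matrix_of x) = x"
        using corner by (simp add: unit flip: corner_expansion)
      show "\<forall>N\<in>carrier_mat k k. matrix_of (of_matrix N) = N"
        by (simp add: matrix_of_of_matrix)
      show "matrix_of ` corner p \<subseteq> carrier_mat k k"
        by auto
      have "of_matrix N = p * of_matrix N * p" for N
        using of_matrix_unit[of N] by (simp add: unit)
      then show "of_matrix ` carrier_mat k k \<subseteq> corner p"
        unfolding corner_def by blast
    qed
    moreover have "matrix_of (x * y) = matrix_of x * matrix_of y" if "x \<in> corner p" for x y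
      using matrix_of_mult[of x y] corner(2)[OF that] by (simp add: unit)
    ultimately have "iso_matrix_algebra (corner p) k"
      unfolding iso_matrix_algebra_def
      by (intro exI[of _ matrix_of]) (simp add: matrix_of_add matrix_of_scaleC)
    then show ?thesis
      by blast
  qed
qed

text \<open>A common unit \<open>r\<close> places \<open>g\<close> and \<open>h\<close> in one
  corner, which is a matrix algebra. A suitable matrix unit between two nonzero matrices gives a
  nonzero product.\<close>

lemma linked_if_corner_matrix_algebra:
  assumes iso: "\<And>p::'a. p \<in> socle \<Longrightarrow> p * p = p \<Longrightarrow> \<exists>n. iso_matrix_algebra (corner p) n"
  shows "minimal_idempotents_linked ty"
  unfolding minimal_idempotents_linked_def
proof (intro allI impI)
  fix g h :: 'a
  assume gh: "minimal_idempotent g" "minimal_idempotent h"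
  obtain R where R: "minimal_family R" "\<And>s. s \<in> {g, h} \<Longrightarrow> \<Sum>R * s = s \<and> s * \<Sum>R = s"
    using common_unit[OF semisimple, of "{g, h}"] minimal_idempotent_socle gh by auto
  define r where "r = \<Sum>R"
  have rr: "r * r = r"
    unfolding r_def by (rule orthogonal_sum_idempotent) (use R(1) in \<open>simp add: minimal_family_def\<close>)
  \<comment> \<open>\<open>linear_functional_on_sum\<close> carries the closure of the socle under
    finite sums; \<open>trace_on\<close> serves as the functional it asks for.\<close>
  have "r \<in> socle"
    unfolding r_def
    by (rule linear_functional_on_sum[OF semisimple trace_on_linear[OF semisimple, of "\<lambda>_. True"], THEN conjunct1])
      (use R(1) minimal_idempotent_socle in \<open>auto simp: link_invariant_def minimal_family_def\<close>)
  then obtain n where "iso_matrix_algebra (corner r) n"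
    using iso rr by blast
  then obtain \<phi> :: "'a \<Rightarrow> complex mat" where bij: "bij_betw \<phi> (corner r) (carrier_mat n n)"
    and add: "\<And>x y. x \<in> corner r \<Longrightarrow> y \<in> corner r \<Longrightarrow> \<phi> (x + y) = \<phi> x + \<phi> y"
    and mult: "\<And>x y. x \<in> corner r \<Longrightarrow> y \<in> corner r \<Longrightarrow> \<phi> (x * y) = \<phi> x * \<phi> y"
    unfolding iso_matrix_algebra_def by blast
  have cornerI: "x \<in> corner r" if "r * x = x" "x * r = x" for x
    unfolding corner_def using that by (intro CollectI exI[of _ x]) simp
  have inr: "g \<in> corner r" "h \<in> corner r" "0 \<in> corner r"
    by (rule cornerI; use R(2)[of g] R(2)[of h] in \<open>simp add: r_def\<close>)+
  have corner: "r * x = x" "x * r = x" if "x \<in> corner r" for x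
  proof -
    obtain y where "x = r * y * r"
      using \<open>x \<in> corner r\<close> by (auto simp: corner_def)
    moreover have "r * (r * y * r) = r * r * y * r" "(r * y * r) * r = r * y * (r * r)"
      by (simp_all only: mult.assoc)
    ultimately show "r * x = x" "x * r = x"
      by (simp_all add: rr)
  qed
  have prod: "x * y \<in> corner r" if "x \<in> corner r" "y \<in> corner r" for x y
    using corner that by (intro cornerI) (simp_all add: mult.assoc, simp flip: mult.assoc)
  have carr: "\<phi> x \<in> carrier_mat n n" if "x \<in> corner r" for x
    using bij that by (auto simp: bij_betw_def)
  have \<phi>0: "\<phi> 0 = 0\<^sub>m n n"
  proof (rule eq_matI)
    fix i j assume "i < dim_row (0\<^sub>m n n :: complex mat)" "j < dim_col (0\<^sub>m n n :: complex mat)"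
    then have ij: "i < n" "j < n"
      by simp_all
    have "\<phi> 0 = \<phi> 0 + \<phi> 0"
      using add[OF inr(3,3)] by simp
    then have "\<phi> 0 $$ (i, j) = (\<phi> 0 + \<phi> 0) $$ (i, j)"
      by simp
    also have "\<dots> = \<phi> 0 $$ (i, j) + \<phi> 0 $$ (i, j)"
      using carr[OF inr(3)] ij by simp
    finally show "\<phi> 0 $$ (i, j) = 0\<^sub>m n n $$ (i, j)"
      using ij by simp
  qed (use carr[OF inr(3)] in auto)
  have nonzero: "\<exists>i<n. \<exists>j<n. \<phi> x $$ (i, j) \<noteq> 0" if x: "x \<in> corner r" "x \<noteq> 0" for x
  proof (rule ccontr)
    assume "\<not> ?thesis"
    then have "\<phi> x = \<phi> 0"
      unfolding \<phi>0 by (intro eq_matI) (use carr[OF x(1)] in auto)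
    then show False
      using bij x inr(3) by (auto simp: bij_betw_def inj_on_def)
  qed
  obtain i j where ij: "i < n" "j < n" "\<phi> g $$ (i, j) \<noteq> 0"
    using nonzero[OF inr(1)] gh(1) by (auto simp: minimal_idempotent_def)
  obtain l m where lm: "l < n" "m < n" "\<phi> h $$ (l, m) \<noteq> 0"
    using nonzero[OF inr(2)] gh(2) by (auto simp: minimal_idempotent_def)
  \<comment> \<open>The matrix unit at \<open>(j, l)\<close> joins the two chosen nonzero entries,
    so their product appears at position \<open>(i, m)\<close>.\<close>
  define N :: "complex mat" where "N = Matrix.mat n n (\<lambda>(s, t). if s = j \<and> t = l then 1 else 0)"
  have N: "N \<in> carrier_mat n n"
    by (simp add: N_def)
  obtain x where x: "x \<in> corner r" "\<phi> x = N"
    using bij N by (metis bij_betw_iff_bijections)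
  have "(\<phi> g * N) $$ (i, t) = (if t = l then \<phi> g $$ (i, j) else 0)" if "t < n" for t
  proof -
    have "(\<phi> g * N) $$ (i, t) = (\<Sum>s<n. \<phi> g $$ (i, s) * N $$ (s, t))"
      by (rule index_mult_square_mat[OF carr[OF inr(1)] N ij(1) that])
    also have "\<dots> = (\<Sum>s<n. if s = j then (if t = l then \<phi> g $$ (i, j) else 0) else 0)"
      by (intro sum.cong) (use that in \<open>auto simp: N_def\<close>)
    finally show ?thesis
      using ij by simp
  qed
  note row = this
  have "(\<phi> g * N * \<phi> h) $$ (i, m) = (\<Sum>t<n. (\<phi> g * N) $$ (i, t) * \<phi> h $$ (t, m))"
    by (rule index_mult_square_mat[OF mult_carrier_mat[OF carr[OF inr(1)] N] carr[OF inr(2)] ij(1) lm(2)])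
  also have "\<dots> = (\<Sum>t<n. if t = l then \<phi> g $$ (i, j) * \<phi> h $$ (l, m) else 0)"
    by (intro sum.cong) (auto simp: row)
  also have "\<dots> = \<phi> g $$ (i, j) * \<phi> h $$ (l, m)"
    using lm by simp
  finally have "(\<phi> g * N * \<phi> h) $$ (i, m) \<noteq> 0"
    using ij lm by simp
  moreover have "\<phi> (g * x * h) = \<phi> g * N * \<phi> h"
    using inr x prod mult by simp
  ultimately have "\<phi> (g * x * h) $$ (i, m) \<noteq> \<phi> 0 $$ (i, m)"
    using ij lm by (simp add: \<phi>0)
  then have "g * x * h \<noteq> 0"
    by auto
  then show "\<exists>x. g * x * h \<noteq> 0"
    by blast
qed

end

theorem theorem3p9:
  assumes "semisimple_algebra TYPE('a::complex_banach_algebra_1)"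
  shows "(\<forall>f :: 'a \<Rightarrow> complex. linear_functional_on socle f \<longrightarrow>
            ((\<exists>\<alpha>. \<forall>a\<in>socle. f a = \<alpha> * spectral_trace a) \<longleftrightarrow>
             (\<forall>a\<in>socle. \<forall>b\<in>socle. f (a * b) = f (b * a))))
         \<longleftrightarrow>
         (\<forall>p :: 'a. p * p = p \<and> spectral_rank p < \<infinity> \<longrightarrow>
            (\<exists>n. iso_matrix_algebra (corner p) n))"
    (is "?I \<longleftrightarrow> ?II")
proof
  assume I: ?I
  have "minimal_idempotents_linked TYPE('a)"
    by (rule linked_if_trace_characterization[OF assms]) (use I in blast)
  then show ?II
    using corner_matrix_algebra_if_linked[OF assms] by (simp add: socle_def)
next
  assume II: ?II
  have "minimal_idempotents_linked TYPE('a)"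
    by (rule linked_if_corner_matrix_algebra[OF assms]) (use II in \<open>simp add: socle_def\<close>)
  then show ?I
    using trace_characterization_if_linked[OF assms] by blast
qed

end
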